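(* The braided Thompson group $BV$ has a linear divergence function; that is, there exists $\delta\in(0,1)$ such that the $\delta$-divergence function of $BV$ (with respect to a finite generating set) is equivalent to a linear function.
   Context: **The group $BV$.** Finite rooted binary trees: every interior vertex has a left child (edge labelled $0$) and a right child (edge labelled $1$); a caret is an interior vertex together with its two downward edges; leaves are numbered from left to right starting from $0$. A tree-braid-tree diagram is a triple $(T_+,br,T_-)$ where $T_+,T_-$ are finite rooted binary trees with the same number $n$ of carets (hence $n+1$ leaves) and $br\in B_{n+1}$ is a braid on $n+1$ strands (up to isotopy) whose strands run from the leaves of $T_+$ to the leaves of $T_-$. Splitting of the $i$-th strand: attach a caret to the $i$-th leaf of $T_+$ and to the corresponding leaf of $T_-$, and replace the strand $b_i$ by two parallel strands $b_i,b_i'$, where $b_i'$ is immediately to the right of $b_i$, does not cross $b_i$, and crosses the other strands in the same way as $b_i$ does. The inverse operation is called reduction. Two diagrams are equivalent if they are related by finitely many splittings and reductions; $BV$ is the set of equivalence classes. Product: given $a,b\in BV$, choose representatives $(A_+,br_A,A_-)$ and $(B_+,br_B,B_-)$ with $A_-=B_+$; then $ab$ is the class of $(A_+,br_Abr_B,B_-)$, where $br_Abr_B$ is $br_A$ followed by $br_B$. The group $BV$ is finitely generated. **Divergence.** For functions $f,g:\mathbb{R}_+\to\mathbb{R}_+$ write $f\preceq g$ if there are $A,B,C,D,E\ge 0$ with $f(x)\le A\,g(Bx+C)+Dx+E$ for all $x$, and $f\approx g$ (equivalent) if $f\preceq g$ and $g\preceq f$. Let $G$ be a group with finite generating set $X$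 and Cayley graph $\Gamma$. For $\delta\in(0,1)$, the $\delta$-divergence function of $\Gamma$ is the smallest function $f_\delta$ such that every two vertices of $\Gamma$ at distance $x$ from the identity can be connected by a path in $\Gamma$ of length less than $f_\delta(x)$ which avoids the ball of radius $\delta x$ centred at the identity (with $f_\delta(x)=\infty$ if no such path exists). The $\delta$-divergence function of $G$ is the $\approx$-equivalence class of $f_\delta$, which does not depend on $X$. *)

theory Defs
  imports "HOL-Analysis.Analysis" "HOL-Algebra.Generated_Groups"
begin

section \<open>Braids\<close>

text \<open>
  A geometric braid on \<open>n\<close> strands is a path of \<open>n\<close> pairwise distinct points of the complex plane,
  indexed by \<open>{..<n}\<close>.  It starts at the points \<open>0, 1, ..., n - 1\<close>, which label the strands, and
  ends at the same set of points; ``to the right'' means in the direction of the positive real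
  axis.  The coordinates with index \<open>\<ge> n\<close> carry no information and are fixed to \<open>0\<close>.
\<close>

definition conf :: "nat \<Rightarrow> (nat \<Rightarrow> complex) set" where
  "conf n = {z. inj_on z {..<n} \<and> (\<forall>i\<ge>n. z i = 0)}"

definition base_conf :: "nat \<Rightarrow> nat \<Rightarrow> complex" where
  "base_conf n = (\<lambda>i. if i < n then of_nat i else 0)"

definition geometric_braid :: "nat \<Rightarrow> (real \<Rightarrow> nat \<Rightarrow> complex) \<Rightarrow> bool" where
  "geometric_braid n p \<longleftrightarrow>
     path p \<and> path_image p \<subseteq> conf n \<and> pathstart p = base_conf n \<and>
     pathfinish p ` {..<n} = of_nat ` {..<n}"

text \<open>The position at which strand \<open>i\<close> ends.\<close>

definition end_pos :: "(real \<Rightarrow> nat \<Rightarrow> complex) \<Rightarrow> nat \<Rightarrow> nat" where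
  "end_pos p i = (THE j. pathfinish p i = of_nat j)"

definition isotopy :: "nat \<Rightarrow> ((real \<Rightarrow> nat \<Rightarrow> complex) \<times> (real \<Rightarrow> nat \<Rightarrow> complex)) set" where
  "isotopy n =
     {(p, q). geometric_braid n p \<and> geometric_braid n q \<and> homotopic_paths (conf n) p q}"

text \<open>\<open>p\<close> followed by \<open>q\<close>: strand \<open>i\<close> of \<open>p\<close> is continued by the strand of \<open>q\<close> that starts where it
  ends.\<close>

definition braid_comp ::
  "nat \<Rightarrow> (real \<Rightarrow> nat \<Rightarrow> complex) \<Rightarrow> (real \<Rightarrow> nat \<Rightarrow> complex) \<Rightarrow> real \<Rightarrow> nat \<Rightarrow> complex" where
  "braid_comp n p q = p +++ (\<lambda>t i. if i < n then q t (end_pos p i) else 0)"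

definition braid_group :: "nat \<Rightarrow> (real \<Rightarrow> nat \<Rightarrow> complex) set monoid" where
  "braid_group n =
     \<lparr>carrier = {p. geometric_braid n p} // isotopy n,
      mult = (\<lambda>\<beta> \<gamma>. \<Union>p\<in>\<beta>. \<Union>q\<in>\<gamma>. isotopy n `` {braid_comp n p q}),
      one = isotopy n `` {\<lambda>t. base_conf n}\<rparr>"

text \<open>
  Splitting strand \<open>i\<close> of \<open>p\<close>: a new strand \<open>i + 1\<close> runs parallel to strand \<open>i\<close> at distance \<open>\<epsilon>\<close> to its
  right, and the strands \<open>i + 1, i + 2, ...\<close> are renumbered accordingly.
\<close>

definition double_strand ::
  "nat \<Rightarrow> nat \<Rightarrow> real \<Rightarrow> (real \<Rightarrow> nat \<Rightarrow> complex) \<Rightarrow> real \<Rightarrow> nat \<Rightarrow> complex" where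
  "double_strand n i \<epsilon> p =
     (\<lambda>t k. if k \<le> i then p t k
            else if k = Suc i then p t i + of_real \<epsilon>
            else if k < Suc n then p t (k - 1)
            else 0)"

text \<open>
  The end points of the doubled braid are then moved along the real axis, preserving their order,
  to \<open>0, 1, ..., n\<close>.
\<close>

definition double_end :: "nat \<Rightarrow> nat \<Rightarrow> (real \<Rightarrow> nat \<Rightarrow> complex) \<Rightarrow> nat \<Rightarrow> complex" where
  "double_end n i p =
     (\<lambda>k. if k < Suc n then
            (let e = end_pos p (if k \<le> i then k else k - 1)
             in of_nat (if end_pos p i < e \<or> k = Suc i then Suc e else e))
          else 0)"

definition straight_path :: "(nat \<Rightarrow> complex) \<Rightarrow> (nat \<Rightarrow> complex) \<Rightarrow> real \<Rightarrow> nat \<Rightarrow> complex" where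
  "straight_path u v = (\<lambda>t k. linepath (u k) (v k) t)"

definition split_strand ::
  "nat \<Rightarrow> nat \<Rightarrow> real \<Rightarrow> (real \<Rightarrow> nat \<Rightarrow> complex) \<Rightarrow> real \<Rightarrow> nat \<Rightarrow> complex" where
  "split_strand n i \<epsilon> p =
     (let q = double_strand n i \<epsilon> p
      in straight_path (base_conf (Suc n)) (pathstart q) +++ q +++
         straight_path (pathfinish q) (double_end n i p))"

text \<open>The width \<open>\<epsilon>\<close> has to be smaller than the distance from strand \<open>i\<close> to any other strand, at all
  times.\<close>

definition split_width :: "nat \<Rightarrow> nat \<Rightarrow> (real \<Rightarrow> nat \<Rightarrow> complex) \<Rightarrow> real \<Rightarrow> bool" where
  "split_width n i p \<epsilon> \<longleftrightarrow>
     0 < \<epsilon> \<and> (\<forall>t\<in>{0..1}. \<forall>j<n. j \<noteq> i \<longrightarrow> \<epsilon> < dist (p t i) (p t j))"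


section \<open>Tree-braid-tree diagrams and the group BV\<close>

datatype btree = Leaf | Caret btree btree

fun carets :: "btree \<Rightarrow> nat" where
  "carets Leaf = 0"
| "carets (Caret l r) = Suc (carets l + carets r)"

abbreviation leaves :: "btree \<Rightarrow> nat" where
  "leaves t \<equiv> Suc (carets t)"

text \<open>Attach a caret to leaf number \<open>i\<close>; leaves are numbered from left to right, starting from \<open>0\<close>.\<close>

fun add_caret :: "btree \<Rightarrow> nat \<Rightarrow> btree" where
  "add_caret Leaf i = Caret Leaf Leaf"
| "add_caret (Caret l r) i =
     (if i < leaves l then Caret (add_caret l i) r else Caret l (add_caret r (i - leaves l)))"

type_synonym diagram = "btree \<times> (real \<Rightarrow> nat \<Rightarrow> complex) set \<times> btree"

definition diagrams :: "diagram set" where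
  "diagrams = {(S, \<beta>, T). carets S = carets T \<and> \<beta> \<in> carrier (braid_group (leaves S))}"

inductive_set splitting :: "(diagram \<times> diagram) set" where
  "\<lbrakk>(S, \<beta>, T) \<in> diagrams; n = leaves S; p \<in> \<beta>; i < n; split_width n i p \<epsilon>\<rbrakk>
   \<Longrightarrow> ((S, \<beta>, T),
        (add_caret S i, isotopy (Suc n) `` {split_strand n i \<epsilon> p}, add_caret T (end_pos p i)))
       \<in> splitting"

definition diagram_equiv :: "(diagram \<times> diagram) set" where
  "diagram_equiv = (splitting \<union> splitting\<inverse>)\<^sup>* \<inter> diagrams \<times> diagrams"

definition BV :: "diagram set monoid" where
  "BV =
     \<lparr>carrier = diagrams // diagram_equiv,
      mult = (\<lambda>a b. \<Union>{diagram_equiv `` {(R, \<beta> \<otimes>\<^bsub>braid_group (leaves S)\<^esub> \<gamma>, T)} | R \<beta> S \<gamma> T.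
                        (R, \<beta>, S) \<in> a \<and> (S, \<gamma>, T) \<in> b}),
      one = diagram_equiv `` {(Leaf, \<one>\<^bsub>braid_group 1\<^esub>, Leaf)}\<rparr>"


section \<open>Divergence functions\<close>

definition generates :: "('a, 'b) monoid_scheme \<Rightarrow> 'a set \<Rightarrow> bool" where
  "generates G X \<longleftrightarrow> X \<subseteq> carrier G \<and> generate G X = carrier G"

definition cayley_adj :: "('a, 'b) monoid_scheme \<Rightarrow> 'a set \<Rightarrow> 'a \<Rightarrow> 'a \<Rightarrow> bool" where
  "cayley_adj G X u v \<longleftrightarrow>
     u \<in> carrier G \<and> v \<in> carrier G \<and> (\<exists>x\<in>X. v = u \<otimes>\<^bsub>G\<^esub> x \<or> u = v \<otimes>\<^bsub>G\<^esub> x)"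

text \<open>A path is given by the nonempty list of its vertices; its length is the number of edges.\<close>

definition cayley_path :: "('a, 'b) monoid_scheme \<Rightarrow> 'a set \<Rightarrow> 'a \<Rightarrow> 'a list \<Rightarrow> 'a \<Rightarrow> bool" where
  "cayley_path G X u vs v \<longleftrightarrow>
     vs \<noteq> [] \<and> set vs \<subseteq> carrier G \<and> hd vs = u \<and> last vs = v \<and> successively (cayley_adj G X) vs"

definition path_length :: "'a list \<Rightarrow> nat" where
  "path_length vs = length vs - 1"

definition cayley_dist :: "('a, 'b) monoid_scheme \<Rightarrow> 'a set \<Rightarrow> 'a \<Rightarrow> 'a \<Rightarrow> nat" where
  "cayley_dist G X u v = (LEAST m. \<exists>vs. cayley_path G X u vs v \<and> path_length vs = m)"

text \<open>
  The ball to be avoided is open: at \<open>x = 0\<close> a closed ball of radius \<open>\<delta> * x\<close> would contain the identity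
  itself, the only vertex at distance \<open>0\<close>.  An edge avoids an open ball around a vertex as soon as
  its two end points do.  As path lengths are integers, the smallest strict bound is the least
  natural number (or \<open>\<infinity>\<close>) with the property; an infimum over all reals would not be attained.
\<close>

definition divergence :: "('a, 'b) monoid_scheme \<Rightarrow> 'a set \<Rightarrow> real \<Rightarrow> real \<Rightarrow> ennreal" where
  "divergence G X \<delta> x =
     Inf {of_nat m | m :: nat.
       \<forall>u\<in>carrier G. \<forall>v\<in>carrier G.
         real (cayley_dist G X \<one>\<^bsub>G\<^esub> u) = x \<and> real (cayley_dist G X \<one>\<^bsub>G\<^esub> v) = x \<longrightarrow>
         (\<exists>vs. cayley_path G X u vs v \<and> path_length vs < m \<and>
               (\<forall>w\<in>set vs. \<not> real (cayley_dist G X \<one>\<^bsub>G\<^esub> w) < \<delta> * x))}"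

text \<open>Functions on the nonnegative reals are functions on \<open>real\<close> of which only the values at
  \<open>x \<ge> 0\<close> are used.\<close>

definition div_le :: "(real \<Rightarrow> ennreal) \<Rightarrow> (real \<Rightarrow> ennreal) \<Rightarrow> bool" where
  "div_le f g \<longleftrightarrow>
     (\<exists>A B C D E :: real. 0 \<le> A \<and> 0 \<le> B \<and> 0 \<le> C \<and> 0 \<le> D \<and> 0 \<le> E \<and>
        (\<forall>x\<ge>0. f x \<le> ennreal A * g (B * x + C) + ennreal (D * x + E)))"

definition div_equiv :: "(real \<Rightarrow> ennreal) \<Rightarrow> (real \<Rightarrow> ennreal) \<Rightarrow> bool" where
  "div_equiv f g \<longleftrightarrow> div_le f g \<and> div_le g f"

end

(*
  Cabling.  Replacing the strands of a braid by bundles of parallel strands is well defined on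
  isotopy classes, compatible with products and functorial in the bundling.  Hence splittings of
  diagrams at different leaves commute, two expansions of a diagram with the same head tree agree,
  and BV is a group.

  Twists.  For a vertex w of the infinite binary tree let t(w) be the generator x0 of Thompson's
  group F acting below w.  Twists at disjoint vertices commute, and if g has a diagram in which a
  leaf w is sent to a leaf w', then g conjugates one of t(w), t(w') to the other.  The largest change
  of the depth of a leaf is subadditive, so up to a constant it is a lower bound for word length, and
  it is at least |a| and |b| on t(w)^a t(w')^b for disjoint w, w'.

  Divergence.  Let |g| = n.  After walking away from the identity, g is followed by a large power of
  t(0) in one of the two directions, then by a power of t(1^k), with k of order n, which commutes
  with t(0); now the power of t(0) is undone, and multiplication by the inverse of g gives a power
  of a conjugate of the second twist, a twist t(w).  The vertex w lies in one half of the tree, so t(w)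
  commutes with t(0) or t(1), and can be traded for a power of t(0) or t(1).  All steps have linear
  length, because t(1^k) is conjugate to t(1) by an element of linear length.
*)
theory Submission
  imports Defs
begin

section \<open>Homotopies of paths in a topological space\<close>

text \<open>Only an upper bound is at stake: the comparison of divergence functions tolerates an
  added linear term, so a linear function lies below every function. The obstacle is that the word
  metric of BV is hard to compute. The defect replaces it: it sees depths of leaves and ignores the
  braid. Subadditivity turns a large defect into a large length, and from the second twist on some
  factor with exponent \<open>K * m\<close> always stays intact. Twists pass through diagrams
  because the strands split off from one strand are parallel: splitting either of the two copies
  once more gives the same braid. The walk away from the identity is made because a line of powers
  of t(0) through a point may come near the identity in one direction. If it did so in both, the
  exponents in between would be bounded linearly, and the point itself would be close to the
  identity. The depth k has to be of order n because each generator raises the moved vertex by a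
  bounded number of levels; a larger k keeps the conjugated twist away from the root, hence inside
  one half of the tree.\<close>

lemma homotopic_paths_convex_image:
  fixes K :: "'a::real_normed_vector \<Rightarrow> 'b::topological_space"
  assumes "convex C" "continuous_on C K" "K ` C \<subseteq> S"
    and "path g" "path h" "path_image g \<subseteq> C" "path_image h \<subseteq> C"
    and "pathstart g = pathstart h" "pathfinish g = pathfinish h"
  shows "homotopic_paths S (K \<circ> g) (K \<circ> h)"
proof -
  have "homotopic_paths C g h"
  proof (rule homotopic_paths_linear)
    show "closed_segment (g t) (h t) \<subseteq> C" if "t \<in> {0..1}" for t
      using assms that by (intro closed_segment_subset) (auto simp: path_image_def)
  qed (use assms in auto)
  then show ?thesis
    by (rule homotopic_paths_continuous_image) (use assms in auto)
qed

lemma comp_linepath_01 [simp]: "p \<circ> linepath 0 1 = (p :: real \<Rightarrow> 'b)"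
  by (auto simp: linepath_def)

text \<open>The case \<open>K = p\<close>, \<open>C = {0..1}\<close> of
  \<open>homotopic_paths_convex_image\<close>: pauses and reversals of \<open>p\<close> are paths in
  the parameter interval, which is convex. The next two lemmas have the same proof.\<close>

lemma homotopic_paths_const_right:
  assumes "path p" "path_image p \<subseteq> S"
  shows "homotopic_paths S (p +++ (\<lambda>t. pathfinish p)) p"
proof -
  have "homotopic_paths S (p \<circ> (linepath 0 1 +++ linepath 1 1)) (p \<circ> linepath 0 1)"
    by (rule homotopic_paths_convex_image[where C = "{0..1}"])
      (use assms[unfolded path_def path_image_def] in \<open>auto simp: path_image_join closed_segment_eq_real_ivl image_subset_iff
         simp flip: path_def path_image_def\<close>)
  moreover have "p \<circ> linepath 1 1 = (\<lambda>t. pathfinish p)"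
    by (auto simp: linepath_def pathfinish_def)
  ultimately show ?thesis
    by (simp add: path_compose_join)
qed

lemma homotopic_paths_const_left:
  assumes "path p" "path_image p \<subseteq> S"
  shows "homotopic_paths S ((\<lambda>t. pathstart p) +++ p) p"
proof -
  have "homotopic_paths S (p \<circ> (linepath 0 0 +++ linepath 0 1)) (p \<circ> linepath 0 1)"
    by (rule homotopic_paths_convex_image[where C = "{0..1}"])
      (use assms[unfolded path_def path_image_def] in \<open>auto simp: path_image_join closed_segment_eq_real_ivl image_subset_iff
         simp flip: path_def path_image_def\<close>)
  moreover have "p \<circ> linepath 0 0 = (\<lambda>t. pathstart p)"
    by (auto simp: linepath_def pathstart_def)
  ultimately show ?thesis
    by (simp add: path_compose_join)
qed

lemma homotopic_paths_reversepath_right: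
  assumes "path p" "path_image p \<subseteq> S"
  shows "homotopic_paths S (p +++ reversepath p) (\<lambda>t. pathstart p)"
proof -
  have "homotopic_paths S (p \<circ> (linepath 0 1 +++ linepath 1 0)) (p \<circ> linepath 0 0)"
    by (rule homotopic_paths_convex_image[where C = "{0..1}"])
      (use assms[unfolded path_def path_image_def] in \<open>auto simp: path_image_join closed_segment_eq_real_ivl image_subset_iff
         simp flip: path_def path_image_def\<close>)
  moreover have "p \<circ> linepath 0 0 = (\<lambda>t. pathstart p)" "p \<circ> linepath 1 0 = reversepath p"
    by (auto simp: linepath_def pathstart_def reversepath_def)
  ultimately show ?thesis
    by (simp add: path_compose_join)
qed

text \<open>Both sides are images of routes along the boundary of the square from (0, 0) to (1, 1),
  and the square is convex.\<close>

lemma homotopic_paths_square: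
  fixes K :: "real \<times> real \<Rightarrow> 'b::topological_space"
  assumes "continuous_on ({0..1} \<times> {0..1}) K" "K ` ({0..1} \<times> {0..1}) \<subseteq> S"
  shows "homotopic_paths S ((\<lambda>t. K (0, t)) +++ (\<lambda>s. K (s, 1))) ((\<lambda>s. K (s, 0)) +++ (\<lambda>t. K (1, t)))"
proof -
  let ?l = "\<lambda>a b c d. linepath (a, b) (c, d) :: real \<Rightarrow> real \<times> real"
  have C: "convex ({0..1} \<times> {0..1} :: (real \<times> real) set)"
    by (intro convex_Times) auto
  have sub: "path_image (?l a b c d) \<subseteq> {0..1} \<times> {0..1}" if "{a,b,c,d} \<subseteq> {0..1}" for a b c d
    using that by (simp only: path_image_linepath, intro closed_segment_subset C) auto
  have "homotopic_paths S (K \<circ> (?l 0 0 0 1 +++ ?l 0 1 1 1)) (K \<circ> (?l 0 0 1 0 +++ ?l 1 0 1 1))"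
    by (rule homotopic_paths_convex_image[where C = "{0..1} \<times> {0..1}"])
      (use assms C sub in \<open>auto simp: path_image_join simp del: path_image_linepath\<close>)
  moreover have "K \<circ> ?l 0 0 0 1 = (\<lambda>t. K (0, t))" "K \<circ> ?l 0 1 1 1 = (\<lambda>s. K (s, 1))"
    "K \<circ> ?l 0 0 1 0 = (\<lambda>s. K (s, 0))" "K \<circ> ?l 1 0 1 1 = (\<lambda>t. K (1, t))"
    by (auto simp: linepath_def)
  ultimately show ?thesis
    by (simp add: path_compose_join)
qed

lemma homotopic_paths_assoc_middle:
  assumes "path a" "path b" "path c" "path d"
    and "path_image a \<subseteq> S" "path_image b \<subseteq> S" "path_image c \<subseteq> S" "path_image d \<subseteq> S"
    and "pathfinish a = pathstart b" "pathfinish b = pathstart c" "pathfinish c = pathstart d"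
  shows "homotopic_paths S ((a +++ b) +++ (c +++ d)) (a +++ ((b +++ c) +++ d))"
proof -
  have "homotopic_paths S ((a +++ b) +++ (c +++ d)) (a +++ (b +++ (c +++ d)))"
    by (rule homotopic_paths_sym, rule homotopic_paths_assoc)
      (use assms in \<open>auto simp: path_image_join\<close>)
  also have "homotopic_paths S (a +++ (b +++ (c +++ d))) (a +++ ((b +++ c) +++ d))"
    by (intro homotopic_paths_join homotopic_paths_assoc)
      (use assms in \<open>auto simp: path_image_join\<close>)
  finally show ?thesis .
qed

text \<open>The ends of a free homotopy may wander inside sets in which any two paths with the same end
  points are homotopic; closing up inside these sets turns it into a homotopy of paths.\<close>

lemma homotopic_paths_close_up:
  fixes K :: "real \<times> real \<Rightarrow> 'b::topological_space"
  assumes K: "continuous_on ({0..1} \<times> {0..1}) K" "K ` ({0..1} \<times> {0..1}) \<subseteq> S"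
    and A: "\<And>g h. \<lbrakk>path g; path h; path_image g \<subseteq> A; path_image h \<subseteq> A; pathstart g = pathstart h;
               pathfinish g = pathfinish h\<rbrakk> \<Longrightarrow> homotopic_paths S g h"
    and B: "\<And>g h. \<lbrakk>path g; path h; path_image g \<subseteq> B; path_image h \<subseteq> B; pathstart g = pathstart h;
               pathfinish g = pathfinish h\<rbrakk> \<Longrightarrow> homotopic_paths S g h"
    and KA: "\<And>s. s \<in> {0..1} \<Longrightarrow> K (s, 0) \<in> A" and KB: "\<And>s. s \<in> {0..1} \<Longrightarrow> K (s, 1) \<in> B"
    and a: "path a" "path a'" "path_image a \<subseteq> A" "path_image a' \<subseteq> A" "pathstart a = pathstart a'"
      "pathfinish a = K (0, 0)" "pathfinish a' = K (1, 0)"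
    and b: "path b" "path b'" "path_image b \<subseteq> B" "path_image b' \<subseteq> B" "pathfinish b = pathfinish b'"
      "pathstart b = K (0, 1)" "pathstart b' = K (1, 1)"
  shows "homotopic_paths S (a +++ ((\<lambda>t. K (0, t)) +++ b)) (a' +++ ((\<lambda>t. K (1, t)) +++ b'))"
proof -
  define k0 k1 e0 e1 where "k0 = (\<lambda>t. K (0, t))" and "k1 = (\<lambda>t. K (1, t))"
    and "e0 = (\<lambda>s. K (s, 0))" and "e1 = (\<lambda>s. K (s, 1))"
  note defs = k0_def k1_def e0_def e1_def
  have p: "path k0" "path k1" "path e0" "path e1"
    unfolding path_def defs by (intro continuous_on_compose2[OF K(1)] continuous_intros; force)+
  have i: "path_image k0 \<subseteq> S" "path_image k1 \<subseteq> S" "path_image e0 \<subseteq> S" "path_image e1 \<subseteq> S"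
    using K(2) by (force simp: path_image_def defs)+
  have eA: "path_image e0 \<subseteq> A" "path_image e1 \<subseteq> B"
    using KA KB by (auto simp: path_image_def defs)
  have ends: "pathstart k0 = K (0, 0)" "pathfinish k0 = K (0, 1)" "pathstart k1 = K (1, 0)"
    "pathfinish k1 = K (1, 1)" "pathstart e0 = K (0, 0)" "pathfinish e0 = K (1, 0)"
    "pathstart e1 = K (0, 1)" "pathfinish e1 = K (1, 1)"
    by (auto simp: defs pathstart_def pathfinish_def)
  \<comment> \<open>The assumptions on \<open>A\<close> and \<open>B\<close>, applied to a path and
    itself, give a homotopy inside \<open>S\<close>; hence the path runs in
    \<open>S\<close>.\<close>
  have S: "path_image a \<subseteq> S" "path_image a' \<subseteq> S" "path_image b \<subseteq> S" "path_image b' \<subseteq> S"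
    using A[of a a] A[of a' a'] B[of b b] B[of b' b'] a b homotopic_paths_imp_subset by blast+
  have sq: "homotopic_paths S (k0 +++ e1) (e0 +++ k1)"
    using homotopic_paths_square[OF K] by (simp add: defs)
  have "homotopic_paths S b (e1 +++ b')"
    by (rule B) (use b p ends eA in \<open>auto simp: path_image_join\<close>)
  then have "homotopic_paths S (a +++ (k0 +++ b)) (a +++ (k0 +++ (e1 +++ b')))"
    by (intro homotopic_paths_join) (use a b p i S ends in auto)
  also have "homotopic_paths S \<dots> (a +++ ((k0 +++ e1) +++ b'))"
    by (intro homotopic_paths_join homotopic_paths_assoc) (use a b p i S ends in auto)
  also have "homotopic_paths S \<dots> (a +++ ((e0 +++ k1) +++ b'))"
    by (rule homotopic_paths_join[OF _ homotopic_paths_join[OF sq]]) (use a b p i S ends in auto)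
  also have "homotopic_paths S \<dots> ((a +++ e0) +++ (k1 +++ b'))"
    by (rule homotopic_paths_sym, rule homotopic_paths_assoc_middle) (use a b p i S ends in auto)
  also have "homotopic_paths S \<dots> (a' +++ (k1 +++ b'))"
  proof (rule homotopic_paths_join)
    show "homotopic_paths S (a +++ e0) a'"
      by (rule A) (use a p ends eA in \<open>auto simp: path_image_join\<close>)
  qed (use a b p i S ends in \<open>auto simp: path_image_join\<close>)
  finally show ?thesis
    by (simp add: defs)
qed

text \<open>The shape of a product of two cablings: the segment \<open>b\<close> that straightens
  the end of the first factor is undone at the start of the second.\<close>

lemma homotopic_paths_cancel_middle:
  assumes "path a" "path p" "path b" "path q" "path c"
    and "path_image a \<subseteq> S" "path_image p \<subseteq> S" "path_image b \<subseteq> S" "path_image q \<subseteq> S"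
      "path_image c \<subseteq> S"
    and "pathfinish a = pathstart p" "pathfinish p = pathstart b" "pathstart q = pathfinish p"
      "pathfinish q = pathstart c"
  shows "homotopic_paths S ((a +++ (p +++ b)) +++ (reversepath b +++ (q +++ c))) (a +++ ((p +++ q) +++ c))"
proof -
  have "homotopic_paths S ((a +++ (p +++ b)) +++ (reversepath b +++ (q +++ c)))
      (a +++ (((p +++ b) +++ reversepath b) +++ (q +++ c)))"
    by (rule homotopic_paths_assoc_middle) (use assms in \<open>auto simp: path_image_join\<close>)
  also have "homotopic_paths S \<dots> (a +++ (p +++ (q +++ c)))"
  proof (intro homotopic_paths_join)
    have "homotopic_paths S ((p +++ b) +++ reversepath b) (p +++ (b +++ reversepath b))"
      by (rule homotopic_paths_sym, rule homotopic_paths_assoc) (use assms in auto)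
    also have "homotopic_paths S \<dots> (p +++ (\<lambda>t. pathfinish p))"
      using homotopic_paths_reversepath_right[of b S] assms by (intro homotopic_paths_join) auto
    also have "homotopic_paths S \<dots> p"
      using assms by (intro homotopic_paths_const_right)
    finally show "homotopic_paths S ((p +++ b) +++ reversepath b) p" .
  qed (use assms in \<open>auto simp: path_image_join\<close>)
  also have "homotopic_paths S \<dots> (a +++ ((p +++ q) +++ c))"
    by (intro homotopic_paths_join homotopic_paths_assoc) (use assms in \<open>auto simp: path_image_join\<close>)
  finally show ?thesis .
qed


section \<open>Geometric braids and their cablings as paths in configuration spaces\<close>

section \<open>Ordered configurations\<close>

text \<open>A convex set of configurations on the real axis. End points are straightened inside it,
  so the way in which this is done does not matter up to homotopy.\<close>

definition ordered_conf :: "nat \<Rightarrow> (nat \<Rightarrow> nat) \<Rightarrow> (nat \<Rightarrow> complex) set" where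
  "ordered_conf m \<tau> = {z. (\<forall>k<m. \<forall>l<m. \<tau> k < \<tau> l \<longrightarrow> Re (z k) < Re (z l)) \<and>
     (\<forall>k. Im (z k) = 0) \<and> (\<forall>k\<ge>m. z k = 0)}"

definition placed_conf :: "nat \<Rightarrow> (nat \<Rightarrow> nat) \<Rightarrow> nat \<Rightarrow> complex" where
  "placed_conf m \<tau> = (\<lambda>k. if k < m then of_nat (\<tau> k) else 0)"

lemma base_conf_eq_placed: "base_conf m = placed_conf m id"
  by (auto simp: base_conf_def placed_conf_def)

lemma placed_in_ordered_conf: "placed_conf m \<tau> \<in> ordered_conf m \<tau>"
  by (auto simp: ordered_conf_def placed_conf_def)

lemma ordered_conf_subset_conf: "inj_on \<tau> {..<m} \<Longrightarrow> ordered_conf m \<tau> \<subseteq> conf m"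
  unfolding ordered_conf_def conf_def inj_on_def
  by clarsimp (metis lessThan_iff linorder_neqE_nat order_less_irrefl)

lemma continuous_on_coordinate:
  "continuous_on S f \<Longrightarrow> continuous_on S (\<lambda>x. f x i)" for f :: "'a::topological_space \<Rightarrow> 'b \<Rightarrow> 'c::topological_space"
  by (rule continuous_on_product_then_coordinatewise)

lemma convex_comb_less:
  fixes a b c d :: real
  assumes "a < b" "c < d" "0 \<le> s" "s \<le> 1"
  shows "(1 - s) * a + s * c < (1 - s) * b + s * d"
proof (cases "s = 0")
  case False
  then have "s * c < s * d" "(1 - s) * a \<le> (1 - s) * b"
    using assms by (auto intro: mult_left_mono)
  then show ?thesis by linarith
qed (use assms in auto)

text \<open>Linear interpolation preserves strict inequalities between real parts. The homotopy is
  written out by coordinates because configurations carry the product topology rather than a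
  norm.\<close>

lemma homotopic_paths_ordered_conf:
  assumes "path p" "path q" "path_image p \<subseteq> ordered_conf m \<tau>" "path_image q \<subseteq> ordered_conf m \<tau>"
    and "pathstart p = pathstart q" "pathfinish p = pathfinish q"
  shows "homotopic_paths (ordered_conf m \<tau>) p q"
proof -
  define h where "h = (\<lambda>(s::real, t) k. of_real (1 - s) * p t k + of_real s * q t k)"
  have cont: "continuous_on ({0..1} \<times> {0..1}) (\<lambda>x. r (snd x) k)" if "path r" for r :: "real \<Rightarrow> nat \<Rightarrow> complex" and k
    by (rule continuous_on_compose2[OF continuous_on_coordinate[OF that[unfolded path_def]]])
      (auto intro!: continuous_intros)
  show ?thesis
    unfolding homotopic_paths
  proof (intro exI[of _ h] conjI)
    show "continuous_on ({0..1} \<times> {0..1}) h"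
      unfolding h_def case_prod_unfold
      by (intro continuous_on_coordinatewise_then_product continuous_intros cont assms)
    show "h \<in> {0..1} \<times> {0..1} \<rightarrow> ordered_conf m \<tau>"
    proof (clarsimp simp: h_def)
      fix s t :: real
      assume st: "0 \<le> s" "s \<le> 1" "0 \<le> t" "t \<le> 1"
      then have "p t \<in> ordered_conf m \<tau>" "q t \<in> ordered_conf m \<tau>"
        using assms by (auto simp: path_image_def)
      then show "(\<lambda>k. (1 - complex_of_real s) * p t k + complex_of_real s * q t k) \<in> ordered_conf m \<tau>"
        using st by (auto simp: ordered_conf_def intro!: convex_comb_less)
    qed
  qed (use assms in \<open>auto simp: h_def pathstart_def pathfinish_def algebra_simps\<close>)
qed

lemma homotopic_paths_conf_if_ordered:
  assumes "inj_on \<tau> {..<m}" "path p" "path q" "path_image p \<subseteq> ordered_conf m \<tau>"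
    "path_image q \<subseteq> ordered_conf m \<tau>" "pathstart p = pathstart q" "pathfinish p = pathfinish q"
  shows "homotopic_paths (conf m) p q"
  using homotopic_paths_subset[OF homotopic_paths_ordered_conf ordered_conf_subset_conf] assms by blast

lemma path_straight_path [simp]: "path (straight_path u v)"
  unfolding path_def straight_path_def
  by (intro continuous_on_coordinatewise_then_product continuous_on_linepath)

lemma pathstart_straight_path [simp]: "pathstart (straight_path u v) = u"
  and pathfinish_straight_path [simp]: "pathfinish (straight_path u v) = v"
  by (auto simp: straight_path_def pathstart_def pathfinish_def linepath_def)

lemma reversepath_straight_path: "reversepath (straight_path u v) = straight_path v u"
  by (auto simp: straight_path_def reversepath_def linepath_def fun_eq_iff algebra_simps)

lemma path_image_straight_path_ordered:
  assumes "u \<in> ordered_conf m \<tau>" "v \<in> ordered_conf m \<tau>"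
  shows "path_image (straight_path u v) \<subseteq> ordered_conf m \<tau>"
  using assms
  by (auto simp: path_image_def straight_path_def linepath_def ordered_conf_def intro!: convex_comb_less)


section \<open>Geometric braids and their end positions\<close>

lemma end_pos_eq:
  assumes "pathfinish p = placed_conf n \<pi>" "i < n"
  shows "end_pos p i = \<pi> i"
  unfolding end_pos_def assms(1) using assms(2) by (auto simp: placed_conf_def)

lemma geometric_braid_finish:
  assumes "geometric_braid n p"
  shows "pathfinish p = placed_conf n (end_pos p)" and "bij_betw (end_pos p) {..<n} {..<n}"
    and "n \<le> i \<Longrightarrow> end_pos p i = 0"
proof -
  have c: "pathfinish p \<in> conf n" and im: "pathfinish p ` {..<n} = of_nat ` {..<n}"
    using assms by (auto simp: geometric_braid_def)
  have ex: "\<exists>j<n. pathfinish p i = of_nat j" if "i < n" for i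
  proof -
    have "pathfinish p i \<in> pathfinish p ` {..<n}" using that by simp
    then show ?thesis unfolding im by auto
  qed
  have e: "pathfinish p i = of_nat (end_pos p i)" "end_pos p i < n" if "i < n" for i
    using ex[OF that] unfolding end_pos_def by auto
  show fin: "pathfinish p = placed_conf n (end_pos p)"
    using e c by (auto simp: placed_conf_def conf_def)
  have "inj_on (end_pos p) {..<n}"
  proof (rule inj_onI)
    fix i j assume "i \<in> {..<n}" "j \<in> {..<n}" "end_pos p i = end_pos p j"
    then have "pathfinish p i = pathfinish p j" using e by simp
    then show "i = j"
      using c \<open>i \<in> {..<n}\<close> \<open>j \<in> {..<n}\<close> by (auto simp: conf_def dest: inj_onD)
  qed
  moreover have "end_pos p ` {..<n} \<subseteq> {..<n}"
    using e by auto
  ultimately show "bij_betw (end_pos p) {..<n} {..<n}"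
    by (auto simp: bij_betw_def endo_inj_surj)
  \<comment> \<open>The coordinates from \<open>n\<close> on are fixed to 0, so the position read
    off there is the default value 0.\<close>
  show "end_pos p i = 0" if "n \<le> i"
    using that c unfolding end_pos_def conf_def by auto
qed

lemma end_pos_less: "geometric_braid n p \<Longrightarrow> i < n \<Longrightarrow> end_pos p i < n"
  using geometric_braid_finish(2)[of n p] by (auto simp: bij_betw_def)

lemma geometric_braidI:
  assumes "path p" "path_image p \<subseteq> conf n" "pathstart p = base_conf n"
    and "pathfinish p = placed_conf n \<pi>" "bij_betw \<pi> {..<n} {..<n}"
  shows "geometric_braid n p"
proof -
  have "pathfinish p ` {..<n} = of_nat ` (\<pi> ` {..<n})"
    unfolding assms(4) by (auto simp: placed_conf_def image_image)
  then show ?thesis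
    using assms by (auto simp: geometric_braid_def bij_betw_def)
qed

lemma geometric_braid_homotopic:
  assumes "geometric_braid n p" "homotopic_paths (conf n) p q"
  shows "geometric_braid n q"
  using assms homotopic_paths_imp_path[OF assms(2)] homotopic_paths_imp_subset[OF assms(2)]
    homotopic_paths_imp_pathstart[OF assms(2)] homotopic_paths_imp_pathfinish[OF assms(2)]
  by (simp add: geometric_braid_def)

lemma end_pos_homotopic: "homotopic_paths S p q \<Longrightarrow> end_pos p = end_pos q"
  by (drule homotopic_paths_imp_pathfinish) (simp add: end_pos_def fun_eq_iff)


section \<open>Cabling\<close>

text \<open>In the cabling of \<open>p\<close> along a monotone map \<open>f\<close>, strand \<open>k\<close> runs parallel to strand \<open>f k\<close> of \<open>p\<close>
  at the horizontal offset \<open>d k\<close>; its ends are then moved straight to the integer points, in the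
  order \<open>\<tau>\<close>.  Splitting a strand is the case of a map that identifies two neighbours, and iterated
  splittings are again cablings, along composed maps.\<close>

definition spread :: "nat \<Rightarrow> (nat \<Rightarrow> nat) \<Rightarrow> (nat \<Rightarrow> real) \<Rightarrow> (nat \<Rightarrow> complex) \<Rightarrow> nat \<Rightarrow> complex" where
  "spread m f d z = (\<lambda>k. if k < m then z (f k) + of_real (d k) else 0)"

definition cable ::
  "nat \<Rightarrow> (nat \<Rightarrow> nat) \<Rightarrow> (nat \<Rightarrow> real) \<Rightarrow> (nat \<Rightarrow> nat) \<Rightarrow> (real \<Rightarrow> nat \<Rightarrow> complex) \<Rightarrow> real \<Rightarrow> nat \<Rightarrow> complex" where
  "cable m f d \<tau> p =
     straight_path (base_conf m) (spread m f d (pathstart p)) +++ (spread m f d \<circ> p) +++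
     straight_path (spread m f d (pathfinish p)) (placed_conf m \<tau>)"

definition monotone_map :: "nat \<Rightarrow> nat \<Rightarrow> (nat \<Rightarrow> nat) \<Rightarrow> bool" where
  "monotone_map m n f \<longleftrightarrow> (\<forall>k<m. f k < n) \<and> (\<forall>k l. k < l \<and> l < m \<longrightarrow> f k \<le> f l)"

text \<open>The order in which the strands of the cabled braid end, where \<open>\<pi>\<close> is that of the original one.\<close>

definition cable_perm :: "nat \<Rightarrow> (nat \<Rightarrow> nat) \<Rightarrow> (nat \<Rightarrow> nat) \<Rightarrow> (nat \<Rightarrow> nat) \<Rightarrow> bool" where
  "cable_perm m f \<pi> \<tau> \<longleftrightarrow> bij_betw \<tau> {..<m} {..<m} \<and>
     (\<forall>k<m. \<forall>l<m. \<tau> k < \<tau> l \<longrightarrow> \<pi> (f k) < \<pi> (f l) \<or> f k = f l \<and> k < l)"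

definition offsets :: "nat \<Rightarrow> (nat \<Rightarrow> nat) \<Rightarrow> (nat \<Rightarrow> real) \<Rightarrow> bool" where
  "offsets m f d \<longleftrightarrow> (\<forall>k l. k < l \<and> l < m \<and> f k = f l \<longrightarrow> d k < d l)"

text \<open>Offsets are real, so strands \<open>k\<close> and \<open>l\<close> of different bundles
  can meet only where the strands they follow differ by exactly \<open>d l - d k\<close>; the strict
  bound excludes this.\<close>

definition wide_conf :: "nat \<Rightarrow> nat \<Rightarrow> (nat \<Rightarrow> nat) \<Rightarrow> (nat \<Rightarrow> real) \<Rightarrow> (nat \<Rightarrow> complex) set" where
  "wide_conf n m f d =
     {z \<in> conf n. \<forall>k<m. \<forall>l<m. f k \<noteq> f l \<longrightarrow> \<bar>d k - d l\<bar> < dist (z (f k)) (z (f l))}"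

lemma spread_conf:
  assumes "offsets m f d" "z \<in> wide_conf n m f d"
  shows "spread m f d z \<in> conf m"
proof -
  have "spread m f d z k \<noteq> spread m f d z l" if "k < l" "l < m" for k l
  proof (cases "f k = f l")
    case True
    then show ?thesis using assms(1) that by (force simp: spread_def offsets_def)
  next
    case False
    show ?thesis
    proof
      assume "spread m f d z k = spread m f d z l"
      then have "z (f k) - z (f l) = of_real (d l - d k)"
        using that by (simp add: spread_def algebra_simps)
      then have "dist (z (f k)) (z (f l)) = \<bar>d k - d l\<bar>"
        by (simp only: dist_norm norm_of_real)
      then show False
        using assms(2) that False unfolding wide_conf_def by clarsimp (metis less_irrefl order.strict_trans)
    qed
  qed
  then have "inj_on (spread m f d z) {..<m}"
    by (intro linorder_inj_onI) auto
  then show ?thesis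
    by (simp add: conf_def spread_def)
qed

lemma continuous_on_spread: "continuous_on S (spread m f d)"
  unfolding spread_def
proof (rule continuous_on_coordinatewise_then_product)
  show "continuous_on S (\<lambda>x. if k < m then x (f k) + of_real (d k) else (0::complex))" for k
    by (cases "k < m")
      (auto intro!: continuous_intros continuous_on_subset[OF continuous_on_product_coordinates])
qed

text \<open>On the real axis the distance of two points is the difference of their real parts, so
  wideness prevents the offsets from reversing the order of two bundles; inside a bundle the offsets
  themselves give the order.\<close>

lemma spread_ordered_conf:
  assumes "cable_perm m f \<pi> \<tau>" "offsets m f d" "z \<in> wide_conf n m f d" "z \<in> ordered_conf n \<pi>"
    "\<And>k. k < m \<Longrightarrow> f k < n"
  shows "spread m f d z \<in> ordered_conf m \<tau>"
proof -
  have "Re (spread m f d z k) < Re (spread m f d z l)"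
    if kl: "k < m" "l < m" "\<tau> k < \<tau> l" for k l
  proof (cases "f k = f l")
    case True
    then show ?thesis
      using assms(1,2) kl unfolding cable_perm_def offsets_def spread_def
      by simp (metis less_irrefl)
  next
    case False
    then have less: "\<pi> (f k) < \<pi> (f l)"
      using assms(1) kl by (auto simp: cable_perm_def)
    then have Re: "Re (z (f k)) < Re (z (f l))"
      using assms(4,5) kl by (auto simp: ordered_conf_def)
    have "\<bar>d k - d l\<bar> < dist (z (f k)) (z (f l))"
      using assms(3) kl False by (auto simp: wide_conf_def)
    also have "\<dots> = \<bar>Re (z (f k)) - Re (z (f l))\<bar>"
      using assms(4) by (simp add: dist_norm cmod_eq_Re ordered_conf_def)
    finally show ?thesis
      using kl Re by (auto simp: spread_def)
  qed
  then show ?thesis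
    using assms(4) by (auto simp: ordered_conf_def spread_def)
qed

lemma cable_perm_id: "monotone_map m n f \<Longrightarrow> cable_perm m f id id"
  by (auto simp: cable_perm_def monotone_map_def) (metis nat_less_le)

text \<open>A bijection of an initial segment is determined by the order it induces:
  \<open>\<tau> k\<close> is the number of \<open>l\<close> with \<open>\<tau> l < \<tau> k\<close>,
  and the condition expresses this number by \<open>\<pi>\<close> and \<open>f\<close>
  alone.\<close>

lemma cable_perm_unique:
  assumes "cable_perm m f \<pi> \<tau>" "cable_perm m f \<pi> \<tau>'" "inj_on \<pi> (f ` {..<m})" "k < m"
  shows "\<tau> k = \<tau>' k"
proof -
  have *: "\<tau> k = card {l. l < m \<and> (\<pi> (f l) < \<pi> (f k) \<or> f l = f k \<and> l < k)}"
    if \<tau>: "cable_perm m f \<pi> \<tau>" for \<tau>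
  proof -
    have bij: "bij_betw \<tau> {..<m} {..<m}" using \<tau> by (simp add: cable_perm_def)
    have "\<tau> l < \<tau> k \<longleftrightarrow> \<pi> (f l) < \<pi> (f k) \<or> f l = f k \<and> l < k" if "l < m" for l
    proof
      assume "\<tau> l < \<tau> k"
      then show "\<pi> (f l) < \<pi> (f k) \<or> f l = f k \<and> l < k"
        using \<tau> that assms(4) by (auto simp: cable_perm_def)
    next
      assume R: "\<pi> (f l) < \<pi> (f k) \<or> f l = f k \<and> l < k"
      then have "l \<noteq> k" by auto
      then have "\<tau> l \<noteq> \<tau> k" using bij that assms(4) by (auto simp: bij_betw_def inj_on_def)
      moreover have "\<not> \<tau> k < \<tau> l"
        using \<tau>[unfolded cable_perm_def, THEN conjunct2, rule_format, of k l] that assms(4) R by auto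
      ultimately show "\<tau> l < \<tau> k" by auto
    qed
    then have eq: "{l. l < m \<and> (\<pi> (f l) < \<pi> (f k) \<or> f l = f k \<and> l < k)} = {l. l < m \<and> \<tau> l < \<tau> k}"
      by auto
    have "\<tau> ` {l. l < m \<and> \<tau> l < \<tau> k} = {..<\<tau> k}"
    proof -
      have "\<tau> k < m" using bij assms(4) by (auto simp: bij_betw_def)
      moreover have "\<exists>l<m. \<tau> l = j" if "j < m" for j
        using bij that by (metis bij_betw_def imageE lessThan_iff)
      ultimately show ?thesis by (auto simp: image_iff) (metis less_trans)
    qed
    moreover have "inj_on \<tau> {l. l < m \<and> \<tau> l < \<tau> k}"
      using bij by (auto simp: bij_betw_def inj_on_def)
    ultimately show ?thesis
      unfolding eq by (metis card_image card_lessThan)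
  qed
  show ?thesis using *[OF assms(1)] *[OF assms(2)] by simp
qed


text \<open>Each distance of two coordinates attains a positive minimum on \<open>C\<close>, and
  there are finitely many pairs. Halving the minimum leaves room for a strict inequality.\<close>

lemma compact_conf_separated:
  assumes "compact C" "C \<subseteq> conf n"
  obtains e :: real where "0 < e" "\<And>z i j. \<lbrakk>z \<in> C; i < n; j < n; i \<noteq> j\<rbrakk> \<Longrightarrow> e < dist (z i) (z j)"
proof (cases "C = {}")
  case False
  have "\<exists>e>0. \<forall>z\<in>C. e < dist (z i) (z j)" if ij: "i < n" "j < n" "i \<noteq> j" for i j
  proof -
    have cont: "continuous_on C (\<lambda>z. dist (z i) (z j))"
      by (intro continuous_intros continuous_on_subset[OF continuous_on_product_coordinates]) auto
    obtain w where w: "w \<in> C" "\<And>z. z \<in> C \<Longrightarrow> dist (w i) (w j) \<le> dist (z i) (z j)"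
      using continuous_attains_inf[OF assms(1) False cont] by auto
    have "w i \<noteq> w j"
      using w(1) assms(2) ij by (auto simp: conf_def dest: inj_onD)
    then have "0 < dist (w i) (w j)" by simp
    then show ?thesis
      using w(2) by (intro exI[of _ "dist (w i) (w j) / 2"] conjI ballI)
        (simp, metis field_sum_of_halves less_add_same_cancel1 half_gt_zero order_less_le_trans)
  qed
  then obtain e where e: "\<And>i j. \<lbrakk>i < n; j < n; i \<noteq> j\<rbrakk> \<Longrightarrow> 0 < e i j \<and> (\<forall>z\<in>C. e i j < dist (z i) (z j))"
    by metis
  \<comment> \<open>The element 1 keeps the set nonempty when there are no pairs to compare.\<close>
  define E where "E = insert 1 ((\<lambda>(i, j). e i j) ` {(i, j). i < n \<and> j < n \<and> i \<noteq> j})"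
  have fin: "finite {(i, j). i < n \<and> j < n \<and> i \<noteq> j}"
    by (rule finite_subset[of _ "{..<n} \<times> {..<n}"]) auto
  show ?thesis
  proof (rule that[of "Min E"])
    show "0 < Min E" using e fin by (auto simp: E_def)
    fix z i j assume *: "z \<in> C" "i < n" "j < n" "i \<noteq> j"
    have "Min E \<le> e i j" using * fin by (intro Min_le) (auto simp: E_def)
    also have "\<dots> < dist (z i) (z j)" using e * by blast
    finally show "Min E < dist (z i) (z j)" .
  qed
qed (use that[of 1] in auto)

lemma offsets_exist:
  assumes "0 < e"
  obtains d where "offsets m f d" "\<And>k l. \<lbrakk>k < m; l < m\<rbrakk> \<Longrightarrow> \<bar>d k - d l\<bar> < e"
proof
  define d where "d = (\<lambda>k. e / real (Suc m) * real k)"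
  show "offsets m f d"
    using assms by (auto simp: offsets_def d_def divide_strict_right_mono)
  show "\<bar>d k - d l\<bar> < e" if "k < m" "l < m" for k l
  proof -
    have "\<bar>d k - d l\<bar> = e / real (Suc m) * \<bar>real k - real l\<bar>"
    proof -
      have "d k - d l = e / real (Suc m) * (real k - real l)"
        by (simp add: d_def right_diff_distrib)
      then show ?thesis using assms by (simp add: abs_mult)
    qed
    also have "\<dots> < e / real (Suc m) * real (Suc m)"
      using assms that by (intro mult_strict_left_mono) auto
    also have "\<dots> = e" by simp
    finally show ?thesis .
  qed
qed

definition cable_data ::
  "nat \<Rightarrow> nat \<Rightarrow> (nat \<Rightarrow> nat) \<Rightarrow> (nat \<Rightarrow> real) \<Rightarrow> (nat \<Rightarrow> nat) \<Rightarrow> (real \<Rightarrow> nat \<Rightarrow> complex) \<Rightarrow> bool" where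
  "cable_data n m f d \<tau> p \<longleftrightarrow> geometric_braid n p \<and> monotone_map m n f \<and> offsets m f d \<and>
     path_image p \<subseteq> wide_conf n m f d \<and> cable_perm m f (end_pos p) \<tau>"

context
  fixes n m f d \<tau> p
  assumes cd: "cable_data n m f d \<tau> p"
begin

lemma cable_data_start: "spread m f d (pathstart p) \<in> ordered_conf m id"
proof -
  have "pathstart p \<in> wide_conf n m f d"
    using cd by (auto simp: cable_data_def pathstart_in_path_image subset_iff)
  moreover have "pathstart p = placed_conf n id"
    using cd by (simp add: cable_data_def geometric_braid_def base_conf_eq_placed)
  ultimately show ?thesis
    using cd placed_in_ordered_conf[of n id] spread_ordered_conf[OF cable_perm_id, of m n f d "pathstart p" n]
    by (auto simp: cable_data_def monotone_map_def)
qed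

lemma cable_data_finish: "spread m f d (pathfinish p) \<in> ordered_conf m \<tau>"
proof -
  have "pathfinish p \<in> wide_conf n m f d"
    using cd by (auto simp: cable_data_def pathfinish_in_path_image subset_iff)
  then show ?thesis
    using cd geometric_braid_finish(1)[of n p] placed_in_ordered_conf[of n "end_pos p"]
      spread_ordered_conf[of m f "end_pos p" \<tau> d "pathfinish p" n]
    by (auto simp: cable_data_def monotone_map_def)
qed

lemma cable_data_path: "path (spread m f d \<circ> p)" "path_image (spread m f d \<circ> p) \<subseteq> conf m"
proof -
  show "path (spread m f d \<circ> p)"
    using cd by (auto simp: cable_data_def geometric_braid_def intro: path_continuous_image continuous_on_spread)
  show "path_image (spread m f d \<circ> p) \<subseteq> conf m"
    using cd spread_conf[of m f d _ n] by (auto simp: cable_data_def path_image_compose)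
qed

lemma cable_data_inj: "inj_on \<tau> {..<m}"
  using cd by (auto simp: cable_data_def cable_perm_def bij_betw_def)

lemma cable_data_ends:
  "path_image (straight_path (base_conf m) (spread m f d (pathstart p))) \<subseteq> ordered_conf m id"
  "path_image (straight_path (spread m f d (pathfinish p)) (placed_conf m \<tau>)) \<subseteq> ordered_conf m \<tau>"
  unfolding base_conf_eq_placed
  by (intro path_image_straight_path_ordered cable_data_start cable_data_finish placed_in_ordered_conf)+

lemma cable_data_ends_conf:
  "path_image (straight_path (base_conf m) (spread m f d (pathstart p))) \<subseteq> conf m"
  "path_image (straight_path (spread m f d (pathfinish p)) (placed_conf m \<tau>)) \<subseteq> conf m"
  using cable_data_ends ordered_conf_subset_conf cable_data_inj inj_on_id by blast+

lemma geometric_braid_cable: "geometric_braid m (cable m f d \<tau> p)"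
proof (rule geometric_braidI)
  show "bij_betw \<tau> {..<m} {..<m}"
    using cd by (auto simp: cable_data_def cable_perm_def)
qed (use cable_data_path cable_data_ends_conf in
    \<open>auto simp: cable_def path_image_join pathstart_compose pathfinish_compose\<close>)

lemma end_pos_cable: "k < m \<Longrightarrow> end_pos (cable m f d \<tau> p) k = \<tau> k"
  by (rule end_pos_eq) (auto simp: cable_def)

end

lemma wide_conf_separated:
  assumes "z \<in> conf n" "\<And>i j. \<lbrakk>i < n; j < n; i \<noteq> j\<rbrakk> \<Longrightarrow> e < dist (z i) (z j)"
    and "\<And>k l. \<lbrakk>k < m; l < m\<rbrakk> \<Longrightarrow> \<bar>d k - d l\<bar> < e" "\<And>k. k < m \<Longrightarrow> f k < n"
  shows "z \<in> wide_conf n m f d"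
  using assms unfolding wide_conf_def by clarsimp (meson less_trans)

lemma convex_comb_abs_less:
  fixes a b c :: real
  assumes "\<bar>a\<bar> < c" "\<bar>b\<bar> < c" "0 \<le> s" "s \<le> 1"
  shows "\<bar>(1 - s) * a + s * b\<bar> < c"
proof -
  have "\<bar>(1 - s) * a + s * b\<bar> \<le> (1 - s) * \<bar>a\<bar> + s * \<bar>b\<bar>"
    using assms by (intro order_trans[OF abs_triangle_ineq]) (simp add: abs_mult)
  also have "\<dots> < (1 - s) * c + s * c"
    by (rule convex_comb_less) (use assms in auto)
  finally show ?thesis by (simp add: algebra_simps)
qed

text \<open>The admissible offsets for fixed \<open>f\<close>, \<open>\<tau>\<close> and
  \<open>p\<close> form a convex set, so interpolating between two of them deforms one cabling into
  the other. The ends wander through ordered configurations and are closed up there.\<close>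

lemma cable_change_offsets:
  assumes cd: "cable_data n m f d \<tau> p" and cd': "cable_data n m f d' \<tau> p"
  shows "homotopic_paths (conf m) (cable m f d \<tau> p) (cable m f d' \<tau> p)"
proof -
  define e where "e = (\<lambda>s k. (1 - s) * d k + s * d' k)"
  have e01: "e 0 = d" "e 1 = d'" by (auto simp: e_def)
  have cde: "cable_data n m f (e s) \<tau> p" if s: "0 \<le> s" "s \<le> 1" for s
  proof -
    have "offsets m f (e s)"
      using cd cd' s unfolding cable_data_def offsets_def e_def by (auto intro: convex_comb_less)
    moreover have "wide_conf n m f d \<inter> wide_conf n m f d' \<subseteq> wide_conf n m f (e s)"
    proof -
      have *: "e s k - e s l = (1 - s) * (d k - d l) + s * (d' k - d' l)" for k l
        by (simp add: e_def algebra_simps)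
      show ?thesis
        using s unfolding wide_conf_def * by (auto intro!: convex_comb_abs_less)
    qed
    ultimately show ?thesis
      using cd cd' unfolding cable_data_def by blast
  qed
  define K where "K = (\<lambda>(s, t). spread m f (e s) (p t))"
  have p: "path p" using cd by (auto simp: cable_data_def geometric_braid_def)
  have "continuous_on ({0..1} \<times> {0..1}) (\<lambda>x. p (snd x) k)" for k
    by (rule continuous_on_compose2[OF continuous_on_coordinate[OF p[unfolded path_def]]])
      (auto intro!: continuous_intros)
  then have "continuous_on ({0..1} \<times> {0..1}) (\<lambda>x. K x k)" for k
    by (cases "k < m") (auto simp: K_def spread_def case_prod_unfold e_def intro!: continuous_intros)
  then have K: "continuous_on ({0..1} \<times> {0..1}) K"
    by (rule continuous_on_coordinatewise_then_product)
  have "homotopic_paths (conf m)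
     (straight_path (base_conf m) (spread m f d (pathstart p)) +++ ((\<lambda>t. K (0, t)) +++
      straight_path (spread m f d (pathfinish p)) (placed_conf m \<tau>)))
     (straight_path (base_conf m) (spread m f d' (pathstart p)) +++ ((\<lambda>t. K (1, t)) +++
      straight_path (spread m f d' (pathfinish p)) (placed_conf m \<tau>)))"
  proof (rule homotopic_paths_close_up[OF K, where A = "ordered_conf m id" and B = "ordered_conf m \<tau>"])
    show "K ` ({0..1} \<times> {0..1}) \<subseteq> conf m"
    proof clarsimp
      fix s t :: real assume "0 \<le> s" "s \<le> 1" "0 \<le> t" "t \<le> 1"
      then show "K (s, t) \<in> conf m"
        using cable_data_path(2)[OF cde, of s] by (auto simp: K_def path_image_def image_subset_iff)
    qed
    show "K (s, 0) \<in> ordered_conf m id" if "s \<in> {0..1}" for s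
      using cable_data_start[OF cde] that by (auto simp: K_def pathstart_def)
    show "K (s, 1) \<in> ordered_conf m \<tau>" if "s \<in> {0..1}" for s
      using cable_data_finish[OF cde] that by (auto simp: K_def pathfinish_def)
  qed (use cable_data_ends[OF cd] cable_data_ends[OF cd'] cable_data_inj[OF cd] in
      \<open>auto simp: K_def e01 pathstart_def[of p] pathfinish_def[of p] intro: homotopic_paths_conf_if_ordered[OF inj_on_id] homotopic_paths_conf_if_ordered[where \<tau> = \<tau>]\<close>)
  then show ?thesis
    by (simp add: cable_def K_def e01 comp_def)
qed

lemma cable_homotopic_wide:
  assumes cd: "cable_data n m f d \<tau> p" and hom: "homotopic_paths (wide_conf n m f d) p q"
  shows "homotopic_paths (conf m) (cable m f d \<tau> p) (cable m f d \<tau> q)"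
proof -
  have "homotopic_paths (conf m) (spread m f d \<circ> p) (spread m f d \<circ> q)"
    using cd by (intro homotopic_paths_continuous_image[OF hom] continuous_on_spread)
      (auto simp: cable_data_def intro: spread_conf)
  moreover have "pathstart q = pathstart p" "pathfinish q = pathfinish p"
    using hom homotopic_paths_imp_pathstart homotopic_paths_imp_pathfinish by metis+
  ultimately show ?thesis
    unfolding cable_def using cable_data_ends_conf[OF cd]
    by (intro homotopic_paths_join) (auto simp: pathstart_compose pathfinish_compose)
qed

text \<open>The image of a homotopy is compact, so one separation bound serves all its stages;
  offsets below this bound are admissible during the whole homotopy.\<close>

lemma homotopic_paths_separated:
  assumes "homotopic_paths (conf n) p q"
  obtains e :: real where "0 < e"
    "homotopic_paths {z \<in> conf n. \<forall>i<n. \<forall>j<n. i \<noteq> j \<longrightarrow> e < dist (z i) (z j)} p q"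
proof -
  obtain h :: "real \<times> real \<Rightarrow> nat \<Rightarrow> complex" where h: "continuous_on ({0..1} \<times> {0..1}) h" "h \<in> {0..1} \<times> {0..1} \<rightarrow> conf n"
    "\<forall>x\<in>{0..1}. h (0, x) = p x" "\<forall>x\<in>{0..1}. h (1, x) = q x"
    "\<forall>t\<in>{0..1}. pathstart (h \<circ> Pair t) = pathstart p \<and> pathfinish (h \<circ> Pair t) = pathfinish p"
    using assms unfolding homotopic_paths by blast
  have "compact (h ` ({0..1} \<times> {0..1}))"
    by (intro compact_continuous_image h compact_Times) auto
  moreover have "h ` ({0..1} \<times> {0..1}) \<subseteq> conf n" using h(2) by auto
  ultimately obtain e :: real where e: "0 < e"
    "\<And>z i j. \<lbrakk>z \<in> h ` ({0..1} \<times> {0..1}); i < n; j < n; i \<noteq> j\<rbrakk> \<Longrightarrow> e < dist (z i) (z j)"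
    by (rule compact_conf_separated) blast
  have "homotopic_paths {z \<in> conf n. \<forall>i<n. \<forall>j<n. i \<noteq> j \<longrightarrow> e < dist (z i) (z j)} p q"
    unfolding homotopic_paths
    by (rule exI[of _ h]) (use h e(2) in \<open>auto simp: Pi_iff\<close>)
  then show ?thesis using that e(1) by blast
qed

lemma cable_cong: "(\<And>k. k < m \<Longrightarrow> \<tau> k = \<tau>' k) \<Longrightarrow> cable m f d \<tau> p = cable m f d \<tau>' p"
  by (simp add: cable_def placed_conf_def cong: if_cong)

text \<open>Cabling is well defined on isotopy classes: replace the offsets by ones thin enough for
  the whole homotopy, follow the homotopy with these fixed, and pass to the offsets of the other
  cabling. The end order is forced by \<open>cable_perm_unique\<close>.\<close>

lemma cable_unique:
  assumes cd: "cable_data n m f d \<tau> p" and cd': "cable_data n m f d' \<tau>' p'"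
    and hom: "homotopic_paths (conf n) p p'"
  shows "homotopic_paths (conf m) (cable m f d \<tau> p) (cable m f d' \<tau>' p')"
proof -
  have ep: "end_pos p' = end_pos p" using end_pos_homotopic[OF hom] by simp
  have f: "\<And>k. k < m \<Longrightarrow> f k < n" using cd by (auto simp: cable_data_def monotone_map_def)
  have "inj_on (end_pos p) (f ` {..<m})"
    using geometric_braid_finish(2)[of n p] cd f
    by (auto simp: cable_data_def bij_betw_def intro: inj_on_subset)
  then have \<tau>: "\<tau>' k = \<tau> k" if "k < m" for k
    using cable_perm_unique[of m f "end_pos p" \<tau>' \<tau> k] cd cd' ep that by (auto simp: cable_data_def)
  then have perm': "cable_perm m f (end_pos p') \<tau>"
    using cd ep by (auto simp: cable_data_def)
  obtain e :: real where e: "0 < e"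
    "homotopic_paths {z \<in> conf n. \<forall>i<n. \<forall>j<n. i \<noteq> j \<longrightarrow> e < dist (z i) (z j)} p p'"
    using homotopic_paths_separated[OF hom] by blast
  obtain c where c: "offsets m f c" "\<And>k l. \<lbrakk>k < m; l < m\<rbrakk> \<Longrightarrow> \<bar>c k - c l\<bar> < e"
    using offsets_exist[OF e(1)] by blast
  have homc: "homotopic_paths (wide_conf n m f c) p p'"
    by (rule homotopic_paths_subset[OF e(2)]) (use c(2) f in \<open>auto intro: wide_conf_separated[where e = e]\<close>)
  have c1: "cable_data n m f c \<tau> p" and c2: "cable_data n m f c \<tau> p'"
    using cd cd' c(1) homotopic_paths_imp_subset[OF homc] perm' by (auto simp: cable_data_def)
  have "cable_data n m f d' \<tau> p'" using cd' perm' by (auto simp: cable_data_def)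
  from cable_change_offsets[OF cd c1] cable_homotopic_wide[OF c1 homc] cable_change_offsets[OF c2 this]
  have "homotopic_paths (conf m) (cable m f d \<tau> p) (cable m f d' \<tau> p')"
    by (blast intro: homotopic_paths_trans)
  then show ?thesis using cable_cong[of m \<tau> \<tau>'] \<tau> by simp
qed

text \<open>The bound \<open>e\<close> is left free so that cables can be made as thin as a later
  construction requires.\<close>

lemma cable_data_exists:
  assumes "geometric_braid n p" "monotone_map m n f" "cable_perm m f (end_pos p) \<tau>" "0 < e"
  obtains d where "cable_data n m f d \<tau> p" "\<And>k l. \<lbrakk>k < m; l < m\<rbrakk> \<Longrightarrow> \<bar>d k - d l\<bar> < e"
proof -
  have p: "path_image p \<subseteq> conf n" "compact (path_image p)"
    using assms(1) by (auto simp: geometric_braid_def compact_path_image)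
  obtain e' :: real where e': "0 < e'"
    "\<And>z i j. \<lbrakk>z \<in> path_image p; i < n; j < n; i \<noteq> j\<rbrakk> \<Longrightarrow> e' < dist (z i) (z j)"
    using compact_conf_separated[OF p(2,1)] by blast
  obtain d where d: "offsets m f d" "\<And>k l. \<lbrakk>k < m; l < m\<rbrakk> \<Longrightarrow> \<bar>d k - d l\<bar> < min e e'"
    using offsets_exist[of "min e e'"] e'(1) assms(4) by auto
  show ?thesis
  proof (rule that[of d])
    show "cable_data n m f d \<tau> p"
      using assms d p e'(2) unfolding cable_data_def
      by (auto intro!: wide_conf_separated[where e = e'] simp: monotone_map_def)
  qed (use d in auto)
qed


section \<open>Composition of braids and of cablings\<close>

definition relabel :: "nat \<Rightarrow> (nat \<Rightarrow> nat) \<Rightarrow> (nat \<Rightarrow> complex) \<Rightarrow> nat \<Rightarrow> complex" where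
  "relabel n \<pi> z = (\<lambda>i. if i < n then z (\<pi> i) else 0)"

lemma braid_comp_eq_relabel: "braid_comp n p q = p +++ (relabel n (end_pos p) \<circ> q)"
  by (simp add: braid_comp_def relabel_def comp_def)

lemma continuous_on_relabel: "continuous_on S (relabel n \<pi>)"
proof (unfold relabel_def, rule continuous_on_coordinatewise_then_product)
  show "continuous_on S (\<lambda>z. if i < n then z (\<pi> i) else (0::complex))" for i
    by (cases "i < n") (auto intro: continuous_on_subset[OF continuous_on_product_coordinates])
qed

lemma relabel_conf:
  assumes "bij_betw \<pi> {..<n} {..<n}" "z \<in> conf n"
  shows "relabel n \<pi> z \<in> conf n"
  using assms unfolding conf_def relabel_def bij_betw_def inj_on_def by (auto simp: image_def) blast+

lemma relabel_base: "bij_betw \<pi> {..<n} {..<n} \<Longrightarrow> relabel n \<pi> (base_conf n) = placed_conf n \<pi>"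
  by (auto simp: relabel_def base_conf_def placed_conf_def bij_betw_def fun_eq_iff image_def)

lemma relabel_placed:
  "bij_betw \<pi> {..<n} {..<n} \<Longrightarrow> relabel n \<pi> (placed_conf n \<rho>) = placed_conf n (\<rho> \<circ> \<pi>)"
  by (auto simp: relabel_def placed_conf_def bij_betw_def fun_eq_iff image_def)

context
  fixes n p q
  assumes p: "geometric_braid n p" and q: "geometric_braid n q"
begin

lemma relabel_braid_path:
  "path (relabel n (end_pos p) \<circ> q)" "path_image (relabel n (end_pos p) \<circ> q) \<subseteq> conf n"
  "pathstart (relabel n (end_pos p) \<circ> q) = pathfinish p"
  "pathfinish (relabel n (end_pos p) \<circ> q) = placed_conf n (end_pos q \<circ> end_pos p)"
proof -
  note \<pi> = geometric_braid_finish[OF p] geometric_braid_finish[OF q]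
  show "path (relabel n (end_pos p) \<circ> q)"
    using q by (auto simp: geometric_braid_def intro: path_continuous_image continuous_on_relabel)
  show "path_image (relabel n (end_pos p) \<circ> q) \<subseteq> conf n"
    using q relabel_conf[OF \<pi>(2)] by (auto simp: path_image_compose geometric_braid_def)
  show "pathstart (relabel n (end_pos p) \<circ> q) = pathfinish p"
    using q relabel_base[OF \<pi>(2)] \<pi>(1) by (simp add: pathstart_compose geometric_braid_def)
  show "pathfinish (relabel n (end_pos p) \<circ> q) = placed_conf n (end_pos q \<circ> end_pos p)"
    using relabel_placed[OF \<pi>(2)] \<pi>(4) by (metis pathfinish_compose)
qed

lemma geometric_braid_comp: "geometric_braid n (braid_comp n p q)"
proof (rule geometric_braidI)
  show "bij_betw (end_pos q \<circ> end_pos p) {..<n} {..<n}"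
    using geometric_braid_finish(2)[OF p] geometric_braid_finish(2)[OF q] by (rule bij_betw_trans)
qed (use p relabel_braid_path in \<open>auto simp: braid_comp_eq_relabel path_image_join geometric_braid_def\<close>)

lemma end_pos_comp: "i < n \<Longrightarrow> end_pos (braid_comp n p q) i = end_pos q (end_pos p i)"
  using end_pos_eq[of "braid_comp n p q" n "end_pos q \<circ> end_pos p" i] relabel_braid_path(4)
  by (simp add: braid_comp_eq_relabel)

end

lemma braid_comp_homotopic:
  assumes "geometric_braid n p" "geometric_braid n q"
    and "homotopic_paths (conf n) p p'" "homotopic_paths (conf n) q q'"
  shows "homotopic_paths (conf n) (braid_comp n p q) (braid_comp n p' q')"
proof -
  have "end_pos p' = end_pos p" using end_pos_homotopic[OF assms(3)] by simp
  moreover have "homotopic_paths (conf n) (relabel n (end_pos p) \<circ> q) (relabel n (end_pos p) \<circ> q')"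
    using relabel_conf[OF geometric_braid_finish(2)[OF assms(1)]]
    by (intro homotopic_paths_continuous_image[OF assms(4)] continuous_on_relabel) auto
  ultimately show ?thesis
    using assms relabel_braid_path(3)[OF assms(1,2)]
    by (auto simp: braid_comp_eq_relabel intro: homotopic_paths_join)
qed

text \<open>By \<open>cable_unique\<close> both cablings may be made thin, with offsets differing by
  less than half the separation of \<open>p\<close>; their sum is then an admissible offset for the
  composed map. The straightening segments of the two layers run in ordered configurations and
  merge.\<close>

lemma cable_cable:
  assumes cf: "cable_data n m' f d \<sigma> p" and cg: "cable_data m' m g c \<tau> (cable m' f d \<sigma> p)"
  obtains b where "cable_data n m (f \<circ> g) b \<tau> p"
    "homotopic_paths (conf m) (cable m g c \<tau> (cable m' f d \<sigma> p)) (cable m (f \<circ> g) b \<tau> p)"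
proof -
  have p: "geometric_braid n p" and monf: "monotone_map m' n f" and mong: "monotone_map m m' g"
    and permf: "cable_perm m' f (end_pos p) \<sigma>"
    and permg: "cable_perm m g (end_pos (cable m' f d \<sigma> p)) \<tau>"
    using cf cg by (auto simp: cable_data_def)
  have glt: "g k < m'" if "k < m" for k using mong that by (auto simp: monotone_map_def)
  have flt: "f k < n" if "k < m'" for k using monf that by (auto simp: monotone_map_def)
  obtain e :: real where e: "0 < e"
    "\<And>z i j. \<lbrakk>z \<in> path_image p; i < n; j < n; i \<noteq> j\<rbrakk> \<Longrightarrow> e < dist (z i) (z j)"
    using compact_conf_separated[of "path_image p" n] p compact_path_image
    unfolding geometric_braid_def by blast
  obtain d0 where d0: "cable_data n m' f d0 \<sigma> p" "\<And>k l. \<lbrakk>k < m'; l < m'\<rbrakk> \<Longrightarrow> \<bar>d0 k - d0 l\<bar> < e / 2"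
    using cable_data_exists[OF p monf permf, of "e/2"] e(1) by (metis half_gt_zero)
  define q where "q = cable m' f d0 \<sigma> p"
  have hq: "homotopic_paths (conf m') (cable m' f d \<sigma> p) q"
    using cable_unique[OF cf d0(1)] p unfolding q_def by (simp add: geometric_braid_def)
  have q: "geometric_braid m' q" unfolding q_def by (rule geometric_braid_cable[OF d0(1)])
  have permq: "cable_perm m g (end_pos q) \<tau>"
    using permg end_pos_homotopic[OF hq] by simp
  obtain c0 where c0: "cable_data m' m g c0 \<tau> q" "\<And>k l. \<lbrakk>k < m; l < m\<rbrakk> \<Longrightarrow> \<bar>c0 k - c0 l\<bar> < e / 2"
    using cable_data_exists[OF q mong permq, of "e/2"] e(1) by (metis half_gt_zero)
  \<comment> \<open>A strand has the offset of its bundle plus the offset inside that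
    bundle.\<close>
  define b0 where "b0 = (\<lambda>k. d0 (g k) + c0 k)"
  have im_q: "path_image q \<subseteq> wide_conf m' m g c0" using c0(1) by (simp add: cable_data_def)
  define A B where "A = straight_path (base_conf m') (spread m' f d0 (pathstart p))"
    and "B = straight_path (spread m' f d0 (pathfinish p)) (placed_conf m' \<sigma>)"
  define A' B' where "A' = straight_path (base_conf m) (spread m g c0 (base_conf m'))"
    and "B' = straight_path (spread m g c0 (placed_conf m' \<sigma>)) (placed_conf m \<tau>)"
  define P where "P = spread m' f d0 \<circ> p"
  note cP = cable_data_path[OF d0(1), folded P_def]
  have qeq: "q = A +++ (P +++ B)"
    by (simp add: q_def cable_def A_def B_def P_def)
  have imq3: "path_image q = path_image A \<union> (path_image P \<union> path_image B)"
    unfolding qeq by (simp add: path_image_join A_def B_def P_def pathstart_compose pathfinish_compose)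
  have b0: "cable_data n m (f \<circ> g) b0 \<tau> p"
  proof -
    have "offsets m (f \<circ> g) b0"
    proof -
      have "b0 k < b0 l" if kl: "k < l" "l < m" "f (g k) = f (g l)" for k l
      proof (cases "g k = g l")
        case True
        then show ?thesis using c0(1) kl by (auto simp: cable_data_def offsets_def b0_def)
      next
        case False
        then have "g k < g l" using mong kl by (auto simp: monotone_map_def le_neq_implies_less)
        then have d: "d0 (g k) < d0 (g l)"
          using d0(1) kl glt by (auto simp: cable_data_def offsets_def)
        \<comment> \<open>The strands \<open>g k\<close> and \<open>g l\<close> follow the same
          strand of \<open>p\<close>, so their distance is constantly
          \<open>\<bar>d0 (g k) - d0 (g l)\<bar>\<close>. Wideness at a single time thus shows that
          the inner offsets cannot reverse their order.\<close>
        have "P 0 \<in> wide_conf m' m g c0"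
          using im_q imq3 by (auto simp: path_image_def)
        then have "\<bar>c0 k - c0 l\<bar> < dist (P 0 (g k)) (P 0 (g l))"
          using kl False by (auto simp: wide_conf_def)
        also have "\<dots> = dist (complex_of_real (d0 (g k))) (of_real (d0 (g l)))"
          using kl glt by (simp add: P_def spread_def dist_norm)
        also have "\<dots> = \<bar>d0 (g k) - d0 (g l)\<bar>"
          by (metis dist_norm norm_of_real of_real_diff)
        finally show ?thesis using d by (auto simp: b0_def)
      qed
      then show ?thesis by (auto simp: offsets_def)
    qed
    moreover have "path_image p \<subseteq> wide_conf n m (f \<circ> g) b0"
    proof
      fix z assume z: "z \<in> path_image p"
      show "z \<in> wide_conf n m (f \<circ> g) b0"
      proof (rule wide_conf_separated[where e = e])
        show "\<bar>b0 k - b0 l\<bar> < e" if "k < m" "l < m" for k l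
          using d0(2)[OF glt[OF that(1)] glt[OF that(2)]] c0(2)[OF that]
          unfolding b0_def abs_less_iff by linarith
      qed (use z e p glt flt in \<open>auto simp: geometric_braid_def\<close>)
    qed
    moreover have "monotone_map m n (f \<circ> g)"
      using monf mong unfolding monotone_map_def comp_def by (metis le_neq_implies_less order_refl)
    moreover have "cable_perm m (f \<circ> g) (end_pos p) \<tau>"
    proof -
      have "end_pos p (f (g k)) < end_pos p (f (g l)) \<or> f (g k) = f (g l) \<and> k < l"
        if kl: "k < m" "l < m" "\<tau> k < \<tau> l" for k l
      proof -
        have "end_pos q (g k) < end_pos q (g l) \<or> g k = g l \<and> k < l"
          using permq kl by (auto simp: cable_perm_def)
        then have "\<sigma> (g k) < \<sigma> (g l) \<or> g k = g l \<and> k < l"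
          using end_pos_cable[OF d0(1)] glt kl by (simp add: q_def)
        moreover have "g l \<le> g k" if "l \<le> k"
          using mong that kl(1) unfolding monotone_map_def by (cases "l = k") simp_all
        ultimately have *: "\<sigma> (g k) < \<sigma> (g l) \<or> g k = g l \<and> k < l" "g k < g l \<Longrightarrow> k < l"
          by (auto simp: not_le[symmetric])
        have "end_pos p (f (g k)) < end_pos p (f (g l)) \<or> f (g k) = f (g l) \<and> g k < g l"
          if "\<sigma> (g k) < \<sigma> (g l)"
          using permf[unfolded cable_perm_def, THEN conjunct2, rule_format, OF glt[OF kl(1)] glt[OF kl(2)] that] .
        then show ?thesis
          using * by metis
      qed
      then show ?thesis using permq by (auto simp: cable_perm_def)
    qed
    ultimately show ?thesis using p by (simp add: cable_data_def)
  qed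
  have ss: "spread m g c0 (spread m' f d0 z) = spread m (f \<circ> g) b0 z" for z
    using glt by (auto simp: spread_def b0_def)
  then have sp: "spread m g c0 \<circ> P = spread m (f \<circ> g) b0 \<circ> p"
    by (auto simp: P_def)
  have ords: "path_image (spread m g c0 \<circ> A) \<subseteq> ordered_conf m id"
    "path_image (spread m g c0 \<circ> B) \<subseteq> ordered_conf m \<tau>"
  proof -
    have off: "offsets m g c0" using c0(1) by (simp add: cable_data_def)
    have perm\<sigma>: "cable_perm m g \<sigma> \<tau>"
      using permq glt end_pos_cable[OF d0(1)] by (simp add: cable_perm_def q_def)
    show "path_image (spread m g c0 \<circ> A) \<subseteq> ordered_conf m id"
      using cable_data_ends(1)[OF d0(1)] im_q imq3
        spread_ordered_conf[OF cable_perm_id[OF mong] off _ _ glt]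
      unfolding path_image_compose A_def by blast
    show "path_image (spread m g c0 \<circ> B) \<subseteq> ordered_conf m \<tau>"
      using cable_data_ends(2)[OF d0(1)] im_q imq3 spread_ordered_conf[OF perm\<sigma> off _ _ glt]
      unfolding path_image_compose B_def by blast
  qed
  have ords': "path_image A' \<subseteq> ordered_conf m id" "path_image B' \<subseteq> ordered_conf m \<tau>"
    using cable_data_ends[OF c0(1)] by (auto simp: A'_def B'_def qeq A_def B_def)
  have inj\<tau>: "inj_on \<tau> {..<m}" using cable_data_inj[OF c0(1)] .
  note oc = subset_trans[OF _ ordered_conf_subset_conf[OF inj_on_id]]
    subset_trans[OF _ ordered_conf_subset_conf[OF inj\<tau>]]
  note paths = path_continuous_image[OF _ continuous_on_spread]
  define GA GP GB where "GA = spread m g c0 \<circ> A" and "GP = spread m g c0 \<circ> P" and "GB = spread m g c0 \<circ> B"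
  have pp: "path A'" "path B'" "path GA" "path GP" "path GB"
    using cP(1) by (auto simp: A'_def B'_def GA_def GP_def GB_def A_def B_def intro: paths)
  have ii: "path_image A' \<subseteq> conf m" "path_image B' \<subseteq> conf m" "path_image GA \<subseteq> conf m"
    "path_image GP \<subseteq> conf m" "path_image GB \<subseteq> conf m"
    using ords ords' oc cable_data_path(2)[OF b0] by (auto simp: GA_def GP_def GB_def sp)
  have ee: "pathfinish A' = pathstart GA" "pathfinish GA = pathstart GP" "pathfinish GP = pathstart GB"
    "pathfinish GB = pathstart B'"
    by (simp_all add: A'_def GA_def GP_def GB_def B'_def A_def B_def P_def pathstart_compose pathfinish_compose)
  have "homotopic_paths (conf m) (cable m g c \<tau> (cable m' f d \<sigma> p)) (cable m g c0 \<tau> q)"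
    by (rule cable_unique[OF cg c0(1) hq])
  also have "cable m g c0 \<tau> q = A' +++ ((GA +++ (GP +++ GB)) +++ B')"
    by (simp add: cable_def qeq path_compose_join A'_def B'_def GA_def GP_def GB_def A_def B_def)
  also have "homotopic_paths (conf m) \<dots> ((A' +++ GA) +++ ((GP +++ GB) +++ B'))"
    by (rule homotopic_paths_sym, rule homotopic_paths_assoc_middle)
      (use pp ii ee in \<open>auto simp: path_image_join\<close>)
  \<comment> \<open>The two segments before the cabled middle stay in one ordered set, and so do the
    two after it; each pair contracts to a single straight segment.\<close>
  also have "homotopic_paths (conf m) \<dots> (cable m (f \<circ> g) b0 \<tau> p)"
  proof -
    have 1: "homotopic_paths (conf m) (A' +++ GA)
        (straight_path (base_conf m) (spread m (f \<circ> g) b0 (pathstart p)))"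
      by (rule homotopic_paths_conf_if_ordered[OF inj_on_id])
        (use pp(1,3) ee(1) ords(1) ords'(1) cable_data_ends(1)[OF b0] in
          \<open>auto simp: path_image_join GA_def[symmetric]\<close>,
         auto simp: GA_def A'_def A_def pathfinish_compose ss)
    have "homotopic_paths (conf m) ((GP +++ GB) +++ B') (GP +++ (GB +++ B'))"
      by (rule homotopic_paths_sym, rule homotopic_paths_assoc) (use pp ii ee in auto)
    also have "homotopic_paths (conf m) \<dots>
        (GP +++ straight_path (spread m (f \<circ> g) b0 (pathfinish p)) (placed_conf m \<tau>))"
    proof (rule homotopic_paths_join)
      show "homotopic_paths (conf m) (GB +++ B')
         (straight_path (spread m (f \<circ> g) b0 (pathfinish p)) (placed_conf m \<tau>))"
        by (rule homotopic_paths_conf_if_ordered[OF inj\<tau>])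
          (use pp(2,5) ee(4) ords(2) ords'(2) cable_data_ends(2)[OF b0] in
            \<open>auto simp: path_image_join GB_def[symmetric]\<close>,
           auto simp: GB_def B'_def B_def pathstart_compose ss)
    qed (use pp ii ee in auto)
    finally have 2: "homotopic_paths (conf m) ((GP +++ GB) +++ B')
        (GP +++ straight_path (spread m (f \<circ> g) b0 (pathfinish p)) (placed_conf m \<tau>))" .
    have GPeq: "GP = spread m (f \<circ> g) b0 \<circ> p" using sp by (simp add: GP_def)
    show ?thesis
      unfolding cable_def GPeq[symmetric]
      by (rule homotopic_paths_join[OF 1 2]) (use ee in auto)
  qed
  finally show ?thesis using that b0 by blast
qed

text \<open>Uniqueness of the end order makes \<open>\<tau>\<close> the identity on the strands, so
  the whole loop stays in one set of ordered configurations and contracts.\<close>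

lemma cable_const:
  assumes "cable_data n m f d \<tau> (\<lambda>t. base_conf n)"
  shows "homotopic_paths (conf m) (cable m f d \<tau> (\<lambda>t. base_conf n)) (\<lambda>t. base_conf m)"
proof -
  have mon: "monotone_map m n f" using assms by (simp add: cable_data_def)
  have g: "geometric_braid n (\<lambda>t. base_conf n)" using assms by (simp add: cable_data_def)
  have ep: "end_pos (\<lambda>t. base_conf n) i = i" if "i < n" for i
    by (rule end_pos_eq[where \<pi> = "\<lambda>i. i", OF _ that]) (auto simp: pathfinish_def base_conf_def placed_conf_def)
  have "cable_perm m f (end_pos (\<lambda>t. base_conf n)) id"
    using cable_perm_id[OF mon] ep mon by (auto simp: cable_perm_def monotone_map_def)
  moreover have "cable_perm m f (end_pos (\<lambda>t. base_conf n)) \<tau>"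
    using assms by (simp add: cable_data_def)
  moreover have "inj_on (end_pos (\<lambda>t. base_conf n)) (f ` {..<m})"
    using ep mon by (auto simp: inj_on_def monotone_map_def)
  ultimately have \<tau>: "\<tau> k = k" if "k < m" for k
    using cable_perm_unique that by (metis id_apply)
  have pl: "placed_conf m \<tau> = base_conf m"
    using \<tau> by (auto simp: placed_conf_def base_conf_def)
  have o: "ordered_conf m \<tau> = ordered_conf m id"
    using \<tau> by (auto simp: ordered_conf_def)
  have c: "spread m f d \<circ> (\<lambda>t. base_conf n) = (\<lambda>t. spread m f d (base_conf n))" by auto
  have s: "spread m f d (base_conf n) \<in> ordered_conf m id"
    using cable_data_start[OF assms] by (simp add: pathstart_def)
  have b: "base_conf m \<in> ordered_conf m id"
    unfolding base_conf_eq_placed by (rule placed_in_ordered_conf)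
  have const: "path (\<lambda>t. x)" "pathstart (\<lambda>t. x) = x" "pathfinish (\<lambda>t. x) = x" "path_image (\<lambda>t. x) = {x}"
    for x :: "nat \<Rightarrow> complex"
    by (auto simp: path_def pathstart_def pathfinish_def path_image_def)
  show ?thesis
    unfolding cable_def c const pl
    by (rule homotopic_paths_conf_if_ordered[OF inj_on_id])
      (use s b path_image_straight_path_ordered[OF s b] path_image_straight_path_ordered[OF b s] in
        \<open>auto simp: const path_image_join\<close>)
qed

text \<open>The condition \<open>fg\<close> says that the bundles of the second cabling start where
  those of the first arrive. With offsets carried along the strands, the straightening at the end of
  the first factor cancels the one at the start of the second.\<close>

lemma cable_comp:
  assumes cp: "cable_data n m f d \<tau> p" and cq: "cable_data n m g c \<sigma> q"
    and cpq: "cable_data n m f b \<rho> (braid_comp n p q)"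
    and fg: "\<And>k. k < m \<Longrightarrow> g (\<tau> k) = end_pos p (f k)"
  shows "homotopic_paths (conf m) (braid_comp m (cable m f d \<tau> p) (cable m g c \<sigma> q))
           (cable m f b \<rho> (braid_comp n p q))"
proof -
  have p: "geometric_braid n p" and q: "geometric_braid n q" and monf: "monotone_map m n f"
    and permf: "cable_perm m f (end_pos p) \<tau>" and permg: "cable_perm m g (end_pos q) \<sigma>"
    and mong: "monotone_map m n g"
    using cp cq by (auto simp: cable_data_def)
  note \<pi> = geometric_braid_finish[OF p] geometric_braid_finish[OF q]
  have flt: "f k < n" if "k < m" for k using monf that by (auto simp: monotone_map_def)
  have glt: "g k < n" if "k < m" for k using mong that by (auto simp: monotone_map_def)
  have bij\<tau>: "bij_betw \<tau> {..<m} {..<m}" and bij\<sigma>: "bij_betw \<sigma> {..<m} {..<m}"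
    using permf permg by (auto simp: cable_perm_def)
  have \<tau>lt: "\<tau> k < m" if "k < m" for k using bij\<tau> that by (auto simp: bij_betw_def)
  let ?C = "path_image p \<union> path_image q"
  obtain e :: real where e: "0 < e"
    "\<And>z i j. \<lbrakk>z \<in> ?C; i < n; j < n; i \<noteq> j\<rbrakk> \<Longrightarrow> e < dist (z i) (z j)"
    using compact_conf_separated[of ?C n] p q compact_path_image compact_Un
    unfolding geometric_braid_def by (metis Un_least)
  obtain d0 where d0: "cable_data n m f d0 \<tau> p" "\<And>k l. \<lbrakk>k < m; l < m\<rbrakk> \<Longrightarrow> \<bar>d0 k - d0 l\<bar> < e"
    using cable_data_exists[OF p monf permf e(1)] by blast
  define \<theta> where "\<theta> = inv_into {..<m} \<tau>"
  have \<theta>: "\<theta> j < m" "\<tau> (\<theta> j) = j" if "j < m" for j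
    using bij\<tau> that unfolding \<theta>_def by (auto simp: bij_betw_def intro: inv_into_into f_inv_into_f)
     (metis inv_into_into lessThan_iff)
  have \<theta>\<tau>: "\<theta> (\<tau> k) = k" if "k < m" for k
    using bij\<tau> that unfolding \<theta>_def by (auto simp: bij_betw_def)
  \<comment> \<open>Position \<open>j\<close> is reached by strand \<open>\<theta> j\<close> of the
    first cabling. Giving it the offset of that strand makes the two spread middle parts fit without
    correction.\<close>
  define c0 where "c0 = d0 \<circ> \<theta>"
  have c0: "cable_data n m g c0 \<sigma> q"
    unfolding cable_data_def
  proof (intro conjI q mong permg subsetI)
    show "offsets m g c0"
      unfolding offsets_def
    proof (intro allI impI, elim conjE)
      fix j l assume jl: "j < l" "l < m" "g j = g l"
      then have "j < m" by simp
      have "end_pos p (f (\<theta> j)) = end_pos p (f (\<theta> l))"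
        using fg[OF \<theta>(1)[OF \<open>j < m\<close>]] fg[OF \<theta>(1)[OF jl(2)]] \<theta> jl \<open>j < m\<close> by simp
      moreover have "end_pos p (f (\<theta> j)) < end_pos p (f (\<theta> l)) \<or> f (\<theta> j) = f (\<theta> l) \<and> \<theta> j < \<theta> l"
        using permf \<theta> jl \<open>j < m\<close> unfolding cable_perm_def by metis
      ultimately show "c0 j < c0 l"
        using d0(1) \<theta> jl by (auto simp: c0_def cable_data_def offsets_def)
    qed
    show "z \<in> wide_conf n m g c0" if "z \<in> path_image q" for z
      by (rule wide_conf_separated[where e = e])
        (use that q e glt d0(2) \<theta> in \<open>auto simp: geometric_braid_def c0_def\<close>)
  qed
  have pq: "geometric_braid n (braid_comp n p q)" by (rule geometric_braid_comp[OF p q])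
  have b0: "cable_data n m f d0 (\<sigma> \<circ> \<tau>) (braid_comp n p q)"
    unfolding cable_data_def
  proof (intro conjI pq monf subsetI)
    show "offsets m f d0" using d0(1) by (simp add: cable_data_def)
    show "z \<in> wide_conf n m f d0" if "z \<in> path_image (braid_comp n p q)" for z
    proof -
      have zc: "z \<in> conf n" using that pq by (auto simp: geometric_braid_def)
      from that have "z \<in> path_image p \<or> z \<in> relabel n (end_pos p) ` path_image q"
        using relabel_braid_path(3)[OF p q] by (simp add: braid_comp_eq_relabel path_image_join path_image_compose)
      then have sep: "e < dist (z i) (z j)" if "i < n" "j < n" "i \<noteq> j" for i j
      proof
        assume "z \<in> relabel n (end_pos p) ` path_image q"
        then obtain w where "w \<in> path_image q" "z = relabel n (end_pos p) w" by blast
        moreover have "end_pos p i \<noteq> end_pos p j"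
          using \<pi>(2) that by (auto simp: bij_betw_def dest: inj_onD)
        ultimately show ?thesis
          using that e(2)[of w "end_pos p i" "end_pos p j"] end_pos_less[OF p]
          by (simp add: relabel_def)
      qed (use that e in auto)
      show ?thesis by (rule wide_conf_separated[OF zc sep]) (use d0(2) flt in auto)
    qed
    have "end_pos (braid_comp n p q) (f k) < end_pos (braid_comp n p q) (f l) \<or> f k = f l \<and> k < l"
      if kl: "k < m" "l < m" "\<sigma> (\<tau> k) < \<sigma> (\<tau> l)" for k l
    proof -
      have "end_pos q (g (\<tau> k)) < end_pos q (g (\<tau> l)) \<or> g (\<tau> k) = g (\<tau> l) \<and> \<tau> k < \<tau> l"
        using permg kl \<tau>lt by (auto simp: cable_perm_def)
      moreover have "end_pos p (f k) < end_pos p (f l) \<or> f k = f l \<and> k < l" if "\<tau> k < \<tau> l"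
        using permf kl that by (auto simp: cable_perm_def)
      ultimately show ?thesis
        using fg kl flt end_pos_comp[OF p q] by auto
    qed
    then show "cable_perm m f (end_pos (braid_comp n p q)) (\<sigma> \<circ> \<tau>)"
      using bij_betw_trans[OF bij\<tau> bij\<sigma>] by (auto simp: cable_perm_def)
  qed
  define P Q where "P = cable m f d0 \<tau> p" and "Q = cable m g c0 \<sigma> q"
  have P: "geometric_braid m P" and Q: "geometric_braid m Q"
    using geometric_braid_cable d0(1) c0 unfolding P_def Q_def by blast+
  define A X B Y C where "A = straight_path (base_conf m) (spread m f d0 (pathstart p))"
    and "X = spread m f d0 \<circ> p"
    and "B = straight_path (spread m f d0 (pathfinish p)) (placed_conf m \<tau>)"
    and "Y = spread m f d0 \<circ> (relabel n (end_pos p) \<circ> q)"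
    and "C = straight_path (spread m f d0 (placed_conf n (end_pos q \<circ> end_pos p))) (placed_conf m (\<sigma> \<circ> \<tau>))"
  have rs: "relabel m \<tau> \<circ> straight_path u v = straight_path (relabel m \<tau> u) (relabel m \<tau> v)" for u v
    by (auto simp: relabel_def straight_path_def linepath_def fun_eq_iff)
  have eP: "relabel m (end_pos P) = relabel m \<tau>"
    using end_pos_cable[OF d0(1)] by (auto simp: P_def relabel_def fun_eq_iff)
  have rsp: "relabel m \<tau> (spread m g c0 z) = spread m f d0 (relabel n (end_pos p) z)" for z
    using \<tau>lt fg \<theta>\<tau> flt by (auto simp: relabel_def spread_def c0_def fun_eq_iff)
  \<comment> \<open>Seen from the strands of \<open>P\<close>, the second cabling opens with the
    segment \<open>B\<close> run backwards.\<close>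
  have "relabel m (end_pos P) \<circ> Q = reversepath B +++ (Y +++ C)"
  proof -
    have "relabel n (end_pos p) (base_conf n) = pathfinish p"
      using relabel_base \<pi> by metis
    moreover have "relabel m \<tau> (base_conf m) = placed_conf m \<tau>" using relabel_base[OF bij\<tau>] .
    moreover have "relabel m \<tau> (placed_conf m \<sigma>) = placed_conf m (\<sigma> \<circ> \<tau>)" using relabel_placed[OF bij\<tau>] .
    moreover have "relabel n (end_pos p) (pathfinish q) = placed_conf n (end_pos q \<circ> end_pos p)"
      using relabel_braid_path(4)[OF p q] by (simp add: pathfinish_compose)
    moreover have "pathstart q = base_conf n" using q by (simp add: geometric_braid_def)
    moreover have "relabel m \<tau> \<circ> (spread m g c0 \<circ> q) = Y" by (simp add: Y_def fun_eq_iff rsp)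
    ultimately show ?thesis
      by (simp add: Q_def cable_def path_compose_join rs eP rsp B_def C_def reversepath_straight_path)
  qed
  moreover have "P = A +++ (X +++ B)"
    by (simp add: P_def cable_def A_def X_def B_def)
  ultimately have PQ: "braid_comp m P Q = (A +++ (X +++ B)) +++ (reversepath B +++ (Y +++ C))"
    by (simp add: braid_comp_eq_relabel)
  have pq_parts: "pathstart (braid_comp n p q) = pathstart p"
    "pathfinish (braid_comp n p q) = placed_conf n (end_pos q \<circ> end_pos p)"
    using relabel_braid_path(4)[OF p q] by (simp_all add: braid_comp_eq_relabel)
  have XY: "X +++ Y = spread m f d0 \<circ> braid_comp n p q"
    by (simp add: X_def Y_def braid_comp_eq_relabel path_compose_join)
  have Yp: "path Y" "pathstart Y = pathfinish X" "pathfinish Y = pathstart C"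
    using relabel_braid_path[OF p q]
    by (auto simp: Y_def X_def C_def pathstart_compose pathfinish_compose
        intro: path_continuous_image continuous_on_spread)
  have "path_image (X +++ Y) \<subseteq> conf m"
    unfolding XY by (rule cable_data_path(2)[OF b0])
  then have XYi: "path_image X \<subseteq> conf m" "path_image Y \<subseteq> conf m"
    using Yp by (auto simp: path_image_join)
  have "homotopic_paths (conf m) (braid_comp m P Q) (A +++ ((X +++ Y) +++ C))"
    unfolding PQ
    by (rule homotopic_paths_cancel_middle)
      (use XYi Yp cable_data_path[OF d0(1)] cable_data_ends_conf[OF d0(1)] cable_data_ends_conf[OF b0] in
        \<open>auto simp: A_def B_def X_def C_def pq_parts pathstart_compose pathfinish_compose\<close>)
  also have "A +++ ((X +++ Y) +++ C) = cable m f d0 (\<sigma> \<circ> \<tau>) (braid_comp n p q)"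
    by (simp add: cable_def XY pq_parts A_def C_def)
  also have "homotopic_paths (conf m) \<dots> (cable m f b \<rho> (braid_comp n p q))"
    by (rule cable_unique[OF b0 cpq]) (use pq in \<open>auto simp: geometric_braid_def\<close>)
  finally have main: "homotopic_paths (conf m) (braid_comp m P Q) (cable m f b \<rho> (braid_comp n p q))" .
  have "homotopic_paths (conf m) (braid_comp m (cable m f d \<tau> p) (cable m g c \<sigma> q)) (braid_comp m P Q)"
    unfolding P_def Q_def
    by (intro braid_comp_homotopic geometric_braid_cable[OF cp] geometric_braid_cable[OF cq]
        cable_unique[OF cp d0(1)] cable_unique[OF cq c0])
      (use p q in \<open>auto simp: geometric_braid_def\<close>)
  then show ?thesis using main homotopic_paths_trans by blast
qed


section \<open>The algebra of braid groups and of strand splitting\<close>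

section \<open>The braid groups\<close>

lemma equiv_isotopy: "equiv {p. geometric_braid n p} (isotopy n)"
  by (rule equivI)
    (auto simp: isotopy_def refl_on_def sym_def trans_def geometric_braid_def
      intro: homotopic_paths_sym homotopic_paths_trans)

lemma isotopyI:
  "geometric_braid n p \<Longrightarrow> homotopic_paths (conf n) p q \<Longrightarrow> (p, q) \<in> isotopy n"
  using geometric_braid_homotopic by (auto simp: isotopy_def)

lemma isotopy_class_eqI:
  "geometric_braid n p \<Longrightarrow> homotopic_paths (conf n) p q \<Longrightarrow> isotopy n `` {p} = isotopy n `` {q}"
  by (intro equiv_class_eq[OF equiv_isotopy] isotopyI)

lemma homotopic_self: "geometric_braid n p \<Longrightarrow> homotopic_paths (conf n) p p"
  by (simp add: geometric_braid_def)

lemma braid_classI [intro]: "geometric_braid n p \<Longrightarrow> isotopy n `` {p} \<in> carrier (braid_group n)"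
  by (auto simp: braid_group_def intro: quotientI)

lemma class_self: "geometric_braid n p \<Longrightarrow> p \<in> isotopy n `` {p}"
  by (auto simp: isotopy_def geometric_braid_def)

lemma braid_class_rep:
  assumes "\<beta> \<in> carrier (braid_group n)" "p \<in> \<beta>"
  shows "geometric_braid n p" "\<beta> = isotopy n `` {p}"
proof -
  obtain q where q: "geometric_braid n q" "\<beta> = isotopy n `` {q}"
    using assms(1) by (auto simp: braid_group_def elim: quotientE)
  with assms(2) have "(q, p) \<in> isotopy n" by auto
  then show "geometric_braid n p" "\<beta> = isotopy n `` {p}"
    using q equiv_class_eq[OF equiv_isotopy] by (auto simp: isotopy_def)
qed

lemma braid_class_obtain:
  assumes "\<beta> \<in> carrier (braid_group n)"
  obtains p where "p \<in> \<beta>" "geometric_braid n p" "\<beta> = isotopy n `` {p}"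
proof -
  obtain q where q: "geometric_braid n q" "\<beta> = isotopy n `` {q}"
    using assms by (auto simp: braid_group_def elim: quotientE)
  moreover have "q \<in> \<beta>" using q by (auto simp: isotopy_def geometric_braid_def)
  ultimately show ?thesis using that by blast
qed

lemma braid_mult_class:
  assumes "geometric_braid n p" "geometric_braid n q"
  shows "isotopy n `` {p} \<otimes>\<^bsub>braid_group n\<^esub> isotopy n `` {q} = isotopy n `` {braid_comp n p q}"
proof -
  have "isotopy n `` {braid_comp n p' q'} = isotopy n `` {braid_comp n p q}"
    if "(p, p') \<in> isotopy n" "(q, q') \<in> isotopy n" for p' q'
    using that assms
    by (intro isotopy_class_eqI[symmetric] geometric_braid_comp braid_comp_homotopic) (auto simp: isotopy_def)
  then have "(\<Union>p'\<in>isotopy n `` {p}. \<Union>q'\<in>isotopy n `` {q}. isotopy n `` {braid_comp n p' q'}) =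
      (\<Union>p'\<in>isotopy n `` {p}. \<Union>q'\<in>isotopy n `` {q}. isotopy n `` {braid_comp n p q})"
    by (intro SUP_cong refl) simp
  also have "\<dots> = isotopy n `` {braid_comp n p q}"
    using class_self[OF assms(1)] class_self[OF assms(2)] by blast
  finally show ?thesis
    by (simp only: braid_group_def monoid.simps)
qed

lemma geometric_braid_base: "geometric_braid n (\<lambda>t. base_conf n)"
  by (rule geometric_braidI[of _ _ id])
    (auto simp: path_def path_image_def pathstart_def pathfinish_def conf_def base_conf_def
      placed_conf_def inj_on_def)

lemma end_pos_base: "i < n \<Longrightarrow> end_pos (\<lambda>t. base_conf n) i = i"
  using end_pos_eq[of "\<lambda>t. base_conf n" n id i] by (simp add: pathfinish_def base_conf_eq_placed)

lemma braid_comp_assoc: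
  assumes "geometric_braid n p" "geometric_braid n q" "geometric_braid n r"
  shows "homotopic_paths (conf n) (braid_comp n p (braid_comp n q r)) (braid_comp n (braid_comp n p q) r)"
proof -
  have *: "relabel n (end_pos p) \<circ> braid_comp n q r =
     (relabel n (end_pos p) \<circ> q) +++ (relabel n (end_pos (braid_comp n p q)) \<circ> r)"
    unfolding braid_comp_eq_relabel[of n q r] path_compose_join
    using end_pos_comp[OF assms(1,2)] end_pos_less[OF assms(1)]
    by (intro arg_cong2[of _ _ _ _ joinpaths]) (auto simp: relabel_def fun_eq_iff)
  have fin: "pathfinish (relabel n (end_pos p) \<circ> q) = pathstart (relabel n (end_pos (braid_comp n p q)) \<circ> r)"
    using relabel_braid_path(3)[OF geometric_braid_comp[OF assms(1,2)] assms(3)]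
    by (simp add: braid_comp_eq_relabel)
  have "homotopic_paths (conf n)
     (p +++ ((relabel n (end_pos p) \<circ> q) +++ (relabel n (end_pos (braid_comp n p q)) \<circ> r)))
     ((p +++ (relabel n (end_pos p) \<circ> q)) +++ (relabel n (end_pos (braid_comp n p q)) \<circ> r))"
    by (rule homotopic_paths_assoc)
      (use assms fin relabel_braid_path[OF assms(1,2)]
        relabel_braid_path[OF geometric_braid_comp[OF assms(1,2)] assms(3)] in \<open>auto simp: geometric_braid_def\<close>)
  then show ?thesis
    unfolding braid_comp_eq_relabel[of n p "braid_comp n q r"] *
    by (metis braid_comp_eq_relabel)
qed

lemma braid_comp_base_left:
  assumes "geometric_braid n p"
  shows "homotopic_paths (conf n) (braid_comp n (\<lambda>t. base_conf n) p) p"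
proof -
  have "p t i = 0" if "t \<in> {0..1}" "n \<le> i" for t i
    using assms that by (auto simp: geometric_braid_def path_image_def conf_def subset_iff)
  then have r: "relabel n (end_pos (\<lambda>t. base_conf n)) (p t) = p t" if "t \<in> {0..1}" for t
    using that end_pos_base by (auto simp: relabel_def fun_eq_iff)
  have "homotopic_paths (conf n) ((\<lambda>t. base_conf n) +++ p)
      ((\<lambda>t. base_conf n) +++ (relabel n (end_pos (\<lambda>t. base_conf n)) \<circ> p))"
    using assms r geometric_braid_base[of n]
    by (intro homotopic_paths_join homotopic_paths_eq)
      (auto simp: geometric_braid_def pathfinish_def)
  moreover have "homotopic_paths (conf n) ((\<lambda>t. base_conf n) +++ p) p"
    using assms homotopic_paths_const_left[of p "conf n"] by (simp add: geometric_braid_def)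
  ultimately show ?thesis
    unfolding braid_comp_eq_relabel by (meson homotopic_paths_sym homotopic_paths_trans)
qed

text \<open>The inverse is the reversed path. It starts at the permuted base points, and
  \<open>\<theta>\<close> renumbers its strands by the positions at which they now start.\<close>

lemma braid_comp_inverse:
  assumes p: "geometric_braid n p"
  obtains q where "geometric_braid n q" "homotopic_paths (conf n) (braid_comp n q p) (\<lambda>t. base_conf n)"
proof -
  note \<pi> = geometric_braid_finish[OF p]
  define \<theta> where "\<theta> = inv_into {..<n} (end_pos p)"
  have \<theta>: "bij_betw \<theta> {..<n} {..<n}" using bij_betw_inv_into[OF \<pi>(2)] by (simp add: \<theta>_def)
  have \<theta>': "end_pos p (\<theta> i) = i" "\<theta> i < n" if "i < n" for i
    using \<pi>(2) \<theta> that unfolding \<theta>_def by (auto simp: bij_betw_def f_inv_into_f)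
  define q where "q = relabel n \<theta> \<circ> reversepath p"
  have pathq: "path q" unfolding q_def using p
    by (intro path_continuous_image continuous_on_relabel) (simp add: geometric_braid_def)
  have st: "pathstart q = base_conf n"
    using \<pi>(1) \<theta>' by (auto simp: q_def pathstart_compose relabel_def placed_conf_def base_conf_def)
  have "pathstart p = base_conf n" using p by (simp add: geometric_braid_def)
  then have fin: "pathfinish q = placed_conf n \<theta>"
    using relabel_base[OF \<theta>] by (simp add: q_def pathfinish_compose)
  have imq: "path_image q \<subseteq> conf n"
    using p relabel_conf[OF \<theta>] by (auto simp: q_def path_image_compose geometric_braid_def)
  have q: "geometric_braid n q"
    by (rule geometric_braidI[OF pathq imq st fin \<theta>])
  have "relabel n (end_pos q) \<circ> p = reversepath q"
    using end_pos_eq[OF fin] by (auto simp: q_def relabel_def reversepath_def fun_eq_iff)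
  then have "homotopic_paths (conf n) (braid_comp n q p) (\<lambda>t. base_conf n)"
    using homotopic_paths_reversepath_right[OF pathq imq] st by (simp add: braid_comp_eq_relabel)
  then show ?thesis using that q by blast
qed

lemma braid_group_one: "\<one>\<^bsub>braid_group n\<^esub> = isotopy n `` {\<lambda>t. base_conf n}"
  by (simp add: braid_group_def)

lemma group_braid_group: "group (braid_group n)"
proof (rule groupI)
  fix x y assume "x \<in> carrier (braid_group n)" "y \<in> carrier (braid_group n)"
  then show "x \<otimes>\<^bsub>braid_group n\<^esub> y \<in> carrier (braid_group n)"
    by (elim braid_class_obtain) (auto simp: braid_mult_class geometric_braid_comp)
next
  show "\<one>\<^bsub>braid_group n\<^esub> \<in> carrier (braid_group n)"
    by (auto simp: braid_group_one geometric_braid_base)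
next
  fix x y z assume "x \<in> carrier (braid_group n)" "y \<in> carrier (braid_group n)" "z \<in> carrier (braid_group n)"
  then show "x \<otimes>\<^bsub>braid_group n\<^esub> y \<otimes>\<^bsub>braid_group n\<^esub> z = x \<otimes>\<^bsub>braid_group n\<^esub> (y \<otimes>\<^bsub>braid_group n\<^esub> z)"
    by (elim braid_class_obtain)
      (auto simp: braid_mult_class geometric_braid_comp
        intro!: isotopy_class_eqI[symmetric] braid_comp_assoc)
next
  fix x assume "x \<in> carrier (braid_group n)"
  then show "\<one>\<^bsub>braid_group n\<^esub> \<otimes>\<^bsub>braid_group n\<^esub> x = x"
    by (elim braid_class_obtain)
      (auto simp: braid_mult_class geometric_braid_comp geometric_braid_base braid_group_one
        intro!: isotopy_class_eqI braid_comp_base_left)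
next
  fix x assume "x \<in> carrier (braid_group n)"
  then obtain p where p: "geometric_braid n p" "x = isotopy n `` {p}"
    by (elim braid_class_obtain)
  obtain q where q: "geometric_braid n q" "homotopic_paths (conf n) (braid_comp n q p) (\<lambda>t. base_conf n)"
    using braid_comp_inverse[OF p(1)] .
  have "isotopy n `` {q} \<otimes>\<^bsub>braid_group n\<^esub> x = \<one>\<^bsub>braid_group n\<^esub>"
    using p q by (auto simp: braid_mult_class braid_group_one geometric_braid_comp intro!: isotopy_class_eqI)
  then show "\<exists>y\<in>carrier (braid_group n). y \<otimes>\<^bsub>braid_group n\<^esub> x = \<one>\<^bsub>braid_group n\<^esub>"
    using q(1) by blast
qed

text \<open>Homotopies of paths fix the end points, so every representative gives the same value;
  see \<open>braid_perm_eq\<close>.\<close>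

definition braid_perm :: "(real \<Rightarrow> nat \<Rightarrow> complex) set \<Rightarrow> nat \<Rightarrow> nat" where
  "braid_perm \<beta> = end_pos (SOME p. p \<in> \<beta>)"

lemma braid_perm_eq:
  assumes "\<beta> \<in> carrier (braid_group n)" "p \<in> \<beta>"
  shows "braid_perm \<beta> = end_pos p"
proof -
  have "(SOME p. p \<in> \<beta>) \<in> \<beta>" using assms(2) by (metis someI)
  then have "(p, SOME p. p \<in> \<beta>) \<in> isotopy n"
    using braid_class_rep(2)[OF assms] by auto
  then show ?thesis
    using end_pos_homotopic by (auto simp: braid_perm_def isotopy_def)
qed

lemma braid_perm_class: "geometric_braid n p \<Longrightarrow> braid_perm (isotopy n `` {p}) = end_pos p"
  by (rule braid_perm_eq[OF braid_classI class_self])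

lemma braid_perm_bij: "\<beta> \<in> carrier (braid_group n) \<Longrightarrow> bij_betw (braid_perm \<beta>) {..<n} {..<n}"
  by (elim braid_class_obtain) (simp add: braid_perm_class geometric_braid_finish)

lemma braid_perm_less: "\<beta> \<in> carrier (braid_group n) \<Longrightarrow> i < n \<Longrightarrow> braid_perm \<beta> i < n"
  using braid_perm_bij by (auto simp: bij_betw_def)

lemma braid_perm_mult:
  assumes "\<beta> \<in> carrier (braid_group n)" "\<gamma> \<in> carrier (braid_group n)" "i < n"
  shows "braid_perm (\<beta> \<otimes>\<^bsub>braid_group n\<^esub> \<gamma>) i = braid_perm \<gamma> (braid_perm \<beta> i)"
  using assms
  by (elim braid_class_obtain)
    (simp add: braid_mult_class braid_perm_class geometric_braid_comp end_pos_comp)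

lemma braid_perm_one: "i < n \<Longrightarrow> braid_perm \<one>\<^bsub>braid_group n\<^esub> i = i"
  by (simp add: braid_group_one braid_perm_class geometric_braid_base end_pos_base)


section \<open>Splitting a strand\<close>

text \<open>The monotone surjection with \<open>i\<close> and \<open>Suc i\<close> in one fibre;
  splitting strand \<open>i\<close> is cabling along it.\<close>

definition collapse :: "nat \<Rightarrow> nat \<Rightarrow> nat" where
  "collapse i k = (if k \<le> i then k else k - 1)"

lemma collapse_self [simp]: "collapse i i = i" "collapse i (Suc i) = i"
  by (simp_all add: collapse_def)

definition split_perm :: "nat \<Rightarrow> (nat \<Rightarrow> nat) \<Rightarrow> nat \<Rightarrow> nat" where
  "split_perm i \<pi> k =
     (if \<pi> i < \<pi> (collapse i k) \<or> k = Suc i then Suc (\<pi> (collapse i k)) else \<pi> (collapse i k))"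

lemma split_strand_eq_cable:
  assumes "i < n"
  shows "split_strand n i \<epsilon> p =
     cable (Suc n) (collapse i) (\<lambda>k. if k = Suc i then \<epsilon> else 0) (split_perm i (end_pos p)) p"
proof -
  have "double_strand n i \<epsilon> p = spread (Suc n) (collapse i) (\<lambda>k. if k = Suc i then \<epsilon> else 0) \<circ> p"
    using assms by (auto simp: double_strand_def spread_def collapse_def fun_eq_iff)
  moreover have "double_end n i p = placed_conf (Suc n) (split_perm i (end_pos p))"
    by (auto simp: double_end_def placed_conf_def split_perm_def collapse_def Let_def fun_eq_iff)
  ultimately show ?thesis
    by (simp add: split_strand_def cable_def pathstart_compose pathfinish_compose)
qed

lemma collapse_less: "i < n \<Longrightarrow> k < Suc n \<Longrightarrow> collapse i k < n"
  by (auto simp: collapse_def)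

lemma cable_perm_split:
  assumes \<pi>: "bij_betw \<pi> {..<n} {..<n}" and i: "i < n"
  shows "cable_perm (Suc n) (collapse i) \<pi> (split_perm i \<pi>)"
proof -
  let ?s = "collapse i" and ?\<sigma> = "split_perm i \<pi>"
  have inj: "?s k = ?s l" if "\<pi> (?s k) = \<pi> (?s l)" "k < Suc n" "l < Suc n" for k l
    using \<pi> that collapse_less[OF i] by (auto simp: bij_betw_def dest: inj_onD)
  have less: "\<pi> (?s k) < n" if "k < Suc n" for k
    using \<pi> that collapse_less[OF i] by (auto simp: bij_betw_def)
  have s: "k = l \<or> k = i \<and> l = Suc i \<or> l = i \<and> k = Suc i" if "?s k = ?s l" for k l
    using that by (auto simp: collapse_def split: if_splits)
  have ord: "\<pi> (?s k) < \<pi> (?s l) \<or> ?s k = ?s l \<and> k < l"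
    if kl: "k < Suc n" "l < Suc n" "?\<sigma> k < ?\<sigma> l" for k l
  proof (cases "\<pi> (?s k) = \<pi> (?s l)")
    case True
    then have "?s k = ?s l" using inj kl by blast
    then show ?thesis using s[of k l] kl(3) by (auto simp: split_perm_def split: if_splits)
  next
    case False
    then show ?thesis using kl(3) by (auto simp: split_perm_def split: if_splits)
  qed
  have "inj_on ?\<sigma> {..<Suc n}"
  proof (rule inj_onI)
    fix k l assume kl: "k \<in> {..<Suc n}" "l \<in> {..<Suc n}" "?\<sigma> k = ?\<sigma> l"
    have *: "k = l \<or> \<not> \<pi> (?s k) < \<pi> (?s l)" if "?\<sigma> k = ?\<sigma> l" for k l
      using that by (auto simp: split_perm_def collapse_def split: if_splits)
    show "k = l"
    proof (cases "\<pi> (?s k) = \<pi> (?s l)")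
      case True
      then have "?s k = ?s l" using inj kl by blast
      then show ?thesis using s[of k l] kl(3) by (auto simp: split_perm_def split: if_splits)
    next
      case False
      then show ?thesis using *[of k l] *[of l k] kl(3) by auto
    qed
  qed
  moreover have "?\<sigma> ` {..<Suc n} \<subseteq> {..<Suc n}"
    using less by (auto simp: split_perm_def) (meson less_SucI)
  ultimately have "bij_betw ?\<sigma> {..<Suc n} {..<Suc n}"
    by (simp add: bij_betw_def endo_inj_surj)
  then show ?thesis using ord by (auto simp: cable_perm_def)
qed

lemma cable_data_split:
  assumes p: "geometric_braid n p" and i: "i < n" and w: "split_width n i p \<epsilon>"
  shows "cable_data n (Suc n) (collapse i) (\<lambda>k. if k = Suc i then \<epsilon> else 0)
           (split_perm i (end_pos p)) p"
  unfolding cable_data_def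
proof (intro conjI p cable_perm_split i geometric_braid_finish(2) subsetI)
  show "monotone_map (Suc n) n (collapse i)"
    using i by (auto simp: monotone_map_def collapse_def)
  show "offsets (Suc n) (collapse i) (\<lambda>k. if k = Suc i then \<epsilon> else 0)"
    using w by (auto simp: offsets_def collapse_def split_width_def split: if_splits)
  fix z assume "z \<in> path_image p"
  then obtain t where t: "t \<in> {0..1}" "z = p t" by (auto simp: path_image_def)
  have z: "z \<in> conf n" using p t by (auto simp: geometric_braid_def path_image_def)
  have \<epsilon>: "0 < \<epsilon>" "\<And>j. \<lbrakk>j < n; j \<noteq> i\<rbrakk> \<Longrightarrow> \<epsilon> < dist (z i) (z j)"
    using w t by (auto simp: split_width_def)
  have "\<bar>(if k = Suc i then \<epsilon> else 0) - (if l = Suc i then \<epsilon> else 0)\<bar> < dist (z (collapse i k)) (z (collapse i l))"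
    if kl: "k < Suc n" "l < Suc n" "collapse i k \<noteq> collapse i l" for k l
  proof -
    have "z (collapse i k) \<noteq> z (collapse i l)"
      using z kl collapse_less[OF i] by (auto simp: conf_def dest: inj_onD)
    moreover have "\<epsilon> < dist (z j) (z i)" if "j < n" "j \<noteq> i" for j
      using \<epsilon>(2)[OF that] by (simp add: dist_commute)
    ultimately show ?thesis
      using \<epsilon> kl collapse_less[OF i] by auto
  qed
  then show "z \<in> wide_conf n (Suc n) (collapse i) (\<lambda>k. if k = Suc i then \<epsilon> else 0)"
    using z by (auto simp: wide_conf_def)
qed

lemma split_width_exists:
  assumes "geometric_braid n p" "i < n"
  obtains \<epsilon> where "split_width n i p \<epsilon>"
proof -
  obtain e :: real where "0 < e" "\<And>z i j. \<lbrakk>z \<in> path_image p; i < n; j < n; i \<noteq> j\<rbrakk> \<Longrightarrow> e < dist (z i) (z j)"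
    using compact_conf_separated[of "path_image p" n] assms(1) compact_path_image
    unfolding geometric_braid_def by blast
  then have "split_width n i p e"
    using assms(2) by (auto simp: split_width_def path_image_def)
  then show ?thesis using that by blast
qed

text \<open>The union over all representatives and widths consists of a single isotopy class, as all
  these cablings are homotopic; no choice has to be made.\<close>

definition split_braid :: "nat \<Rightarrow> nat \<Rightarrow> (real \<Rightarrow> nat \<Rightarrow> complex) set \<Rightarrow> (real \<Rightarrow> nat \<Rightarrow> complex) set" where
  "split_braid n i \<beta> =
     \<Union>{isotopy (Suc n) `` {split_strand n i \<epsilon> p} | p \<epsilon>. p \<in> \<beta> \<and> split_width n i p \<epsilon>}"

lemma split_braid_eq:
  assumes "\<beta> \<in> carrier (braid_group n)" "p \<in> \<beta>" "i < n" "split_width n i p \<epsilon>"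
  shows "split_braid n i \<beta> = isotopy (Suc n) `` {split_strand n i \<epsilon> p}"
proof -
  have "isotopy (Suc n) `` {split_strand n i \<epsilon>' p'} = isotopy (Suc n) `` {split_strand n i \<epsilon> p}"
    if "p' \<in> \<beta>" "split_width n i p' \<epsilon>'" for p' \<epsilon>'
  proof (rule isotopy_class_eqI)
    have p: "geometric_braid n p" and p': "geometric_braid n p'"
      using braid_class_rep(1) assms that by blast+
    have "(p', p) \<in> isotopy n"
      using braid_class_rep(2)[OF assms(1) that(1)] assms(2) by auto
    then show "homotopic_paths (conf (Suc n)) (split_strand n i \<epsilon>' p') (split_strand n i \<epsilon> p)"
      unfolding split_strand_eq_cable[OF assms(3)]
      using cable_unique[OF cable_data_split[OF p' assms(3) that(2)] cable_data_split[OF p assms(3,4)]]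
      by (simp add: isotopy_def)
    show "geometric_braid (Suc n) (split_strand n i \<epsilon>' p')"
      unfolding split_strand_eq_cable[OF assms(3)]
      by (rule geometric_braid_cable[OF cable_data_split[OF p' assms(3) that(2)]])
  qed
  then show ?thesis
    unfolding split_braid_def using assms(2,4) by blast
qed


lemma split_braid_cable:
  assumes "geometric_braid n p" "i < n" "cable_data n (Suc n) (collapse i) d \<tau> p"
  shows "split_braid n i (isotopy n `` {p}) = isotopy (Suc n) `` {cable (Suc n) (collapse i) d \<tau> p}"
proof -
  obtain \<epsilon> where \<epsilon>: "split_width n i p \<epsilon>" using split_width_exists[OF assms(1,2)] .
  have "split_braid n i (isotopy n `` {p}) = isotopy (Suc n) `` {split_strand n i \<epsilon> p}"
    by (rule split_braid_eq[OF braid_classI[OF assms(1)] class_self[OF assms(1)] assms(2) \<epsilon>])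
  also have "\<dots> = isotopy (Suc n) `` {cable (Suc n) (collapse i) d \<tau> p}"
    unfolding split_strand_eq_cable[OF assms(2)]
    by (intro isotopy_class_eqI geometric_braid_cable[OF cable_data_split]
        cable_unique[OF cable_data_split assms(3)] assms \<epsilon> homotopic_self)
  finally show ?thesis .
qed

lemma split_braid_obtain:
  assumes "\<beta> \<in> carrier (braid_group n)" "i < n"
  obtains p d where "geometric_braid n p" "\<beta> = isotopy n `` {p}"
    "cable_data n (Suc n) (collapse i) d (split_perm i (end_pos p)) p"
    "split_braid n i \<beta> = isotopy (Suc n) `` {cable (Suc n) (collapse i) d (split_perm i (end_pos p)) p}"
proof -
  obtain p where p: "geometric_braid n p" "\<beta> = isotopy n `` {p}"
    using assms(1) by (elim braid_class_obtain)
  obtain \<epsilon> where "split_width n i p \<epsilon>" using split_width_exists[OF p(1) assms(2)] .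
  with that show ?thesis
    using p cable_data_split split_braid_cable assms(2) by blast
qed

lemma split_braid_closed:
  assumes "\<beta> \<in> carrier (braid_group n)" "i < n"
  shows "split_braid n i \<beta> \<in> carrier (braid_group (Suc n))"
  using split_braid_obtain[OF assms] by (metis braid_classI geometric_braid_cable)

lemma braid_perm_split:
  assumes "\<beta> \<in> carrier (braid_group n)" "i < n" "k < Suc n"
  shows "braid_perm (split_braid n i \<beta>) k = split_perm i (braid_perm \<beta>) k"
  using assms(1,2)
proof (rule split_braid_obtain)
  fix p d
  assume "geometric_braid n p" "\<beta> = isotopy n `` {p}"
    "cable_data n (Suc n) (collapse i) d (split_perm i (end_pos p)) p"
    "split_braid n i \<beta> = isotopy (Suc n) `` {cable (Suc n) (collapse i) d (split_perm i (end_pos p)) p}"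
  then show ?thesis
    using geometric_braid_cable end_pos_cable assms(3) by (simp add: braid_perm_class)
qed

lemma split_braid_mult:
  assumes "\<beta> \<in> carrier (braid_group n)" "\<gamma> \<in> carrier (braid_group n)" "i < n"
  shows "split_braid n i (\<beta> \<otimes>\<^bsub>braid_group n\<^esub> \<gamma>) =
    split_braid n i \<beta> \<otimes>\<^bsub>braid_group (Suc n)\<^esub> split_braid n (braid_perm \<beta> i) \<gamma>"
proof -
  let ?j = "braid_perm \<beta> i"
  have j: "?j < n" using braid_perm_less assms by blast
  obtain p d where p: "geometric_braid n p" "\<beta> = isotopy n `` {p}"
    and cp: "cable_data n (Suc n) (collapse i) d (split_perm i (end_pos p)) p"
    and sp: "split_braid n i \<beta> = isotopy (Suc n) `` {cable (Suc n) (collapse i) d (split_perm i (end_pos p)) p}"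
    using split_braid_obtain[OF assms(1,3)] .
  obtain q c where q: "geometric_braid n q" "\<gamma> = isotopy n `` {q}"
    and cq: "cable_data n (Suc n) (collapse ?j) c (split_perm ?j (end_pos q)) q"
    and sq: "split_braid n ?j \<gamma> = isotopy (Suc n) `` {cable (Suc n) (collapse ?j) c (split_perm ?j (end_pos q)) q}"
    using split_braid_obtain[OF assms(2) j] .
  have pq: "geometric_braid n (braid_comp n p q)" by (rule geometric_braid_comp[OF p(1) q(1)])
  obtain \<epsilon> where \<epsilon>: "split_width n i (braid_comp n p q) \<epsilon>" using split_width_exists[OF pq assms(3)] .
  note cpq = cable_data_split[OF pq assms(3) \<epsilon>]
  have \<pi>: "braid_perm \<beta> = end_pos p" using p by (simp add: braid_perm_class)
  \<comment> \<open>The two copies of strand \<open>i\<close> arrive next to each other at the two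
    copies of position \<open>?j\<close>, as \<open>cable_comp\<close> demands.\<close>
  have fg: "collapse ?j (split_perm i (end_pos p) k) = end_pos p (collapse i k)" for k
    by (auto simp: \<pi> split_perm_def collapse_def)
  note cables = geometric_braid_cable[OF cp] geometric_braid_cable[OF cq]
  have "\<beta> \<otimes>\<^bsub>braid_group n\<^esub> \<gamma> = isotopy n `` {braid_comp n p q}"
    by (simp only: p(2) q(2) braid_mult_class[OF p(1) q(1)])
  then have "split_braid n i (\<beta> \<otimes>\<^bsub>braid_group n\<^esub> \<gamma>) = isotopy (Suc n) ``
      {cable (Suc n) (collapse i) (\<lambda>k. if k = Suc i then \<epsilon> else 0) (split_perm i (end_pos (braid_comp n p q)))
        (braid_comp n p q)}"
    by (simp only: split_braid_cable[OF pq assms(3) cpq])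
  also have "\<dots> = isotopy (Suc n) `` {braid_comp (Suc n) (cable (Suc n) (collapse i) d (split_perm i (end_pos p)) p)
      (cable (Suc n) (collapse ?j) c (split_perm ?j (end_pos q)) q)}"
    by (rule isotopy_class_eqI[OF geometric_braid_comp[OF cables] cable_comp[OF cp cq cpq fg], symmetric])
  finally show ?thesis
    by (simp only: sp sq braid_mult_class[OF cables])
qed

lemma split_braid_one: "i < n \<Longrightarrow> split_braid n i \<one>\<^bsub>braid_group n\<^esub> = \<one>\<^bsub>braid_group (Suc n)\<^esub>"
proof -
  assume i: "i < n"
  obtain \<epsilon> where \<epsilon>: "split_width n i (\<lambda>t. base_conf n) \<epsilon>"
    using split_width_exists[OF geometric_braid_base i] .
  note c = cable_data_split[OF geometric_braid_base i \<epsilon>]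
  show ?thesis
    unfolding braid_group_one split_braid_cable[OF geometric_braid_base i c]
    by (intro isotopy_class_eqI geometric_braid_cable[OF c] cable_const[OF c])
qed

text \<open>Both sides are cablings along the same map, since \<open>collapse j \<circ> collapse i =
  collapse i \<circ> collapse (Suc j)\<close>. The case \<open>i = j\<close> is included on purpose:
  splitting either of two parallel strands gives the same bundle of three, which is what
  \<open>twist_conj\<close> rests on.\<close>

lemma split_braid_commute:
  assumes \<beta>: "\<beta> \<in> carrier (braid_group n)" and ij: "i \<le> j" "j < n"
  shows "split_braid (Suc n) (Suc j) (split_braid n i \<beta>) = split_braid (Suc n) i (split_braid n j \<beta>)"
proof -
  have *: "\<exists>b \<tau>. cable_data n (Suc (Suc n)) (collapse i \<circ> collapse j) b \<tau> p \<and>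
      split_braid (Suc n) j (split_braid n i (isotopy n `` {p})) =
      isotopy (Suc (Suc n)) `` {cable (Suc (Suc n)) (collapse i \<circ> collapse j) b \<tau> p}"
    if p: "geometric_braid n p" and ij: "i < n" "j < Suc n" for i j p
  proof -
    obtain \<epsilon> where \<epsilon>: "split_width n i p \<epsilon>" using split_width_exists[OF p ij(1)] .
    note c = cable_data_split[OF p ij(1) \<epsilon>]
    define q where "q = cable (Suc n) (collapse i) (\<lambda>k. if k = Suc i then \<epsilon> else 0) (split_perm i (end_pos p)) p"
    have q: "geometric_braid (Suc n) q" unfolding q_def by (rule geometric_braid_cable[OF c])
    obtain \<delta> where \<delta>: "split_width (Suc n) j q \<delta>" using split_width_exists[OF q ij(2)] .
    note c' = cable_data_split[OF q ij(2) \<delta>]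
    obtain b where b: "cable_data n (Suc (Suc n)) (collapse i \<circ> collapse j) b (split_perm j (end_pos q)) p"
      and h: "homotopic_paths (conf (Suc (Suc n)))
        (cable (Suc (Suc n)) (collapse j) (\<lambda>k. if k = Suc j then \<delta> else 0) (split_perm j (end_pos q)) q)
        (cable (Suc (Suc n)) (collapse i \<circ> collapse j) b (split_perm j (end_pos q)) p)"
      using cable_cable[OF c c'[unfolded q_def]] unfolding q_def .
    have "split_braid (Suc n) j (split_braid n i (isotopy n `` {p})) = split_braid (Suc n) j (isotopy (Suc n) `` {q})"
      using split_braid_cable[OF p ij(1) c] by (simp add: q_def)
    also have "\<dots> = isotopy (Suc (Suc n)) `` {cable (Suc (Suc n)) (collapse i \<circ> collapse j) b (split_perm j (end_pos q)) p}"
      unfolding split_braid_cable[OF q ij(2) c'] by (rule isotopy_class_eqI[OF geometric_braid_cable[OF c'] h])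
    finally show ?thesis using b by blast
  qed
  obtain p where p: "geometric_braid n p" "\<beta> = isotopy n `` {p}"
    using \<beta> by (elim braid_class_obtain)
  obtain b \<tau> where b: "cable_data n (Suc (Suc n)) (collapse i \<circ> collapse (Suc j)) b \<tau> p"
      "split_braid (Suc n) (Suc j) (split_braid n i \<beta>) =
      isotopy (Suc (Suc n)) `` {cable (Suc (Suc n)) (collapse i \<circ> collapse (Suc j)) b \<tau> p}"
    using *[OF p(1), of i "Suc j"] ij p(2) by auto
  obtain b' \<tau>' where b': "cable_data n (Suc (Suc n)) (collapse j \<circ> collapse i) b' \<tau>' p"
      "split_braid (Suc n) i (split_braid n j \<beta>) =
      isotopy (Suc (Suc n)) `` {cable (Suc (Suc n)) (collapse j \<circ> collapse i) b' \<tau>' p}"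
    using *[OF p(1), of j i] ij p(2) by auto
  have "collapse j \<circ> collapse i = collapse i \<circ> collapse (Suc j)"
    using ij(1) by (auto simp: collapse_def fun_eq_iff)
  then have b'': "cable_data n (Suc (Suc n)) (collapse i \<circ> collapse (Suc j)) b' \<tau>' p"
    using b'(1) by simp
  show ?thesis
    unfolding b(2) b'(2) \<open>collapse j \<circ> collapse i = _\<close>
    by (rule isotopy_class_eqI[OF geometric_braid_cable[OF b(1)] cable_unique[OF b(1) b'' homotopic_self[OF p(1)]]])
qed


section \<open>Binary trees, expansions of diagrams and the group law\<close>

section \<open>Binary trees\<close>

text \<open>A tree is determined by the prefix-closed set of the addresses of its interior vertices, where
  \<open>False\<close> is a step to the left; larger trees have larger sets.\<close>

fun nodes :: "btree \<Rightarrow> bool list set" where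
  "nodes Leaf = {}"
| "nodes (Caret l r) = insert [] (Cons False ` nodes l \<union> Cons True ` nodes r)"

fun addr :: "btree \<Rightarrow> nat \<Rightarrow> bool list" where
  "addr Leaf i = []"
| "addr (Caret l r) i = (if i < leaves l then False # addr l i else True # addr r (i - leaves l))"

lemma carets_add_caret [simp]: "carets (add_caret T i) = Suc (carets T)"
  by (induction T i rule: add_caret.induct) auto

lemma add_caret_commute:
  "i < j \<Longrightarrow> j < leaves T \<Longrightarrow> add_caret (add_caret T i) (Suc j) = add_caret (add_caret T j) i"
proof (induction T arbitrary: i j)
  case (Caret l r)
  consider "j < leaves l" | "i < leaves l" "leaves l \<le> j" | "leaves l \<le> i" by linarith
  then show ?case
  proof cases
    case 3
    then have "Suc j - leaves l = Suc (j - leaves l)" using Caret.prems by simp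
    then show ?thesis using Caret 3 by auto
  qed (use Caret in auto)
qed auto

lemma addr_add_caret:
  "i < leaves T \<Longrightarrow> k \<le> leaves T \<Longrightarrow> addr (add_caret T i) k =
     (if k < i then addr T k else if k = i then addr T i @ [False]
      else if k = Suc i then addr T i @ [True] else addr T (k - 1))"
proof (induction T arbitrary: i k)
  case (Caret l r)
  show ?case
  proof (cases "i < leaves l")
    case True
    note IH = Caret.IH(1)[OF True]
    consider "k < i" | "k = i" | "k = Suc i" | "Suc i < k" "k \<le> leaves l" | "Suc i < k" "leaves l < k"
      by linarith
    then show ?thesis
    proof cases
      case 5
      then obtain m where "k = Suc (leaves l + m)" using less_iff_Suc_add by auto
      then show ?thesis using True by simp
    qed (use True IH in simp_all)
  next
    case False
    then obtain i' where i': "i = leaves l + i'" using le_Suc_ex by (metis not_less)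
    then have IH: "addr (add_caret r i') m = (if m < i' then addr r m else if m = i' then addr r i' @ [False]
      else if m = Suc i' then addr r i' @ [True] else addr r (m - 1))" if "m \<le> leaves r" for m
      using Caret.IH(2)[of i' m] Caret.prems that by simp
    show ?thesis
    proof (cases "k < leaves l")
      case True
      then show ?thesis using i' by simp
    next
      case False
      then obtain m where m: "k = leaves l + m" using le_Suc_ex by (metis not_less)
      then have "m \<le> leaves r" using Caret.prems by simp
      then show ?thesis using m by (cases m) (simp_all add: i' IH)
    qed
  qed
qed auto

lemma nodes_add_caret: "i < leaves T \<Longrightarrow> nodes (add_caret T i) = insert (addr T i) (nodes T)"
  by (induction T arbitrary: i) auto

lemma nodes_subset_Caret:
  "nodes (Caret l r) \<subseteq> nodes (Caret l' r') \<longleftrightarrow> nodes l \<subseteq> nodes l' \<and> nodes r \<subseteq> nodes r'"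
  by auto

lemma addr_not_in_nodes: "addr T i \<notin> nodes T"
  by (induction T arbitrary: i) auto

lemma inj_on_addr: "inj_on (addr T) {..<leaves T}"
proof (induction T)
  case (Caret l r)
  show ?case
  proof (rule inj_onI)
    fix i j assume *: "i \<in> {..<leaves (Caret l r)}" "j \<in> {..<leaves (Caret l r)}" "addr (Caret l r) i = addr (Caret l r) j"
    then consider "i < leaves l" "j < leaves l" | "leaves l \<le> i" "leaves l \<le> j"
      by (auto split: if_splits)
    then show "i = j"
    proof cases
      case 1
      then show ?thesis using * Caret.IH(1) by (auto dest: inj_onD)
    next
      case 2
      then have "addr r (i - leaves l) = addr r (j - leaves l)" using * by auto
      moreover have "i - leaves l \<in> {..<leaves r}" "j - leaves l \<in> {..<leaves r}" using * 2 by auto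
      ultimately have "i - leaves l = j - leaves l" using Caret.IH(2) by (auto dest: inj_onD)
      then show ?thesis using 2 by simp
    qed
  qed
qed (simp add: inj_on_def)

lemma addr_eq_iff: "i < leaves T \<Longrightarrow> j < leaves T \<Longrightarrow> addr T i = addr T j \<longleftrightarrow> i = j"
  using inj_on_addr[of T] by (auto dest: inj_onD)

lemma leaf_addr_in_larger:
  "nodes S \<subseteq> nodes U \<Longrightarrow> S \<noteq> U \<Longrightarrow> \<exists>i<leaves S. addr S i \<in> nodes U"
proof (induction S arbitrary: U)
  case Leaf
  then show ?case by (cases U) auto
next
  case (Caret l r)
  then obtain l' r' where U: "U = Caret l' r'" by (cases U) auto
  have sub: "nodes l \<subseteq> nodes l'" "nodes r \<subseteq> nodes r'"
    using Caret.prems(1) unfolding U nodes_subset_Caret by auto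
  show ?case
  proof (cases "l = l'")
    case False
    then obtain i where "i < leaves l" "addr l i \<in> nodes l'" using Caret.IH(1) sub by blast
    then show ?thesis unfolding U by (intro exI[of _ i]) auto
  next
    case True
    then have "r \<noteq> r'" using Caret.prems(2) U by simp
    then obtain i where "i < leaves r" "addr r i \<in> nodes r'" using Caret.IH(2) sub by blast
    then show ?thesis unfolding U by (intro exI[of _ "leaves l + i"]) auto
  qed
qed

text \<open>Common refinements exist: a union of prefix-closed sets is prefix-closed, and the tree
  is built recursively on both halves.\<close>

lemma nodes_join: "\<exists>U. nodes U = nodes S \<union> nodes T"
proof (induction S arbitrary: T)
  case Leaf
  then show ?case by auto
next
  case (Caret l r)
  show ?case
  proof (cases T)
    case Leaf
    then show ?thesis by (intro exI[of _ "Caret l r"]) simp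
  next
    case (Caret l' r')
    obtain L R where "nodes L = nodes l \<union> nodes l'" "nodes R = nodes r \<union> nodes r'"
      using Caret.IH by metis
    then have "nodes (Caret L R) = nodes (Caret l r) \<union> nodes T" unfolding Caret by auto
    then show ?thesis by blast
  qed
qed

lemma finite_nodes [simp]: "finite (nodes T)"
  by (induction T) auto

lemma card_nodes: "card (nodes T) = carets T"
proof (induction T)
  case (Caret l r)
  have "card (Cons False ` nodes l \<union> Cons True ` nodes r) = carets l + carets r"
    using Caret by (subst card_Un_disjoint) (auto simp: card_image)
  then show ?case by (subst nodes.simps, subst card_insert_disjoint) auto
qed simp

lemma nodes_subset_carets: "nodes S \<subseteq> nodes T \<Longrightarrow> carets S \<le> carets T"
  by (metis card_mono card_nodes finite_nodes)

text \<open>Induction downwards from \<open>U\<close>: every smaller tree has a leaf that is an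
  interior vertex of \<open>U\<close>, and a caret added there brings it closer to
  \<open>U\<close>.\<close>

lemma tree_growth_induct [consumes 1, case_names refl step]:
  assumes "nodes S \<subseteq> nodes U" "P U"
    and step: "\<And>S i. \<lbrakk>nodes S \<subseteq> nodes U; i < leaves S; addr S i \<in> nodes U; P (add_caret S i)\<rbrakk> \<Longrightarrow> P S"
  shows "P S"
  using assms(1)
proof (induction "carets U - carets S" arbitrary: S rule: less_induct)
  case less
  show ?case
  proof (cases "S = U")
    case False
    then obtain i where i: "i < leaves S" "addr S i \<in> nodes U"
      using leaf_addr_in_larger less.prems by blast
    then have sub: "nodes (add_caret S i) \<subseteq> nodes U" using less.prems nodes_add_caret by auto
    then have "carets U - carets (add_caret S i) < carets U - carets S"
      using nodes_subset_carets[OF sub] by simp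
    then show ?thesis using step[OF less.prems i] less.hyps sub by blast
  qed (use assms(2) in simp)
qed


declare split_paired_All [simp del] split_paired_Ex [simp del]

section \<open>Expansions of tree-braid-tree diagrams\<close>

text \<open>The relation \<open>splitting\<close> turned into a function of the leaf; the choice of
  representative and width has been absorbed by \<open>split_braid\<close>.\<close>

definition split_diagram :: "nat \<Rightarrow> diagram \<Rightarrow> diagram" where
  "split_diagram i = (\<lambda>(S, \<beta>, T). (add_caret S i, split_braid (leaves S) i \<beta>, add_caret T (braid_perm \<beta> i)))"

definition head_tree :: "diagram \<Rightarrow> btree" where "head_tree d = fst d"
definition tail_tree :: "diagram \<Rightarrow> btree" where "tail_tree d = snd (snd d)"

lemma head_tail_simps [simp]: "head_tree (S, \<beta>, T) = S" "tail_tree (S, \<beta>, T) = T"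
  by (simp_all add: head_tree_def tail_tree_def)

lemma head_split_diagram [simp]: "head_tree (split_diagram i d) = add_caret (head_tree d) i"
  by (cases d) (simp add: split_diagram_def)

lemma diagramsD:
  "(S, \<beta>, T) \<in> diagrams \<Longrightarrow> carets T = carets S \<and> \<beta> \<in> carrier (braid_group (leaves S))"
  by (auto simp: diagrams_def)

lemma split_diagram_closed:
  assumes "d \<in> diagrams" "i < leaves (head_tree d)"
  shows "split_diagram i d \<in> diagrams"
proof -
  obtain S \<beta> T where d: "d = (S, \<beta>, T)" by (cases d)
  then have "carets S = carets T" "split_braid (leaves S) i \<beta> \<in> carrier (braid_group (Suc (leaves S)))"
    using assms split_braid_closed by (auto simp: diagrams_def)
  then show ?thesis by (simp add: d split_diagram_def diagrams_def)
qed

lemma splitting_iff: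
  "(d, e) \<in> splitting \<longleftrightarrow> d \<in> diagrams \<and> (\<exists>i<leaves (head_tree d). e = split_diagram i d)"
proof
  assume "(d, e) \<in> splitting"
  then obtain S \<beta> T n p i \<epsilon> where *: "d = (S, \<beta>, T)"
    "e = (add_caret S i, isotopy (Suc n) `` {split_strand n i \<epsilon> p}, add_caret T (end_pos p i))"
    "(S, \<beta>, T) \<in> diagrams" "n = leaves S" "p \<in> \<beta>" "i < n" "split_width n i p \<epsilon>"
    by (cases d; cases e) (simp, elim splitting.cases, simp)
  then have "\<beta> \<in> carrier (braid_group n)" using diagramsD by blast
  then have "split_braid n i \<beta> = isotopy (Suc n) `` {split_strand n i \<epsilon> p}" "braid_perm \<beta> = end_pos p"
    using split_braid_eq braid_perm_eq * by blast+
  then show "d \<in> diagrams \<and> (\<exists>i<leaves (head_tree d). e = split_diagram i d)"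
    using * by (auto simp: split_diagram_def intro!: exI[of _ i])
next
  assume "d \<in> diagrams \<and> (\<exists>i<leaves (head_tree d). e = split_diagram i d)"
  then obtain S \<beta> T i where d: "d = (S, \<beta>, T)" "(S, \<beta>, T) \<in> diagrams" "i < leaves S" "e = split_diagram i d"
    by (cases d) auto
  then have \<beta>: "\<beta> \<in> carrier (braid_group (leaves S))" using diagramsD by blast
  obtain p where p: "p \<in> \<beta>" "geometric_braid (leaves S) p" using \<beta> by (elim braid_class_obtain)
  obtain \<epsilon> where \<epsilon>: "split_width (leaves S) i p \<epsilon>" using split_width_exists[OF p(2) d(3)] .
  show "(d, e) \<in> splitting"
    using splitting.intros[OF d(2) refl p(1) d(3) \<epsilon>] split_braid_eq[OF \<beta> p(1) d(3) \<epsilon>] braid_perm_eq[OF \<beta> p(1)] d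
    by (simp add: split_diagram_def)
qed

lemma split_diagram_commute:
  assumes d: "d \<in> diagrams" and ij: "i < j" "j < leaves (head_tree d)"
  shows "split_diagram (Suc j) (split_diagram i d) = split_diagram i (split_diagram j d)"
proof -
  obtain S \<beta> T where [simp]: "d = (S, \<beta>, T)" by (cases d)
  have \<beta>: "carets T = carets S" "\<beta> \<in> carrier (braid_group (leaves S))" using d diagramsD by auto
  let ?\<pi> = "braid_perm \<beta>"
  have i: "i < leaves S" "j < leaves S" using ij by auto
  have "inj_on ?\<pi> {..<leaves S}" using braid_perm_bij[OF \<beta>(2)] by (simp add: bij_betw_def)
  then have "?\<pi> i \<noteq> ?\<pi> j" using inj_onD[of ?\<pi> "{..<leaves S}" i j] i ij(1) by auto
  moreover have "?\<pi> i < leaves T" "?\<pi> j < leaves T"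
    using braid_perm_less[OF \<beta>(2)] i \<beta>(1) by simp_all
  ultimately have \<pi>: "?\<pi> i \<noteq> ?\<pi> j" "?\<pi> i < leaves T" "?\<pi> j < leaves T" by blast+
  have c: "collapse i (Suc j) = j" "collapse j i = i" using ij by (auto simp: collapse_def)
  have p1: "braid_perm (split_braid (leaves S) i \<beta>) (Suc j) = (if ?\<pi> i < ?\<pi> j then Suc (?\<pi> j) else ?\<pi> j)"
    using braid_perm_split[OF \<beta>(2) i(1), of "Suc j"] i(2) ij c by (simp add: split_perm_def)
  have p2: "braid_perm (split_braid (leaves S) j \<beta>) i = (if ?\<pi> j < ?\<pi> i then Suc (?\<pi> i) else ?\<pi> i)"
    using braid_perm_split[OF \<beta>(2) i(2), of i] i(1) ij c by (simp add: split_perm_def)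
  \<comment> \<open>Strands \<open>i\<close> and \<open>j\<close> may arrive in either order, so on
    the tail tree either caret can be the one whose number is shifted by the other.\<close>
  have "add_caret (add_caret T (?\<pi> i)) (if ?\<pi> i < ?\<pi> j then Suc (?\<pi> j) else ?\<pi> j) =
      add_caret (add_caret T (?\<pi> j)) (if ?\<pi> j < ?\<pi> i then Suc (?\<pi> i) else ?\<pi> i)"
    using \<pi> add_caret_commute[of "?\<pi> i" "?\<pi> j" T] add_caret_commute[of "?\<pi> j" "?\<pi> i" T]
    by (cases "?\<pi> i < ?\<pi> j") simp_all
  then show ?thesis
    using add_caret_commute[of i j S] split_braid_commute[OF \<beta>(2), of i j] ij i
    by (simp add: split_diagram_def p1 p2)
qed

lemma splitting_star_closed: "(d, e) \<in> splitting\<^sup>* \<Longrightarrow> d \<in> diagrams \<Longrightarrow> e \<in> diagrams"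
  by (induction rule: rtrancl_induct) (auto simp: splitting_iff split_diagram_closed)

lemma splitting_star_nodes: "(d, e) \<in> splitting\<^sup>* \<Longrightarrow> nodes (head_tree d) \<subseteq> nodes (head_tree e)"
  by (induction rule: rtrancl_induct) (auto simp: splitting_iff nodes_add_caret)

lemma expansion_exists:
  assumes "d \<in> diagrams" "nodes (head_tree d) \<subseteq> nodes U"
  shows "\<exists>e. (d, e) \<in> splitting\<^sup>* \<and> head_tree e = U"
proof -
  have "\<forall>d. d \<in> diagrams \<longrightarrow> head_tree d = S \<longrightarrow> (\<exists>e. (d, e) \<in> splitting\<^sup>* \<and> head_tree e = U)"
    if "nodes S \<subseteq> nodes U" for S
    using that
  proof (induction rule: tree_growth_induct)
    case (step S i)
    show ?case
    proof (intro allI impI)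
      fix d assume d: "d \<in> diagrams" "head_tree d = S"
      then have "split_diagram i d \<in> diagrams" "head_tree (split_diagram i d) = add_caret S i"
        using split_diagram_closed step by auto
      then obtain e where "(split_diagram i d, e) \<in> splitting\<^sup>*" "head_tree e = U" using step.IH by blast
      moreover have "(d, split_diagram i d) \<in> splitting" using d step splitting_iff by auto
      ultimately show "\<exists>e. (d, e) \<in> splitting\<^sup>* \<and> head_tree e = U"
        by (blast intro: converse_rtrancl_into_rtrancl)
    qed
  qed blast
  then show ?thesis using assms by blast
qed

lemma carets_splitting_star:
  "(d, e) \<in> splitting\<^sup>* \<Longrightarrow> carets (head_tree d) \<le> carets (head_tree e)"
  using splitting_star_nodes nodes_subset_carets by blast

text \<open>Induction on the number of carets still to be added; two first steps at different leaves
  commute.\<close>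

lemma expansion_unique:
  "\<lbrakk>d \<in> diagrams; (d, e) \<in> splitting\<^sup>*; (d, e') \<in> splitting\<^sup>*; head_tree e = head_tree e'\<rbrakk> \<Longrightarrow> e = e'"
proof (induction "carets (head_tree e) - carets (head_tree d)" arbitrary: d e e' rule: less_induct)
  case less
  have strict: "carets (head_tree d) < carets (head_tree f)" if f: "(d, f) \<in> splitting\<^sup>*" "d \<noteq> f" for f
  proof -
    obtain c where "(d, c) \<in> splitting" "(c, f) \<in> splitting\<^sup>*" using f by (metis converse_rtranclE)
    then show ?thesis using carets_splitting_star[of c f] by (auto simp: splitting_iff)
  qed
  have ne: "d = e \<longleftrightarrow> d = e'"
    using strict[OF less.prems(2)] strict[OF less.prems(3)] less.prems(4) by force
  show ?case
  proof (cases "d = e")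
    case True
    then show ?thesis using ne by simp
  next
    case False
    obtain i where i: "i < leaves (head_tree d)" "(split_diagram i d, e) \<in> splitting\<^sup>*"
      using less.prems(2) False by (metis converse_rtranclE splitting_iff)
    obtain j where j: "j < leaves (head_tree d)" "(split_diagram j d, e') \<in> splitting\<^sup>*"
      using less.prems(3) False ne by (metis converse_rtranclE splitting_iff)
    have IH: "f = f'" if "k < leaves (head_tree d)" "(split_diagram k d, f) \<in> splitting\<^sup>*"
      "(split_diagram k d, f') \<in> splitting\<^sup>*" "head_tree f = head_tree e" "head_tree f' = head_tree e" for k f f'
      using less.hyps[of f "split_diagram k d" f'] that split_diagram_closed[OF less.prems(1)]
        carets_splitting_star[OF that(2)] by simp
    have main: "f = f'" if k: "k < l" "l < leaves (head_tree d)" "(split_diagram k d, f) \<in> splitting\<^sup>*"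
      "(split_diagram l d, f') \<in> splitting\<^sup>*" "head_tree f = head_tree e" "head_tree f' = head_tree e" for k l f f'
    proof -
      let ?c = "split_diagram (Suc l) (split_diagram k d)"
      have kd: "k < leaves (head_tree d)" using k by simp
      have in1: "split_diagram k d \<in> diagrams" "split_diagram l d \<in> diagrams"
        using split_diagram_closed[OF less.prems(1)] k kd by auto
      have c: "(split_diagram k d, ?c) \<in> splitting" "(split_diagram l d, ?c) \<in> splitting"
        unfolding splitting_iff using in1 k(1,2) kd split_diagram_commute[OF less.prems(1) k(1,2)]
        by (metis Suc_less_eq carets_add_caret head_split_diagram less_SucI)+
      \<comment> \<open>The diagram \<open>?c\<close> adds only the carets at leaves
        \<open>k\<close> and \<open>l\<close>, both of which the target tree has. Hence
        \<open>?c\<close> expands to the target, and the result \<open>g\<close> is compared with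
        \<open>f\<close> and \<open>f'\<close> by the induction hypothesis.\<close>
      have "nodes (head_tree (split_diagram k d)) \<union> nodes (head_tree (split_diagram l d)) \<subseteq> nodes (head_tree e)"
        using splitting_star_nodes[OF k(3)] splitting_star_nodes[OF k(4)] k(5,6) by auto
      moreover have "addr (add_caret (head_tree d) k) (Suc l) = addr (head_tree d) l"
        using addr_add_caret[OF kd] k by auto
      ultimately have "nodes (head_tree ?c) \<subseteq> nodes (head_tree e)"
        using k kd by (simp add: nodes_add_caret)
      then obtain g where g: "(?c, g) \<in> splitting\<^sup>*" "head_tree g = head_tree e"
        using expansion_exists[of ?c] c splitting_star_closed in1 by blast
      have "f = g" using IH[OF kd k(3) _ k(5) g(2)] c g by (meson converse_rtrancl_into_rtrancl)
      moreover have "f' = g" using IH[OF k(2) k(4) _ k(6) g(2)] c g by (meson converse_rtrancl_into_rtrancl)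
      ultimately show ?thesis by simp
    qed
    consider "i = j" | "i < j" | "j < i" by linarith
    then show ?thesis
    proof cases
      case 1
      then show ?thesis using IH[OF i _ refl] j less.prems(4) by simp
    next
      case 2
      then show ?thesis using main[OF 2 j(1) i(2) j(2) refl] less.prems(4) by simp
    next
      case 3
      then show ?thesis using main[OF 3 i(1) j(2) i(2) _ refl] less.prems(4) by simp
    qed
  qed
qed

text \<open>Confluence of splitting: expand both diagrams to the union of their head trees; the
  results agree by \<open>expansion_unique\<close>.\<close>

lemma expansion_same_head:
  assumes "d \<in> diagrams" "(d, e) \<in> splitting\<^sup>*" "(d, f) \<in> splitting\<^sup>*"
  obtains g where "(e, g) \<in> splitting\<^sup>*" "(f, g) \<in> splitting\<^sup>*"
proof -
  obtain U where U: "nodes U = nodes (head_tree e) \<union> nodes (head_tree f)" using nodes_join by blast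
  have "e \<in> diagrams" "f \<in> diagrams" using splitting_star_closed assms by blast+
  then obtain g h where "(e, g) \<in> splitting\<^sup>*" "head_tree g = U" "(f, h) \<in> splitting\<^sup>*" "head_tree h = U"
    using expansion_exists U by (metis Un_upper1 Un_upper2)
  moreover from this have "g = h"
    using expansion_unique[of d g h] assms by (metis rtrancl_trans)
  ultimately show ?thesis using that by blast
qed

text \<open>The Church-Rosser property: by confluence a zigzag of splittings and reductions can be
  replaced by two expansions that meet.\<close>

lemma diagram_equiv_iff:
  "(d, d') \<in> diagram_equiv \<longleftrightarrow>
     d \<in> diagrams \<and> d' \<in> diagrams \<and> (\<exists>e. (d, e) \<in> splitting\<^sup>* \<and> (d', e) \<in> splitting\<^sup>*)"
proof
  assume "(d, d') \<in> diagram_equiv"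
  then have d: "d \<in> diagrams" "d' \<in> diagrams" and r: "(d, d') \<in> (splitting \<union> splitting\<inverse>)\<^sup>*"
    by (auto simp: diagram_equiv_def)
  from r have "\<exists>e. (d, e) \<in> splitting\<^sup>* \<and> (d', e) \<in> splitting\<^sup>*"
  proof (induction rule: rtrancl_induct)
    case (step x y)
    then obtain e where e: "(d, e) \<in> splitting\<^sup>*" "(x, e) \<in> splitting\<^sup>*" by blast
    show ?case
    proof (cases "(x, y) \<in> splitting")
      case True
      then have "x \<in> diagrams" by (simp add: splitting_iff)
      then obtain g where "(e, g) \<in> splitting\<^sup>*" "(y, g) \<in> splitting\<^sup>*"
        using expansion_same_head[of x e y] e True by blast
      then show ?thesis using e by (meson rtrancl_trans)
    next
      case False
      then have "(y, x) \<in> splitting" using step by auto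
      then show ?thesis using e by (meson converse_rtrancl_into_rtrancl)
    qed
  qed auto
  then show "d \<in> diagrams \<and> d' \<in> diagrams \<and> (\<exists>e. (d, e) \<in> splitting\<^sup>* \<and> (d', e) \<in> splitting\<^sup>*)"
    using d by blast
next
  assume *: "d \<in> diagrams \<and> d' \<in> diagrams \<and> (\<exists>e. (d, e) \<in> splitting\<^sup>* \<and> (d', e) \<in> splitting\<^sup>*)"
  then obtain e where e: "(d, e) \<in> splitting\<^sup>*" "(d', e) \<in> splitting\<^sup>*" by blast
  have sub: "splitting\<^sup>* \<subseteq> (splitting \<union> splitting\<inverse>)\<^sup>*" by (rule rtrancl_mono[OF Un_upper1])
  have "(e, d') \<in> (splitting \<union> splitting\<inverse>)\<^sup>*"
    by (rule symD[OF sym_rtrancl[OF sym_Un_converse] subsetD[OF sub e(2)]])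
  moreover have "(d, e) \<in> (splitting \<union> splitting\<inverse>)\<^sup>*" by (rule subsetD[OF sub e(1)])
  ultimately have "(d, d') \<in> (splitting \<union> splitting\<inverse>)\<^sup>*" by (rule rtrancl_trans[rotated])
  then show "(d, d') \<in> diagram_equiv" using * by (simp add: diagram_equiv_def)
qed

lemma equiv_diagram_equiv: "equiv diagrams diagram_equiv"
proof (rule equivI)
  show "trans diagram_equiv"
    by (auto simp: trans_def diagram_equiv_def)
  show "sym diagram_equiv" by (auto simp: sym_def diagram_equiv_iff)
qed (auto simp: refl_on_def diagram_equiv_def)

lemma expansion_equiv: "d \<in> diagrams \<Longrightarrow> (d, e) \<in> splitting\<^sup>* \<Longrightarrow> (d, e) \<in> diagram_equiv"
  using splitting_star_closed by (auto simp: diagram_equiv_iff)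


section \<open>The group BV\<close>

definition invert_diagram :: "diagram \<Rightarrow> diagram" where
  "invert_diagram = (\<lambda>(S, \<beta>, T). (T, inv\<^bsub>braid_group (leaves S)\<^esub> \<beta>, S))"

lemma diagrams_iff:
  "(S, \<beta>, T) \<in> diagrams \<longleftrightarrow> carets T = carets S \<and> \<beta> \<in> carrier (braid_group (leaves S))"
  by (auto simp: diagrams_def)

lemma invert_diagram_closed: "d \<in> diagrams \<Longrightarrow> invert_diagram d \<in> diagrams"
  by (cases d) (simp add: invert_diagram_def diagrams_iff group.inv_closed[OF group_braid_group])

lemma invert_invert: "d \<in> diagrams \<Longrightarrow> invert_diagram (invert_diagram d) = d"
  by (cases d) (simp add: invert_diagram_def diagrams_iff group.inv_inv[OF group_braid_group])

lemma head_invert [simp]: "head_tree (invert_diagram d) = tail_tree d"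
  and tail_invert [simp]: "tail_tree (invert_diagram d) = head_tree d"
  by (cases d; simp add: invert_diagram_def)+

lemma braid_perm_inv:
  assumes "\<beta> \<in> carrier (braid_group n)" "i < n"
  shows "braid_perm (inv\<^bsub>braid_group n\<^esub> \<beta>) (braid_perm \<beta> i) = i"
proof -
  have "inv\<^bsub>braid_group n\<^esub> \<beta> \<in> carrier (braid_group n)"
    using assms group.inv_closed[OF group_braid_group] by blast
  then show ?thesis
    using braid_perm_mult[OF assms(1) _ assms(2)] assms
    by (metis group.r_inv[OF group_braid_group] braid_perm_one)
qed

lemma split_braid_inv:
  assumes "\<beta> \<in> carrier (braid_group n)" "i < n"
  shows "split_braid n (braid_perm \<beta> i) (inv\<^bsub>braid_group n\<^esub> \<beta>) =
    inv\<^bsub>braid_group (Suc n)\<^esub> (split_braid n i \<beta>)"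
proof -
  interpret B: group "braid_group n" by (rule group_braid_group)
  interpret B': group "braid_group (Suc n)" by (rule group_braid_group)
  have "inv\<^bsub>braid_group n\<^esub> \<beta> \<in> carrier (braid_group n)" using assms by simp
  from split_braid_mult[OF assms(1) this assms(2)]
  have "split_braid n i \<beta> \<otimes>\<^bsub>braid_group (Suc n)\<^esub> split_braid n (braid_perm \<beta> i) (inv\<^bsub>braid_group n\<^esub> \<beta>) =
      \<one>\<^bsub>braid_group (Suc n)\<^esub>"
    using assms by (simp add: split_braid_one)
  moreover have "split_braid n i \<beta> \<in> carrier (braid_group (Suc n))"
    "split_braid n (braid_perm \<beta> i) (inv\<^bsub>braid_group n\<^esub> \<beta>) \<in> carrier (braid_group (Suc n))"
    using assms by (simp_all add: split_braid_closed braid_perm_less)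
  ultimately show ?thesis
    using B'.inv_equality B'.inv_comm by metis
qed

lemma split_invert_diagram:
  assumes "(S, \<beta>, T) \<in> diagrams" "i < leaves S"
  shows "split_diagram (braid_perm \<beta> i) (invert_diagram (S, \<beta>, T)) = invert_diagram (split_diagram i (S, \<beta>, T))"
  using assms split_braid_inv[of \<beta> "leaves S" i] braid_perm_inv[of \<beta> "leaves S" i]
  by (simp add: split_diagram_def invert_diagram_def diagrams_iff)

lemma splitting_invert:
  assumes "(d, e) \<in> splitting"
  shows "(invert_diagram d, invert_diagram e) \<in> splitting"
proof -
  obtain S \<beta> T where d: "d = (S, \<beta>, T)" by (cases d)
  obtain i where i: "d \<in> diagrams" "i < leaves S" "e = split_diagram i d"
    using assms d by (auto simp: splitting_iff)
  then have "braid_perm \<beta> i < leaves T"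
    using d diagramsD[of S \<beta> T] braid_perm_less[of \<beta> "leaves S" i] by simp
  then show ?thesis
    using split_invert_diagram[of S \<beta> T i] i d invert_diagram_closed[OF i(1)]
    unfolding splitting_iff by auto
qed

lemma splitting_star_invert:
  "(d, e) \<in> splitting\<^sup>* \<Longrightarrow> (invert_diagram d, invert_diagram e) \<in> splitting\<^sup>*"
  by (induction rule: rtrancl_induct) (auto intro: rtrancl_into_rtrancl dest: splitting_invert)

text \<open>Splitting commutes with inversion of diagrams, which exchanges the two trees; so this is
  \<open>expansion_exists\<close> for the inverse.\<close>

lemma expansion_tail_exists:
  assumes "d \<in> diagrams" "nodes (tail_tree d) \<subseteq> nodes U"
  shows "\<exists>e. (d, e) \<in> splitting\<^sup>* \<and> tail_tree e = U"
proof -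
  have "nodes (head_tree (invert_diagram d)) \<subseteq> nodes U" using assms by simp
  from expansion_exists[OF invert_diagram_closed[OF assms(1)] this]
  obtain e where e: "(invert_diagram d, e) \<in> splitting\<^sup>*" "head_tree e = U" by blast
  have "(d, invert_diagram e) \<in> splitting\<^sup>*"
    using splitting_star_invert[OF e(1)] invert_invert[OF assms(1)] by simp
  then show ?thesis using e(2) by (metis tail_invert)
qed

lemma diagram_mult_closed:
  "(R, \<beta>, S) \<in> diagrams \<Longrightarrow> (S, \<gamma>, T) \<in> diagrams \<Longrightarrow> (R, \<beta> \<otimes>\<^bsub>braid_group (leaves S)\<^esub> \<gamma>, T) \<in> diagrams"
  using monoid.m_closed[OF group.is_monoid[OF group_braid_group]] by (simp add: diagrams_iff)

lemma split_diagram_mult: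
  assumes "(R, \<beta>, S) \<in> diagrams" "(S, \<gamma>, T) \<in> diagrams" "i < leaves R"
  shows "split_diagram i (R, \<beta> \<otimes>\<^bsub>braid_group (leaves S)\<^esub> \<gamma>, T) =
    (add_caret R i, split_braid (leaves S) i \<beta> \<otimes>\<^bsub>braid_group (Suc (leaves S))\<^esub> split_braid (leaves S) (braid_perm \<beta> i) \<gamma>,
     add_caret T (braid_perm \<gamma> (braid_perm \<beta> i)))"
  using assms split_braid_mult[of \<beta> "leaves S" \<gamma> i] braid_perm_mult[of \<beta> "leaves S" \<gamma> i]
  by (simp add: split_diagram_def diagrams_iff)

text \<open>Each splitting of the left factor at strand \<open>i\<close> is matched in the right
  factor by a splitting at the leaf of the common tree where strand \<open>i\<close> arrives; by
  \<open>split_braid_mult\<close> the product is then split at \<open>i\<close>.\<close>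

lemma expansion_mult_left:
  assumes "((R, \<beta>, S), e) \<in> splitting\<^sup>*" "(R, \<beta>, S) \<in> diagrams" "(S, \<gamma>, T) \<in> diagrams"
  shows "\<exists>R' \<beta>' S' \<gamma>' T'. e = (R', \<beta>', S') \<and> ((S, \<gamma>, T), (S', \<gamma>', T')) \<in> splitting\<^sup>* \<and>
    ((R, \<beta> \<otimes>\<^bsub>braid_group (leaves S)\<^esub> \<gamma>, T), (R', \<beta>' \<otimes>\<^bsub>braid_group (leaves S')\<^esub> \<gamma>', T')) \<in> splitting\<^sup>*"
  using assms(1)
proof (induction rule: rtrancl_induct)
  case base
  then show ?case by blast
next
  case (step e f)
  then obtain R' \<beta>' S' \<gamma>' T' where e: "e = (R', \<beta>', S')"
    and c: "((S, \<gamma>, T), (S', \<gamma>', T')) \<in> splitting\<^sup>*"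
    and m: "((R, \<beta> \<otimes>\<^bsub>braid_group (leaves S)\<^esub> \<gamma>, T), (R', \<beta>' \<otimes>\<^bsub>braid_group (leaves S')\<^esub> \<gamma>', T')) \<in> splitting\<^sup>*"
    by blast
  obtain i where i: "i < leaves R'" "f = split_diagram i e"
    using step.hyps(2) e by (auto simp: splitting_iff)
  have in1: "(R', \<beta>', S') \<in> diagrams" using splitting_star_closed[OF step.hyps(1) assms(2)] e by simp
  have in2: "(S', \<gamma>', T') \<in> diagrams" by (rule splitting_star_closed[OF c assms(3)])
  have j: "braid_perm \<beta>' i < leaves S'" using in1 i(1) braid_perm_less by (simp add: diagrams_iff)
  have L: "leaves R' = leaves S'" using in1 by (simp add: diagrams_iff)
  have 1: "f = (add_caret R' i, split_braid (leaves S') i \<beta>', add_caret S' (braid_perm \<beta>' i))"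
    using i(2) e L by (simp add: split_diagram_def)
  have "((S', \<gamma>', T'), split_diagram (braid_perm \<beta>' i) (S', \<gamma>', T')) \<in> splitting"
    using in2 j by (auto simp: splitting_iff)
  then have 2: "((S, \<gamma>, T), (add_caret S' (braid_perm \<beta>' i), split_braid (leaves S') (braid_perm \<beta>' i) \<gamma>',
      add_caret T' (braid_perm \<gamma>' (braid_perm \<beta>' i)))) \<in> splitting\<^sup>*"
    using c by (simp add: split_diagram_def rtrancl_into_rtrancl)
  have "((R', \<beta>' \<otimes>\<^bsub>braid_group (leaves S')\<^esub> \<gamma>', T'), split_diagram i (R', \<beta>' \<otimes>\<^bsub>braid_group (leaves S')\<^esub> \<gamma>', T')) \<in> splitting"
    using diagram_mult_closed[OF in1 in2] i(1) by (auto simp: splitting_iff)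
  then have 3: "((R, \<beta> \<otimes>\<^bsub>braid_group (leaves S)\<^esub> \<gamma>, T), (add_caret R' i,
     split_braid (leaves S') i \<beta>' \<otimes>\<^bsub>braid_group (Suc (leaves S'))\<^esub> split_braid (leaves S') (braid_perm \<beta>' i) \<gamma>',
     add_caret T' (braid_perm \<gamma>' (braid_perm \<beta>' i)))) \<in> splitting\<^sup>*"
    using m split_diagram_mult[OF in1 in2 i(1)] by (metis rtrancl_into_rtrancl)
  show ?case
    using 1 2 3 by (intro exI conjI) (assumption | simp)+
qed

lemma expansion_mult:
  assumes a: "(R, \<beta>, S) \<in> diagrams" "((R, \<beta>, S), (R', \<beta>', S')) \<in> splitting\<^sup>*"
    and c: "(S, \<gamma>, T) \<in> diagrams" "((S, \<gamma>, T), (S', \<gamma>', T')) \<in> splitting\<^sup>*"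
  shows "((R, \<beta> \<otimes>\<^bsub>braid_group (leaves S)\<^esub> \<gamma>, T), (R', \<beta>' \<otimes>\<^bsub>braid_group (leaves S')\<^esub> \<gamma>', T')) \<in> splitting\<^sup>*"
proof -
  obtain \<gamma>'' T'' where *: "((S, \<gamma>, T), (S', \<gamma>'', T'')) \<in> splitting\<^sup>*"
    "((R, \<beta> \<otimes>\<^bsub>braid_group (leaves S)\<^esub> \<gamma>, T), (R', \<beta>' \<otimes>\<^bsub>braid_group (leaves S')\<^esub> \<gamma>'', T'')) \<in> splitting\<^sup>*"
    using expansion_mult_left[OF a(2,1) c(1)] by blast
  have "(S', \<gamma>'', T'') = (S', \<gamma>', T')" by (rule expansion_unique[OF c(1) *(1) c(2)]) simp
  then show ?thesis using *(2) by simp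
qed

abbreviation diagram_class :: "diagram \<Rightarrow> diagram set" where
  "diagram_class d \<equiv> diagram_equiv `` {d}"

lemma diagram_class_eq_iff:
  "d \<in> diagrams \<Longrightarrow> e \<in> diagrams \<Longrightarrow> diagram_class d = diagram_class e \<longleftrightarrow> (d, e) \<in> diagram_equiv"
  using eq_equiv_class_iff[OF equiv_diagram_equiv] by blast

lemma diagram_class_self: "d \<in> diagrams \<Longrightarrow> d \<in> diagram_class d"
  using equiv_class_self[OF equiv_diagram_equiv] by blast

lemma diagram_class_expansion: "d \<in> diagrams \<Longrightarrow> (d, e) \<in> splitting\<^sup>* \<Longrightarrow> diagram_class d = diagram_class e"
  using diagram_class_eq_iff expansion_equiv splitting_star_closed by blast

lemma diagram_class_split:
  assumes "d \<in> diagrams" "i < leaves (head_tree d)"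
  shows "diagram_class (split_diagram i d) = diagram_class d"
proof -
  have "(d, split_diagram i d) \<in> splitting" using assms by (auto simp: splitting_iff)
  then show ?thesis using diagram_class_expansion[OF assms(1) r_into_rtrancl] by simp
qed

lemma carrier_BV: "carrier BV = diagrams // diagram_equiv"
  by (simp add: BV_def)

lemma diagram_class_in_BV [intro]: "d \<in> diagrams \<Longrightarrow> diagram_class d \<in> carrier BV"
  by (simp add: carrier_BV quotientI)

lemma BV_cases:
  assumes "x \<in> carrier BV"
  obtains S \<beta> T where "(S, \<beta>, T) \<in> diagrams" "x = diagram_class (S, \<beta>, T)"
  using assms unfolding carrier_BV by (metis quotientE prod_cases3)

lemma BV_rep_head:
  assumes "x \<in> carrier BV"
  obtains S where "\<And>U. nodes S \<subseteq> nodes U \<Longrightarrow> \<exists>\<beta> T. (U, \<beta>, T) \<in> diagrams \<and> x = diagram_class (U, \<beta>, T)"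
proof -
  obtain S \<beta> T where d: "(S, \<beta>, T) \<in> diagrams" "x = diagram_class (S, \<beta>, T)" using BV_cases[OF assms] .
  have "\<exists>\<beta> T. (U, \<beta>, T) \<in> diagrams \<and> x = diagram_class (U, \<beta>, T)" if U: "nodes S \<subseteq> nodes U" for U
  proof -
    obtain e where "((S, \<beta>, T), e) \<in> splitting\<^sup>*" "head_tree e = U" using expansion_exists[OF d(1), of U] U by auto
    moreover from this obtain \<beta>' T' where "e = (U, \<beta>', T')" by (cases e) simp
    ultimately have "((S, \<beta>, T), (U, \<beta>', T')) \<in> splitting\<^sup>*" by simp
    then show ?thesis
      using d diagram_class_expansion[OF d(1)] splitting_star_closed[OF _ d(1)] by blast
  qed
  then show ?thesis using that by blast
qed

lemma BV_rep_tail: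
  assumes "x \<in> carrier BV"
  obtains T where "\<And>U. nodes T \<subseteq> nodes U \<Longrightarrow> \<exists>S \<beta>. (S, \<beta>, U) \<in> diagrams \<and> x = diagram_class (S, \<beta>, U)"
proof -
  obtain S \<beta> T where d: "(S, \<beta>, T) \<in> diagrams" "x = diagram_class (S, \<beta>, T)" using BV_cases[OF assms] .
  have "\<exists>S \<beta>. (S, \<beta>, U) \<in> diagrams \<and> x = diagram_class (S, \<beta>, U)" if U: "nodes T \<subseteq> nodes U" for U
  proof -
    obtain e where "((S, \<beta>, T), e) \<in> splitting\<^sup>*" "tail_tree e = U" using expansion_tail_exists[OF d(1), of U] U by auto
    moreover from this obtain S' \<beta>' where "e = (S', \<beta>', U)" by (cases e) simp
    ultimately have "((S, \<beta>, T), (S', \<beta>', U)) \<in> splitting\<^sup>*" by simp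
    then show ?thesis
      using d diagram_class_expansion[OF d(1)] splitting_star_closed[OF _ d(1)] by blast
  qed
  then show ?thesis using that by blast
qed

text \<open>Common expansions of the two left factors and of the two right factors need not match in
  the middle. Expanding them further to the union of the middle trees gives one product that is an
  expansion of both given products.\<close>

lemma diagram_mult_unique:
  assumes a: "(R, \<beta>, S) \<in> diagrams" and c: "(S, \<gamma>, T) \<in> diagrams"
    and a': "(R', \<beta>', S') \<in> diagrams" and c': "(S', \<gamma>', T') \<in> diagrams"
    and aa': "((R, \<beta>, S), (R', \<beta>', S')) \<in> diagram_equiv" and cc': "((S, \<gamma>, T), (S', \<gamma>', T')) \<in> diagram_equiv"
  shows "((R, \<beta> \<otimes>\<^bsub>braid_group (leaves S)\<^esub> \<gamma>, T), (R', \<beta>' \<otimes>\<^bsub>braid_group (leaves S')\<^esub> \<gamma>', T')) \<in> diagram_equiv"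
proof -
  obtain e where e: "((R, \<beta>, S), e) \<in> splitting\<^sup>*" "((R', \<beta>', S'), e) \<in> splitting\<^sup>*"
    using aa' unfolding diagram_equiv_iff by blast
  obtain f where f: "((S, \<gamma>, T), f) \<in> splitting\<^sup>*" "((S', \<gamma>', T'), f) \<in> splitting\<^sup>*"
    using cc' unfolding diagram_equiv_iff by blast
  have ef: "e \<in> diagrams" "f \<in> diagrams" using splitting_star_closed a c e f by blast+
  obtain U where U: "nodes U = nodes (tail_tree e) \<union> nodes (head_tree f)" using nodes_join by blast
  obtain e2 where e2: "(e, e2) \<in> splitting\<^sup>*" "tail_tree e2 = U" using expansion_tail_exists[OF ef(1)] U by blast
  obtain f2 where f2: "(f, f2) \<in> splitting\<^sup>*" "head_tree f2 = U" using expansion_exists[OF ef(2)] U by blast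
  obtain P \<alpha> where e2': "e2 = (P, \<alpha>, U)" using e2(2) by (cases e2) simp
  obtain Q \<delta> where f2': "f2 = (U, \<delta>, Q)" using f2(2) by (cases f2) simp
  note ex = rtrancl_trans[OF e(1) e2(1), unfolded e2'] rtrancl_trans[OF e(2) e2(1), unfolded e2']
    rtrancl_trans[OF f(1) f2(1), unfolded f2'] rtrancl_trans[OF f(2) f2(1), unfolded f2']
  show ?thesis
    unfolding diagram_equiv_iff
    using diagram_mult_closed[OF a c] diagram_mult_closed[OF a' c']
      expansion_mult[OF a ex(1) c ex(3)] expansion_mult[OF a' ex(2) c' ex(4)] by blast
qed

text \<open>By \<open>diagram_mult_unique\<close> the family in the definition of the product has
  exactly one member, so its union is that class.\<close>

lemma BV_mult:
  assumes a: "(R, \<beta>, S) \<in> diagrams" and c: "(S, \<gamma>, T) \<in> diagrams"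
  shows "diagram_class (R, \<beta>, S) \<otimes>\<^bsub>BV\<^esub> diagram_class (S, \<gamma>, T) =
    diagram_class (R, \<beta> \<otimes>\<^bsub>braid_group (leaves S)\<^esub> \<gamma>, T)" (is "?l = ?r")
proof -
  let ?F = "{diagram_class (R', \<beta>' \<otimes>\<^bsub>braid_group (leaves S')\<^esub> \<gamma>', T') | R' \<beta>' S' \<gamma>' T'.
     (R', \<beta>', S') \<in> diagram_class (R, \<beta>, S) \<and> (S', \<gamma>', T') \<in> diagram_class (S, \<gamma>, T)}"
  have "x = ?r" if "x \<in> ?F" for x
  proof -
    obtain R' \<beta>' S' \<gamma>' T' where x: "x = diagram_class (R', \<beta>' \<otimes>\<^bsub>braid_group (leaves S')\<^esub> \<gamma>', T')"
      and e: "((R, \<beta>, S), (R', \<beta>', S')) \<in> diagram_equiv" "((S, \<gamma>, T), (S', \<gamma>', T')) \<in> diagram_equiv"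
      using \<open>x \<in> ?F\<close> unfolding mem_Collect_eq Image_singleton_iff by blast
    have "(R', \<beta>', S') \<in> diagrams" "(S', \<gamma>', T') \<in> diagrams"
      using e unfolding diagram_equiv_iff by blast+
    from equiv_class_eq[OF equiv_diagram_equiv diagram_mult_unique[OF a c this e]]
    show ?thesis using x by simp
  qed
  moreover have "?r \<in> ?F" using diagram_class_self[OF a] diagram_class_self[OF c] by blast
  ultimately have "?F = {?r}" by blast
  then show ?thesis by (simp only: BV_def monoid.simps cSup_singleton)
qed

lemma one_diagram: "carets S = carets T \<Longrightarrow> (S, \<one>\<^bsub>braid_group (leaves S)\<^esub>, T) \<in> diagrams"
  using monoid.one_closed[OF group.is_monoid[OF group_braid_group]] by (simp add: diagrams_iff)

text \<open>The elements with trivial braid form a copy of Thompson's group F.\<close>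

definition F_elt :: "btree \<Rightarrow> btree \<Rightarrow> diagram set" where
  "F_elt S T = diagram_class (S, \<one>\<^bsub>braid_group (leaves S)\<^esub>, T)"

lemma F_elt_closed: "carets S = carets T \<Longrightarrow> F_elt S T \<in> carrier BV"
  unfolding F_elt_def by (intro diagram_class_in_BV one_diagram)

lemma F_elt_add_caret:
  assumes "carets S = carets T" "i < leaves S"
  shows "F_elt (add_caret S i) (add_caret T i) = F_elt S T"
proof -
  have "split_diagram i (S, \<one>\<^bsub>braid_group (leaves S)\<^esub>, T) =
      (add_caret S i, \<one>\<^bsub>braid_group (leaves (add_caret S i))\<^esub>, add_caret T i)"
    using assms(2) by (simp only: split_diagram_def prod.case split_braid_one braid_perm_one carets_add_caret)
  then show ?thesis
    using diagram_class_split[OF one_diagram[OF assms(1)], of i] assms(2) by (simp add: F_elt_def)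
qed

lemma F_elt_mult:
  assumes "carets R = carets S" "carets S = carets T"
  shows "F_elt R S \<otimes>\<^bsub>BV\<^esub> F_elt S T = F_elt R T"
proof -
  interpret B: group "braid_group (leaves S)" by (rule group_braid_group)
  show ?thesis
    unfolding F_elt_def BV_mult[OF one_diagram[OF assms(1)] one_diagram[OF assms(2)]]
    using assms(1) by simp
qed

text \<open>Growing \<open>T\<close> from a single leaf only expands the unit diagram.\<close>

lemma F_elt_self: "F_elt T T = \<one>\<^bsub>BV\<^esub>"
proof -
  have "F_elt S S = F_elt T T" if "nodes S \<subseteq> nodes T" for S
    using that by (induction rule: tree_growth_induct) (auto simp: F_elt_add_caret)
  from this[of Leaf] have "F_elt T T = F_elt Leaf Leaf" by simp
  then show ?thesis by (simp add: BV_def F_elt_def)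
qed

lemma BV_mult_reps:
  assumes "x \<in> carrier BV" "y \<in> carrier BV"
  obtains R \<beta> S \<gamma> T where "(R, \<beta>, S) \<in> diagrams" "(S, \<gamma>, T) \<in> diagrams"
    "x = diagram_class (R, \<beta>, S)" "y = diagram_class (S, \<gamma>, T)"
proof -
  obtain S1 where 1: "\<And>U. nodes S1 \<subseteq> nodes U \<Longrightarrow> \<exists>R \<beta>. (R, \<beta>, U) \<in> diagrams \<and> x = diagram_class (R, \<beta>, U)"
    using BV_rep_tail[OF assms(1)] by blast
  obtain S2 where 2: "\<And>U. nodes S2 \<subseteq> nodes U \<Longrightarrow> \<exists>\<gamma> T. (U, \<gamma>, T) \<in> diagrams \<and> y = diagram_class (U, \<gamma>, T)"
    using BV_rep_head[OF assms(2)] by blast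
  obtain U where "nodes U = nodes S1 \<union> nodes S2" using nodes_join by blast
  then show ?thesis using 1[of U] 2[of U] that by blast
qed

text \<open>The middle factor has to match on both sides. Its head is enlarged for \<open>x\<close>,
  its tail for \<open>z\<close>; the second expansion enlarges the head once more, which the
  representatives of \<open>x\<close> can follow.\<close>

lemma BV_mult_reps3:
  assumes "x \<in> carrier BV" "y \<in> carrier BV" "z \<in> carrier BV"
  obtains R \<alpha> S \<beta> T \<gamma> U where "(R, \<alpha>, S) \<in> diagrams" "(S, \<beta>, T) \<in> diagrams" "(T, \<gamma>, U) \<in> diagrams"
    "x = diagram_class (R, \<alpha>, S)" "y = diagram_class (S, \<beta>, T)" "z = diagram_class (T, \<gamma>, U)"
proof -
  obtain S1 where 1: "\<And>U. nodes S1 \<subseteq> nodes U \<Longrightarrow> \<exists>R \<beta>. (R, \<beta>, U) \<in> diagrams \<and> x = diagram_class (R, \<beta>, U)"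
    using BV_rep_tail[OF assms(1)] by blast
  obtain S2 \<beta> T2 where 2: "(S2, \<beta>, T2) \<in> diagrams" "y = diagram_class (S2, \<beta>, T2)" using BV_cases[OF assms(2)] .
  obtain T3 where 3: "\<And>U. nodes T3 \<subseteq> nodes U \<Longrightarrow> \<exists>\<gamma> T. (U, \<gamma>, T) \<in> diagrams \<and> z = diagram_class (U, \<gamma>, T)"
    using BV_rep_head[OF assms(3)] by blast
  obtain S4 where S4: "nodes S4 = nodes S1 \<union> nodes S2" using nodes_join by blast
  obtain d where d: "((S2, \<beta>, T2), d) \<in> splitting\<^sup>*" "head_tree d = S4"
    using expansion_exists[OF 2(1), of S4] S4 by auto
  have dd: "d \<in> diagrams" by (rule splitting_star_closed[OF d(1) 2(1)])
  obtain T5 where T5: "nodes T5 = nodes (tail_tree d) \<union> nodes T3" using nodes_join by blast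
  obtain e where e: "(d, e) \<in> splitting\<^sup>*" "tail_tree e = T5"
    using expansion_tail_exists[OF dd, of T5] T5 by blast
  obtain S6 \<beta>' where e': "e = (S6, \<beta>', T5)" using e(2) by (cases e) simp
  have in_e: "(S6, \<beta>', T5) \<in> diagrams" using splitting_star_closed[OF e(1) dd] e' by simp
  have "nodes S1 \<subseteq> nodes S6"
    using splitting_star_nodes[OF e(1)] d(2) S4 e' by simp
  then obtain R \<alpha> where "(R, \<alpha>, S6) \<in> diagrams" "x = diagram_class (R, \<alpha>, S6)" using 1 by blast
  moreover obtain \<gamma> U where "(T5, \<gamma>, U) \<in> diagrams" "z = diagram_class (T5, \<gamma>, U)" using 3[of T5] T5 by blast
  moreover have "y = diagram_class (S6, \<beta>', T5)"
    using diagram_class_expansion[OF 2(1) rtrancl_trans[OF d(1) e(1)]] 2(2) e' by simp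
  ultimately show ?thesis using in_e that by blast
qed

lemma BV_class_inverse:
  assumes "(S, \<beta>, T) \<in> diagrams"
  shows "diagram_class (invert_diagram (S, \<beta>, T)) \<otimes>\<^bsub>BV\<^esub> diagram_class (S, \<beta>, T) = \<one>\<^bsub>BV\<^esub>"
proof -
  interpret B: group "braid_group (leaves S)" by (rule group_braid_group)
  have \<beta>: "\<beta> \<in> carrier (braid_group (leaves S))" "carets T = carets S" using diagramsD[OF assms] by auto
  have "(T, inv\<^bsub>braid_group (leaves S)\<^esub> \<beta>, S) \<in> diagrams"
    using invert_diagram_closed[OF assms] by (simp add: invert_diagram_def)
  from BV_mult[OF this assms] show ?thesis
    using \<beta> F_elt_self[of T] by (simp add: invert_diagram_def F_elt_def)
qed

lemma group_BV: "group BV"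
proof (rule groupI)
  fix x y assume "x \<in> carrier BV" "y \<in> carrier BV"
  then show "x \<otimes>\<^bsub>BV\<^esub> y \<in> carrier BV"
  proof (rule BV_mult_reps)
    fix R \<beta> S \<gamma> T
    assume *: "(R, \<beta>, S) \<in> diagrams" "(S, \<gamma>, T) \<in> diagrams" "x = diagram_class (R, \<beta>, S)" "y = diagram_class (S, \<gamma>, T)"
    show ?thesis
      unfolding *(3,4) BV_mult[OF *(1,2)] by (rule diagram_class_in_BV[OF diagram_mult_closed[OF *(1,2)]])
  qed
next
  show one: "\<one>\<^bsub>BV\<^esub> \<in> carrier BV" using F_elt_self[of Leaf] F_elt_closed[of Leaf Leaf] by simp
  fix x assume x: "x \<in> carrier BV"
  then obtain S \<beta> T where *: "(S, \<beta>, T) \<in> diagrams" "x = diagram_class (S, \<beta>, T)" by (rule BV_cases)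
  interpret B: group "braid_group (leaves S)" by (rule group_braid_group)
  show "\<one>\<^bsub>BV\<^esub> \<otimes>\<^bsub>BV\<^esub> x = x"
    unfolding *(2) F_elt_self[of S, symmetric] F_elt_def BV_mult[OF one_diagram[OF refl] *(1)]
    using diagramsD[OF *(1)] by simp
  show "\<exists>y\<in>carrier BV. y \<otimes>\<^bsub>BV\<^esub> x = \<one>\<^bsub>BV\<^esub>"
    using BV_class_inverse[OF *(1)] diagram_class_in_BV[OF invert_diagram_closed[OF *(1)]] *(2) by blast
next
  fix x y z assume "x \<in> carrier BV" "y \<in> carrier BV" "z \<in> carrier BV"
  then show "x \<otimes>\<^bsub>BV\<^esub> y \<otimes>\<^bsub>BV\<^esub> z = x \<otimes>\<^bsub>BV\<^esub> (y \<otimes>\<^bsub>BV\<^esub> z)"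
  proof (rule BV_mult_reps3)
    fix R \<alpha> S \<beta> T \<gamma> U
    assume *: "(R, \<alpha>, S) \<in> diagrams" "(S, \<beta>, T) \<in> diagrams" "(T, \<gamma>, U) \<in> diagrams"
      "x = diagram_class (R, \<alpha>, S)" "y = diagram_class (S, \<beta>, T)" "z = diagram_class (T, \<gamma>, U)"
    have S: "leaves S = leaves T" "carets R = carets T" using *(1,2) by (simp_all add: diagrams_iff)
    have c: "\<alpha> \<in> carrier (braid_group (leaves T))" "\<beta> \<in> carrier (braid_group (leaves T))" "\<gamma> \<in> carrier (braid_group (leaves T))"
      using *(1-3) S by (simp_all add: diagrams_iff)
    show ?thesis
      unfolding *(4-6) BV_mult[OF *(1,2)] BV_mult[OF *(2,3)] BV_mult[OF diagram_mult_closed[OF *(1,2)] *(3)]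
        BV_mult[OF *(1) diagram_mult_closed[OF *(2,3)]]
      unfolding S(1) using monoid.m_assoc[OF group.is_monoid[OF group_braid_group] c] by simp
  qed
qed


context group
begin

lemma commute_inv:
  assumes "x \<otimes> y = y \<otimes> x" "x \<in> carrier G" "y \<in> carrier G"
  shows "inv x \<otimes> y = y \<otimes> inv x"
  using assms by (metis inv_closed inv_solve_left inv_solve_right m_assoc m_closed)

lemma nat_pow_commute:
  assumes "x \<otimes> y = y \<otimes> x" "x \<in> carrier G" "y \<in> carrier G"
  shows "x [^] (a::nat) \<otimes> y = y \<otimes> x [^] a"
proof (induction a)
  case (Suc a)
  have "x [^] Suc a \<otimes> y = x [^] a \<otimes> (y \<otimes> x)" using assms by (simp add: m_assoc)
  also have "\<dots> = y \<otimes> x [^] Suc a" using assms Suc.IH by (simp flip: m_assoc)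
  finally show ?case .
qed (use assms in simp)

lemma int_pow_commute_left:
  assumes "x \<otimes> y = y \<otimes> x" "x \<in> carrier G" "y \<in> carrier G"
  shows "x [^] (a::int) \<otimes> y = y \<otimes> x [^] a"
  unfolding int_pow_def2 using assms
  by (cases "a < 0") (simp_all only: if_True if_False commute_inv nat_pow_commute nat_pow_closed)

lemma int_pow_commute:
  assumes "x \<otimes> y = y \<otimes> x" "x \<in> carrier G" "y \<in> carrier G"
  shows "x [^] (a::int) \<otimes> y [^] (b::int) = y [^] b \<otimes> x [^] a"
  using int_pow_commute_left[of y x b] int_pow_commute_left[of x "y [^] b" a] assms by simp

end

section \<open>Cayley graphs and an abstract criterion for linear divergence\<close>

section \<open>Word length and paths in Cayley graphs\<close>

locale cayley_graph = group G for G (structure) +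
  fixes X
  assumes gen: "generates G X"
begin

definition letters :: "'a set" where
  "letters = X \<union> (\<lambda>x. inv x) ` X"

definition word_prod :: "'a list \<Rightarrow> 'a" where
  "word_prod ws = foldr (\<otimes>) ws \<one>"

abbreviation len :: "'a \<Rightarrow> nat" where
  "len g \<equiv> cayley_dist G X \<one> g"

definition conn :: "'a set \<Rightarrow> 'a \<Rightarrow> 'a \<Rightarrow> nat \<Rightarrow> bool" where
  "conn A u v L \<longleftrightarrow> (\<exists>vs. cayley_path G X u vs v \<and> path_length vs \<le> L \<and> set vs \<subseteq> A)"

lemma X_sub: "X \<subseteq> carrier G" and generate_X: "generate G X = carrier G"
  using gen by (auto simp: generates_def)

lemma letters_sub: "letters \<subseteq> carrier G"
  using X_sub by (auto simp: letters_def)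

lemma inv_letters: "x \<in> letters \<Longrightarrow> inv x \<in> letters"
  using X_sub by (auto simp: letters_def)

lemma word_prod_simps [simp]: "word_prod [] = \<one>" "word_prod (x # ws) = x \<otimes> word_prod ws"
  by (simp_all add: word_prod_def)

lemma word_prod_closed [simp]: "set ws \<subseteq> letters \<Longrightarrow> word_prod ws \<in> carrier G"
  using letters_sub by (induction ws) auto

lemma word_prod_append:
  "set ws \<subseteq> letters \<Longrightarrow> set vs \<subseteq> letters \<Longrightarrow> word_prod (ws @ vs) = word_prod ws \<otimes> word_prod vs"
proof (induction ws)
  case (Cons a ws)
  then have "a \<in> carrier G" using letters_sub by auto
  with Cons show ?case by (simp add: m_assoc)
qed simp

lemma word_prod_inv:
  "set ws \<subseteq> letters \<Longrightarrow> inv (word_prod ws) = word_prod (rev (map (\<lambda>x. inv x) ws))"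
proof (induction ws)
  case (Cons a ws)
  have a: "a \<in> letters" and ws: "set ws \<subseteq> letters" using Cons.prems by auto
  then have "set (rev (map (\<lambda>x. inv x) ws)) \<subseteq> letters" using inv_letters by auto
  moreover have "a \<in> carrier G" using a letters_sub by auto
  ultimately show ?case
    using Cons.IH[OF ws] ws inv_letters[OF a] by (simp add: inv_mult_group word_prod_append)
qed simp

lemma cayley_adj_iff:
  "cayley_adj G X u v \<longleftrightarrow> u \<in> carrier G \<and> (\<exists>x\<in>letters. v = u \<otimes> x)"
proof
  assume "cayley_adj G X u v"
  then obtain x where x: "x \<in> X" "u \<in> carrier G" "v \<in> carrier G" "v = u \<otimes> x \<or> u = v \<otimes> x"
    by (auto simp: cayley_adj_def)
  then have xc: "x \<in> carrier G" using X_sub by auto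
  from x(4) show "u \<in> carrier G \<and> (\<exists>x\<in>letters. v = u \<otimes> x)"
  proof
    assume "u = v \<otimes> x"
    then have "v = u \<otimes> inv x" using x xc by (simp add: m_assoc)
    then show ?thesis using x by (auto simp: letters_def)
  qed (use x in \<open>auto simp: letters_def\<close>)
next
  assume "u \<in> carrier G \<and> (\<exists>x\<in>letters. v = u \<otimes> x)"
  then obtain x where x: "u \<in> carrier G" "x \<in> letters" "v = u \<otimes> x" by auto
  then have xc: "x \<in> carrier G" "v \<in> carrier G" using letters_sub by auto
  from x(2) consider "x \<in> X" | y where "y \<in> X" "x = inv y" by (auto simp: letters_def)
  then show "cayley_adj G X u v"
  proof cases
    case 2
    then have "y \<in> carrier G" using X_sub by auto
    then have "u = v \<otimes> y" using x 2 by (simp add: m_assoc)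
    then show ?thesis using 2 x xc by (auto simp: cayley_adj_def)
  qed (use x xc in \<open>auto simp: cayley_adj_def\<close>)
qed

lemma path_of_word:
  assumes "set ws \<subseteq> letters" "u \<in> carrier G"
  shows "\<exists>vs. cayley_path G X u vs (u \<otimes> word_prod ws) \<and> path_length vs = length ws \<and>
     set vs = {u \<otimes> word_prod (take i ws) | i. i \<le> length ws}"
  using assms
proof (induction ws arbitrary: u)
  case Nil
  then show ?case
    by (intro exI[of _ "[u]"]) (simp add: cayley_path_def path_length_def)
next
  case (Cons a ws)
  have a: "a \<in> letters" "a \<in> carrier G" and ws: "set ws \<subseteq> letters" using Cons.prems letters_sub by auto
  have ua: "u \<otimes> a \<in> carrier G" using a Cons.prems by simp
  obtain vs where vs: "cayley_path G X (u \<otimes> a) vs (u \<otimes> a \<otimes> word_prod ws)" "path_length vs = length ws"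
    "set vs = {u \<otimes> a \<otimes> word_prod (take i ws) | i. i \<le> length ws}"
    using Cons.IH[OF ws ua] by blast
  have adj: "cayley_adj G X u (u \<otimes> a)" using a Cons.prems by (auto simp: cayley_adj_iff)
  have tk: "word_prod (take i ws) \<in> carrier G" for i
    using ws by (meson set_take_subset subset_trans word_prod_closed)
  have "cayley_path G X u (u # vs) (u \<otimes> word_prod (a # ws))"
    using vs(1) adj Cons.prems(2) a ws by (cases vs) (auto simp: cayley_path_def m_assoc)
  moreover have "path_length (u # vs) = length (a # ws)"
    using vs(1,2) by (cases vs) (auto simp: path_length_def cayley_path_def)
  moreover have "set (u # vs) = {u \<otimes> word_prod (take i (a # ws)) | i. i \<le> length (a # ws)}"
  proof -
    have "{u \<otimes> word_prod (take i (a # ws)) | i. i \<le> length (a # ws)} =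
        insert (u \<otimes> word_prod (take 0 (a # ws))) {u \<otimes> word_prod (take (Suc i) (a # ws)) | i. i \<le> length ws}"
    proof (intro equalityI subsetI)
      fix z assume "z \<in> {u \<otimes> word_prod (take i (a # ws)) | i. i \<le> length (a # ws)}"
      then obtain i where "z = u \<otimes> word_prod (take i (a # ws))" "i \<le> length (a # ws)" by blast
      then show "z \<in> insert (u \<otimes> word_prod (take 0 (a # ws))) {u \<otimes> word_prod (take (Suc i) (a # ws)) | i. i \<le> length ws}"
        by (cases i) auto
    next
      fix z assume "z \<in> insert (u \<otimes> word_prod (take 0 (a # ws))) {u \<otimes> word_prod (take (Suc i) (a # ws)) | i. i \<le> length ws}"
      then show "z \<in> {u \<otimes> word_prod (take i (a # ws)) | i. i \<le> length (a # ws)}"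
        by (auto intro: exI[of _ 0] exI[of _ "Suc i" for i])
    qed
    moreover have "{u \<otimes> word_prod (take (Suc i) (a # ws)) | i. i \<le> length ws} = set vs"
      unfolding vs(3) using tk a Cons.prems(2) by (simp add: m_assoc)
    ultimately show ?thesis using Cons.prems(2) by simp
  qed
  ultimately show ?case by blast
qed

lemma word_of_path:
  assumes "cayley_path G X u vs v"
  shows "\<exists>ws. set ws \<subseteq> letters \<and> length ws = path_length vs \<and> v = u \<otimes> word_prod ws"
  using assms
proof (induction vs arbitrary: u)
  case Nil
  then show ?case by (simp add: cayley_path_def)
next
  case (Cons a vs)
  show ?case
  proof (cases vs)
    case Nil
    then show ?thesis using Cons.prems by (intro exI[of _ "[]"]) (auto simp: cayley_path_def path_length_def)
  next
    case (Cons b vs')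
    have adj: "cayley_adj G X a b" "a = u" "a \<in> carrier G"
      using Cons.prems Cons by (auto simp: cayley_path_def)
    then obtain x where x: "x \<in> letters" "b = u \<otimes> x" by (auto simp: cayley_adj_iff)
    have "cayley_path G X b vs v" using Cons.prems Cons by (auto simp: cayley_path_def)
    then obtain ws where ws: "set ws \<subseteq> letters" "length ws = path_length vs" "v = b \<otimes> word_prod ws"
      using Cons.IH by blast
    have "x \<in> carrier G" using x letters_sub by auto
    then have "v = u \<otimes> word_prod (x # ws)" using ws x adj by (simp add: m_assoc)
    then show ?thesis using ws x Cons
      by (intro exI[of _ "x # ws"]) (auto simp: path_length_def)
  qed
qed

lemma exists_word: "g \<in> carrier G \<Longrightarrow> \<exists>ws. set ws \<subseteq> letters \<and> word_prod ws = g"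
  unfolding generate_X[symmetric]
proof (induction rule: generate.induct)
  case one
  then show ?case by (intro exI[of _ "[]"]) simp
next
  case (incl h)
  then show ?case using X_sub by (intro exI[of _ "[h]"]) (auto simp: letters_def)
next
  case (inv h)
  then show ?case using X_sub by (intro exI[of _ "[inv h]"]) (auto simp: letters_def)
next
  case (eng h1 h2)
  then show ?case by (metis word_prod_append set_append Un_least)
qed

lemma len_word_le:
  assumes "set ws \<subseteq> letters"
  shows "len (word_prod ws) \<le> length ws"
proof -
  obtain vs where "cayley_path G X \<one> vs (\<one> \<otimes> word_prod ws)" "path_length vs = length ws"
    using path_of_word[OF assms one_closed] by blast
  then show ?thesis
    using assms unfolding cayley_dist_def by (intro Least_le) auto
qed

lemma geodesic_word:
  assumes "g \<in> carrier G"
  obtains ws where "set ws \<subseteq> letters" "word_prod ws = g" "length ws = len g"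
proof -
  obtain ws where ws: "set ws \<subseteq> letters" "word_prod ws = g" using exists_word[OF assms] by blast
  have "\<exists>m. \<exists>vs. cayley_path G X \<one> vs g \<and> path_length vs = m"
    using path_of_word[OF ws(1) one_closed] ws(2) assms by auto
  then have "\<exists>vs. cayley_path G X \<one> vs g \<and> path_length vs = len g"
    unfolding cayley_dist_def by (rule LeastI_ex)
  then obtain vs where "cayley_path G X \<one> vs g" "path_length vs = len g" by blast
  then obtain us where "set us \<subseteq> letters" "length us = len g" "g = \<one> \<otimes> word_prod us"
    using word_of_path by metis
  then show ?thesis using that by auto
qed

lemma len_one [simp]: "len \<one> = 0"
  using len_word_le[of "[]"] by simp

lemma len_mult: "g \<in> carrier G \<Longrightarrow> h \<in> carrier G \<Longrightarrow> len (g \<otimes> h) \<le> len g + len h"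
  by (metis geodesic_word len_word_le length_append set_append Un_least word_prod_append)

lemma len_inv [simp]: assumes "g \<in> carrier G" shows "len (inv g) = len g"
proof -
  have *: "len (inv g) \<le> len g" if g: "g \<in> carrier G" for g
  proof -
    obtain ws where ws: "set ws \<subseteq> letters" "word_prod ws = g" "length ws = len g" using geodesic_word[OF g] .
    have "set (rev (map (\<lambda>x. inv x) ws)) \<subseteq> letters" using ws inv_letters by auto
    then show ?thesis using len_word_le[of "rev (map (\<lambda>x. inv x) ws)"] word_prod_inv[OF ws(1)] ws by simp
  qed
  show ?thesis using *[OF assms] *[of "inv g"] assms by simp
qed

lemma len_pow: "g \<in> carrier G \<Longrightarrow> len (g [^] (k::nat)) \<le> k * len g"
proof (induction k)
  case (Suc k)
  then show ?case using len_mult[of "g [^] k" g] by simp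
qed simp

lemma len_mult_ge_left: "g \<in> carrier G \<Longrightarrow> h \<in> carrier G \<Longrightarrow> len g \<le> len (g \<otimes> h) + len h"
  using len_mult[of "g \<otimes> h" "inv h"] by (simp add: m_assoc)

lemma len_mult_ge_right: "g \<in> carrier G \<Longrightarrow> h \<in> carrier G \<Longrightarrow> len h \<le> len g + len (g \<otimes> h)"
  using len_mult[of "inv g" "g \<otimes> h"] by (simp flip: m_assoc)

lemma conn_mono: "conn A u v L \<Longrightarrow> L \<le> M \<Longrightarrow> conn A u v M"
  unfolding conn_def by (meson le_trans)

lemma cayley_adj_sym: "cayley_adj G X u v \<Longrightarrow> cayley_adj G X v u"
  by (auto simp: cayley_adj_def)

lemma conn_sym:
  assumes "conn A u v L"
  shows "conn A v u L"
proof -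
  obtain vs where vs: "cayley_path G X u vs v" "path_length vs \<le> L" "set vs \<subseteq> A"
    using assms by (auto simp: conn_def)
  have "successively (cayley_adj G X) (rev vs)"
    unfolding successively_rev using vs(1)
    by (auto simp: cayley_path_def intro: successively_mono cayley_adj_sym)
  then have "cayley_path G X v (rev vs) u"
    using vs(1) by (auto simp: cayley_path_def hd_rev last_rev)
  then show ?thesis using vs by (auto simp: conn_def path_length_def intro!: exI[of _ "rev vs"])
qed

lemma conn_trans:
  assumes "conn A u v L" "conn A v w M"
  shows "conn A u w (L + M)"
proof -
  obtain vs where vs: "cayley_path G X u vs v" "path_length vs \<le> L" "set vs \<subseteq> A"
    using assms by (auto simp: conn_def)
  obtain ws where ws: "cayley_path G X v ws w" "path_length ws \<le> M" "set ws \<subseteq> A"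
    using assms by (auto simp: conn_def)
  obtain ws' where ws': "ws = v # ws'" using ws(1) by (cases ws) (auto simp: cayley_path_def)
  have "cayley_path G X u (vs @ ws') w"
    using vs(1) ws(1) unfolding ws'
    by (cases ws') (auto simp: cayley_path_def successively_append_iff)
  then show ?thesis
    using vs ws unfolding ws' conn_def
    by (intro exI[of _ "vs @ ws'"]) (auto simp: path_length_def cayley_path_def)
qed

lemma conn_refl: "u \<in> carrier G \<Longrightarrow> u \<in> A \<Longrightarrow> conn A u u 0"
  unfolding conn_def by (intro exI[of _ "[u]"]) (simp add: cayley_path_def path_length_def)

text \<open>The vertices of a geodesic from \<open>u\<close> to \<open>u \<otimes> h\<close> are the
  products of \<open>u\<close> with initial parts of a shortest word for \<open>h\<close>. Both
  parts of such a word are shortest words again, so only these factorizations of \<open>h\<close>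
  have to be tested.\<close>

lemma conn_geodesic:
  assumes u: "u \<in> carrier G" and h: "h \<in> carrier G"
    and A: "\<And>p s. \<lbrakk>p \<in> carrier G; s \<in> carrier G; h = p \<otimes> s; len p + len s = len h\<rbrakk> \<Longrightarrow> u \<otimes> p \<in> A"
  shows "conn A u (u \<otimes> h) (len h)"
proof -
  obtain ws where ws: "set ws \<subseteq> letters" "word_prod ws = h" "length ws = len h" using geodesic_word[OF h] .
  obtain vs where vs: "cayley_path G X u vs (u \<otimes> h)" "path_length vs = length ws"
    "set vs = {u \<otimes> word_prod (take i ws) | i. i \<le> length ws}"
    using path_of_word[OF ws(1) u] ws(2) by auto
  have "u \<otimes> word_prod (take i ws) \<in> A" if i: "i \<le> length ws" for i
  proof (rule A)
    have t: "set (take i ws) \<subseteq> letters" "set (drop i ws) \<subseteq> letters"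
      using ws(1) set_take_subset set_drop_subset by (metis subset_trans)+
    then show c: "word_prod (take i ws) \<in> carrier G" "word_prod (drop i ws) \<in> carrier G" by simp_all
    show h: "h = word_prod (take i ws) \<otimes> word_prod (drop i ws)"
      using word_prod_append[OF t] ws(2) by simp
    have "len h \<le> len (word_prod (take i ws)) + len (word_prod (drop i ws))"
      by (subst h) (rule len_mult[OF c])
    moreover have "len (word_prod (take i ws)) \<le> i" "len (word_prod (drop i ws)) \<le> length ws - i"
      using len_word_le[OF t(1)] len_word_le[OF t(2)] i by simp_all
    ultimately show "len (word_prod (take i ws)) + len (word_prod (drop i ws)) = len h"
      using ws(3) i by linarith
  qed
  then show ?thesis
    unfolding conn_def using vs ws(3) by (intro exI[of _ vs]) auto
qed

text \<open>Each factor \<open>s\<close> is walked along a geodesic, so every vertex is some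
  \<open>u \<otimes> s [^] j\<close> followed by an element no longer than \<open>s\<close>.\<close>

lemma conn_power:
  assumes u: "u \<in> carrier G" and s: "s \<in> carrier G" and uA: "u \<in> A"
    and A: "\<And>j p. \<lbrakk>j < N; p \<in> carrier G; len p \<le> len s\<rbrakk> \<Longrightarrow> u \<otimes> s [^] j \<otimes> p \<in> A"
  shows "conn A u (u \<otimes> s [^] (N::nat)) (N * len s)"
  using A
proof (induction N)
  case 0
  then show ?case using conn_refl u uA by simp
next
  case (Suc N)
  have "conn A u (u \<otimes> s [^] N) (N * len s)" using Suc by simp
  moreover have "conn A (u \<otimes> s [^] N) (u \<otimes> s [^] N \<otimes> s) (len s)"
    using Suc.prems[of N] u s by (intro conn_geodesic) auto
  ultimately show ?case
    using conn_trans u s by (fastforce simp: m_assoc add.commute)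
qed

lemma geodesic_split:
  assumes "h \<in> carrier G" "len h = a + b"
  obtains p s where "p \<in> carrier G" "s \<in> carrier G" "h = p \<otimes> s" "len p = a" "len s = b"
proof -
  obtain ws where ws: "set ws \<subseteq> letters" "word_prod ws = h" "length ws = len h" using geodesic_word[OF assms(1)] .
  have t: "set (take a ws) \<subseteq> letters" "set (drop a ws) \<subseteq> letters"
    using ws(1) set_take_subset set_drop_subset by (metis subset_trans)+
  have c: "word_prod (take a ws) \<in> carrier G" "word_prod (drop a ws) \<in> carrier G" using t by simp_all
  have h: "h = word_prod (take a ws) \<otimes> word_prod (drop a ws)"
    using word_prod_append[OF t] ws(2) by simp
  have "len h \<le> len (word_prod (take a ws)) + len (word_prod (drop a ws))"
    by (subst h) (rule len_mult[OF c])
  moreover have "len (word_prod (take a ws)) \<le> a" "len (word_prod (drop a ws)) \<le> b"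
    using len_word_le[OF t(1)] len_word_le[OF t(2)] ws(3) assms(2) by simp_all
  ultimately have "len (word_prod (take a ws)) = a" "len (word_prod (drop a ws)) = b"
    using assms(2) by linarith+
  then show ?thesis by (rule that[OF c h])
qed

end


section \<open>A criterion for linear divergence\<close>

lemma (in group) inv_mult_cancel:
  assumes "x \<in> carrier G" "z \<in> carrier G"
  shows "inv x \<otimes> (x \<otimes> z) = z" "x \<otimes> (inv x \<otimes> z) = z"
  using assms by (simp_all flip: m_assoc)

lemma (in group) conj_pow:
  "x \<in> carrier G \<Longrightarrow> s \<in> carrier G \<Longrightarrow> (x \<otimes> s \<otimes> inv x) [^] (j::nat) = x \<otimes> s [^] j \<otimes> inv x"
proof (induction j)
  case (Suc j)
  then have "(x \<otimes> s \<otimes> inv x) [^] Suc j = x \<otimes> s [^] j \<otimes> inv x \<otimes> (x \<otimes> s \<otimes> inv x)" by simp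
  then show ?case using Suc.prems by (simp add: m_assoc inv_mult_cancel)
qed simp

lemma (in group) conj_int_pow:
  assumes "x \<in> carrier G" "s \<in> carrier G"
  shows "(x \<otimes> s \<otimes> inv x) [^] (j::int) = x \<otimes> s [^] j \<otimes> inv x"
proof (cases "j < 0")
  case True
  have "inv (x \<otimes> s [^] nat (- j) \<otimes> inv x) = x \<otimes> inv (s [^] nat (- j)) \<otimes> inv x"
    using assms by (simp only: inv_mult_group inv_inv m_closed inv_closed nat_pow_closed m_assoc)
  then show ?thesis
    using True by (simp only: int_pow_def2 conj_pow[OF assms] if_True)
next
  case False
  then show ?thesis by (simp only: int_pow_def2 conj_pow[OF assms] if_False)
qed

lemma (in group) nat_pow_commute2:
  assumes "x \<otimes> y = y \<otimes> x" "x \<in> carrier G" "y \<in> carrier G"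
  shows "x [^] (a::nat) \<otimes> y [^] (b::nat) = y [^] b \<otimes> x [^] a"
  using int_pow_commute[OF assms, of "int a" "int b"] by (simp add: int_pow_int)

text \<open>In the application \<open>D\<close> is the defect, \<open>t0\<close> and
  \<open>t1\<close> are the twists in the two halves of the tree, and powers of \<open>y\<close>
  push \<open>t1\<close> deeper into its half. The bounds by \<open>max\<close> say that a product
  of commuting powers is large as soon as one exponent is large, so either factor may be built up or
  undone while the other guards the path.\<close>

locale linear_divergence = cayley_graph +
  fixes D :: "'a \<Rightarrow> nat" and t0 t1 y
  assumes finite_X: "finite X"
    and D_one: "D \<one> = 0"
    and D_mult: "\<And>g h. g \<in> carrier G \<Longrightarrow> h \<in> carrier G \<Longrightarrow> D (g \<otimes> h) \<le> D g + D h"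
    and closed [simp]: "t0 \<in> carrier G" "t1 \<in> carrier G" "y \<in> carrier G"
    and t0_commute: "\<And>k::nat. t0 \<otimes> (y [^] k \<otimes> t1 \<otimes> inv (y [^] k)) = y [^] k \<otimes> t1 \<otimes> inv (y [^] k) \<otimes> t0"
    and D_t0: "\<And>(k::nat) (a::int) (b::int).
      max \<bar>a\<bar> \<bar>b\<bar> \<le> int (D ((y [^] k \<otimes> t1 \<otimes> inv (y [^] k)) [^] a \<otimes> t0 [^] b))"
    and conj_ex: "\<exists>C. \<forall>g\<in>carrier G. \<forall>k\<ge>C * cayley_dist G X \<one> g. \<exists>s\<in>{t0, t1}.
      s \<otimes> (g \<otimes> (y [^] k \<otimes> t1 \<otimes> inv (y [^] k)) \<otimes> inv g) = g \<otimes> (y [^] k \<otimes> t1 \<otimes> inv (y [^] k)) \<otimes> inv g \<otimes> s \<and>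
      (\<forall>(a::int) (b::int). max \<bar>a\<bar> \<bar>b\<bar> \<le>
        int (D ((g \<otimes> (y [^] k \<otimes> t1 \<otimes> inv (y [^] k)) \<otimes> inv g) [^] a \<otimes> s [^] b)))"
begin

text \<open>The complement of the open ball of radius \<open>n / 4\<close>, written with natural
  numbers; this fixes \<open>\<delta>\<close> as 1/4.\<close>

definition outside :: "nat \<Rightarrow> 'a set" where
  "outside n = {w \<in> carrier G. n \<le> 4 * len w}"

text \<open>Subadditivity along a word: the finite sum of \<open>D\<close> over the letters bounds
  each letter, and \<open>Suc\<close> makes \<open>K\<close> positive.\<close>

lemma D_le_len: obtains K :: nat where "1 \<le> K" "\<And>g. g \<in> carrier G \<Longrightarrow> D g \<le> K * len g"
proof -
  have fin: "finite letters" using finite_X by (simp add: letters_def)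
  define K where "K = Suc (\<Sum>x\<in>letters. D x)"
  have letter: "D x \<le> K" if "x \<in> letters" for x
    using member_le_sum[OF that _ fin, of D] by (simp add: K_def)
  have word: "D (word_prod ws) \<le> K * length ws" if "set ws \<subseteq> letters" for ws
    using that
  proof (induction ws)
    case (Cons a ws)
    then have "a \<in> carrier G" "D a \<le> K" using letters_sub letter by auto
    then have "D (word_prod (a # ws)) \<le> K + D (word_prod ws)"
      using D_mult[of a "word_prod ws"] Cons.prems by simp
    then show ?case using Cons by simp
  qed (simp add: D_one)
  show ?thesis
  proof (rule that[of K])
    show "D g \<le> K * len g" if g: "g \<in> carrier G" for g
    proof -
      obtain ws where "set ws \<subseteq> letters" "word_prod ws = g" "length ws = len g" using geodesic_word[OF g] .
      then show ?thesis using word by metis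
    qed
  qed (simp add: K_def)
qed

lemma D_t0_pow: "\<bar>b\<bar> \<le> int (D (t0 [^] (b::int)))"
  using D_t0[where k = 0 and a = 0 and b = b] by simp

text \<open>Powers of \<open>t0\<close> have unbounded \<open>D\<close>, hence unbounded length; an
  initial part of a geodesic has the exact length.\<close>

lemma exact_length: "\<exists>h\<in>carrier G. len h = m"
proof -
  obtain K :: nat where K: "1 \<le> K" "\<And>g. g \<in> carrier G \<Longrightarrow> D g \<le> K * len g"
    using D_le_len by blast
  let ?h = "t0 [^] (int (K * m))"
  have c: "?h \<in> carrier G" by simp
  have "int (K * m) \<le> int (D ?h)" using D_t0_pow[of "int (K * m)"] by simp
  then have "K * m \<le> D ?h" by linarith
  also have "\<dots> \<le> K * len ?h" using K(2)[OF c] .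
  finally have "m \<le> len ?h" using K(1) by simp
  then obtain b where "len ?h = m + b" using le_Suc_ex by blast
  then show ?thesis using geodesic_split[OF c] by metis
qed

text \<open>A geodesic of length \<open>2 L\<close> is attached at \<open>g\<close> by its midpoint; if both halves entered the small
  ball, the geodesic would have a shortcut.\<close>

lemma escape_far:
  assumes g: "g \<in> carrier G" "len g = n"
  obtains u where "u \<in> carrier G" "len u = L" "conn (outside n) g (g \<otimes> u) L"
proof -
  obtain h where h: "h \<in> carrier G" "len h = L + L" using exact_length by blast
  obtain h1 h2 where h12: "h1 \<in> carrier G" "h2 \<in> carrier G" "h = h1 \<otimes> h2" "len h1 = L" "len h2 = L"
    using geodesic_split[OF h] .
  show ?thesis
  proof (cases "\<forall>p\<in>carrier G. \<forall>s\<in>carrier G. h2 = p \<otimes> s \<longrightarrow> len p + len s = len h2 \<longrightarrow> g \<otimes> p \<in> outside n")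
    case True
    then have "conn (outside n) g (g \<otimes> h2) (len h2)"
      using g h12 by (intro conn_geodesic) auto
    then show ?thesis using that[of h2] h12 by simp
  next
    case False
    then obtain p s where p: "p \<in> carrier G" "s \<in> carrier G" "h2 = p \<otimes> s" "len p + len s = len h2" "g \<otimes> p \<notin> outside n"
      by blast
    have gp: "4 * len (g \<otimes> p) < n" using p g by (auto simp: outside_def)
    have "conn (outside n) g (g \<otimes> inv h1) (len (inv h1))"
    proof (rule conn_geodesic)
      fix p' s' assume p': "p' \<in> carrier G" "s' \<in> carrier G" "inv h1 = p' \<otimes> s'" "len p' + len s' = len (inv h1)"
      show "g \<otimes> p' \<in> outside n"
      proof (rule ccontr)
        assume "g \<otimes> p' \<notin> outside n"
        then have gp': "4 * len (g \<otimes> p') < n" using p' g by (auto simp: outside_def)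
        have h1: "h1 = inv s' \<otimes> inv p'" using p' h12(1) by (metis inv_inv inv_mult_group)
        have "h = inv s' \<otimes> (inv p' \<otimes> p) \<otimes> s"
          unfolding h12(3) h1 p(3) using p p' by (simp add: m_assoc)
        then have "len h \<le> len (inv s') + len (inv p' \<otimes> p) + len s"
          using len_mult[of "inv s' \<otimes> (inv p' \<otimes> p)" s] len_mult[of "inv s'" "inv p' \<otimes> p"] p p' by simp
        then have 1: "len p + len p' \<le> len (inv p' \<otimes> p)"
          using h h12 p(4) p'(4) p'(2) by simp
        have "inv p' \<otimes> p = inv (g \<otimes> p') \<otimes> (g \<otimes> p)"
          using g p(1) p'(1) by (simp add: inv_mult_group m_assoc inv_mult_cancel)
        then have 2: "len (inv p' \<otimes> p) \<le> len (g \<otimes> p') + len (g \<otimes> p)"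
          using len_mult[of "inv (g \<otimes> p')" "g \<otimes> p"] g p p' by simp
        \<comment> \<open>Two points of the small ball are less than \<open>n / 2\<close> apart,
          whereas \<open>p\<close> alone is longer than \<open>3 n / 4\<close>, because it leads
          from the sphere of radius \<open>n\<close> into that ball.\<close>
        have 3: "n \<le> len (g \<otimes> p) + len p" using len_mult_ge_left[of g p] g p by simp
        show False using 1 2 3 gp gp' by linarith
      qed
    qed (use g h12 in auto)
    then show ?thesis using that[of "inv h1"] h12 by simp
  qed
qed

text \<open>The device that keeps paths away from the identity: \<open>K * m \<le> D h\<close>
  forces \<open>m \<le> len h\<close>, and the factors \<open>w\<close> and \<open>p\<close> can
  cancel at most their own lengths.\<close>

lemma outside_if_D:
  assumes K: "1 \<le> K" "\<And>g. g \<in> carrier G \<Longrightarrow> D g \<le> K * len g"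
    and c: "w \<in> carrier G" "h \<in> carrier G" "p \<in> carrier G"
    and D: "K * m \<le> D h" and m: "n + len w + len p \<le> m"
  shows "w \<otimes> h \<otimes> p \<in> outside n"
proof -
  have "K * m \<le> K * len h" using D K(2)[OF c(2)] by linarith
  then have "m \<le> len h" using K(1) by simp
  moreover have "len h \<le> len w + len (w \<otimes> h)" using len_mult_ge_right c by blast
  moreover have "len (w \<otimes> h) \<le> len (w \<otimes> h \<otimes> p) + len p" using len_mult_ge_left c by blast
  ultimately show ?thesis using m c by (simp add: outside_def)
qed

text \<open>The power of a conjugate is walked as \<open>x\<close>, then \<open>s [^] M\<close>,
  then \<open>inv x\<close>. The conjugator is paid for twice in total and not once for every
  factor, which keeps the length linear when \<open>x\<close> and \<open>M\<close> are both of
  linear size.\<close>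

lemma conn_conj_power:
  assumes K: "1 \<le> K" "\<And>g. g \<in> carrier G \<Longrightarrow> D g \<le> K * len g"
    and c: "w \<in> carrier G" "h \<in> carrier G" "x \<in> carrier G" "s \<in> carrier G"
    and D: "\<And>j. j \<le> M \<Longrightarrow> K * m \<le> D (h \<otimes> (x \<otimes> s \<otimes> inv x) [^] j)"
    and m: "n + len w + 2 * len x + len s \<le> m"
  shows "conn (outside n) (w \<otimes> h) (w \<otimes> h \<otimes> (x \<otimes> s \<otimes> inv x) [^] (M::nat)) (2 * len x + M * len s)"
proof -
  let ?c = "\<lambda>j. (x \<otimes> s \<otimes> inv x) [^] (j::nat)"
  have out: "w \<otimes> (h \<otimes> ?c j) \<otimes> p \<in> outside n" if "j \<le> M" "p \<in> carrier G" "len p \<le> 2 * len x + len s" for j p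
    by (rule outside_if_D[OF K _ _ _ D]) (use c m that in auto)
  \<comment> \<open>A vertex on the way is \<open>w\<close> times a guarded element times the short
    tail \<open>x \<otimes> p\<close>, the form that \<open>out\<close> handles.\<close>
  have eq: "w \<otimes> h \<otimes> x \<otimes> s [^] j \<otimes> p = w \<otimes> (h \<otimes> ?c j) \<otimes> (x \<otimes> p)" if "p \<in> carrier G" for j p
    unfolding conj_pow[OF c(3,4)] using that c by (simp add: m_assoc inv_mult_cancel)
  have xp: "len (x \<otimes> p) \<le> len x + len p" if "p \<in> carrier G" for p using len_mult c that by blast
  have 1: "conn (outside n) (w \<otimes> h) (w \<otimes> h \<otimes> x) (len x)"
  proof (rule conn_geodesic)
    fix p s' assume "p \<in> carrier G" "len p + len s' = len x"
    then show "w \<otimes> h \<otimes> p \<in> outside n" using out[of 0 p] c by simp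
  qed (use c in auto)
  have 2: "conn (outside n) (w \<otimes> h \<otimes> x) (w \<otimes> h \<otimes> x \<otimes> s [^] M) (M * len s)"
  proof (rule conn_power)
    show "w \<otimes> h \<otimes> x \<in> outside n" using out[of 0 x] c by simp
    show "w \<otimes> h \<otimes> x \<otimes> s [^] j \<otimes> p \<in> outside n" if "j < M" "p \<in> carrier G" "len p \<le> len s" for j p
      unfolding eq[OF that(2)] using that xp[OF that(2)] c by (intro out) auto
  qed (use c in auto)
  have 3: "conn (outside n) (w \<otimes> h \<otimes> x \<otimes> s [^] M) (w \<otimes> h \<otimes> x \<otimes> s [^] M \<otimes> inv x) (len (inv x))"
  proof (rule conn_geodesic)
    fix p s' assume p: "p \<in> carrier G" "len p + len s' = len (inv x)"
    then show "w \<otimes> h \<otimes> x \<otimes> s [^] M \<otimes> p \<in> outside n"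
      unfolding eq[OF p(1)] using xp[OF p(1)] c by (intro out) auto
  qed (use c in auto)
  have "w \<otimes> h \<otimes> x \<otimes> s [^] M \<otimes> inv x = w \<otimes> h \<otimes> ?c M"
    unfolding conj_pow[OF c(3,4)] using c by (simp add: m_assoc)
  then show ?thesis
    using conn_mono[OF conn_trans[OF conn_trans[OF 1 2] 3]] c by simp
qed

lemma conn_power_D:
  assumes K: "1 \<le> K" "\<And>g. g \<in> carrier G \<Longrightarrow> D g \<le> K * len g"
    and c: "w \<in> carrier G" "h \<in> carrier G" "s \<in> carrier G"
    and D: "\<And>j. j \<le> M \<Longrightarrow> K * m \<le> D (h \<otimes> s [^] j)"
    and m: "n + len w + len s \<le> m"
  shows "conn (outside n) (w \<otimes> h) (w \<otimes> h \<otimes> s [^] (M::nat)) (M * len s)"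
  using conn_conj_power[OF K, of w h \<one> s M m n] c D m by simp

text \<open>If both directions along the powers of \<open>t0\<close> failed, \<open>g\<close> times
  two powers of opposite sign would lie near the identity. Their quotient is a power of
  \<open>t0\<close> of length linear in \<open>n\<close>, so \<open>D\<close> bounds the exponents
  linearly, and \<open>g\<close> would be closer to the identity than \<open>big\<close>
  allows.\<close>

lemma escape_t0:
  assumes K: "1 \<le> K" "\<And>g. g \<in> carrier G \<Longrightarrow> D g \<le> K * len g"
    and q: "len t0 \<le> q" "1 \<le> n" and g: "g \<in> carrier G"
    and big: "(5 + 4 * q + 2 * q * K * (1 + 4 * q)) * n \<le> len g + n"
  obtains e :: int where "e \<in> {1, -1}" "\<And>M. conn (outside n) g (g \<otimes> (t0 [^] e) [^] (M::nat)) (M * len t0)"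
proof -
  have uout: "g \<in> outside n"
  proof -
    have "2 * n \<le> (5 + 4 * q + 2 * q * K * (1 + 4 * q)) * n" by (intro mult_right_mono) auto
    then have "n \<le> len g" using big by linarith
    then show ?thesis using g by (simp add: outside_def)
  qed
  \<comment> \<open>A vertex of the walk lies within \<open>q\<close> of some power; if the vertex
    enters the small ball, that power is within \<open>n / 4 + q\<close> of the identity.\<close>
  have one: "\<exists>M. \<not> conn (outside n) g (g \<otimes> (t0 [^] e) [^] (M::nat)) (M * len t0) \<Longrightarrow>
      \<exists>j. 4 * len (g \<otimes> t0 [^] (e * int j)) < n + 4 * q" if e: "e \<in> {1, -1}" for e :: int
  proof (elim exE)
    fix M assume nc: "\<not> conn (outside n) g (g \<otimes> (t0 [^] e) [^] (M::nat)) (M * len t0)"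
    have le: "len (t0 [^] e) = len t0" using e by (auto simp: int_pow_neg)
    have "\<not> (\<forall>j p. j < M \<longrightarrow> p \<in> carrier G \<longrightarrow> len p \<le> len (t0 [^] e) \<longrightarrow> g \<otimes> (t0 [^] e) [^] j \<otimes> p \<in> outside n)"
      using conn_power[of g "t0 [^] e" "outside n" M] nc uout g le by auto
    then obtain j p where j: "p \<in> carrier G" "len p \<le> len t0" "g \<otimes> (t0 [^] e) [^] (j::nat) \<otimes> p \<notin> outside n"
      using le by auto
    have "(t0 [^] e) [^] j = t0 [^] (e * int j)"
      using int_pow_pow[of t0 e "int j"] by (simp add: int_pow_int)
    then have "4 * len (g \<otimes> t0 [^] (e * int j) \<otimes> p) < n"
      using j g by (auto simp: outside_def)
    moreover have "len (g \<otimes> t0 [^] (e * int j)) \<le> len (g \<otimes> t0 [^] (e * int j) \<otimes> p) + len p"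
      using j g by (intro len_mult_ge_left) auto
    ultimately show "\<exists>j. 4 * len (g \<otimes> t0 [^] (e * int j)) < n + 4 * q"
      using j(2) q(1) by (intro exI[of _ j]) linarith
  qed
  show ?thesis
  proof (rule ccontr)
    assume "\<not> thesis"
    then have "\<exists>M. \<not> conn (outside n) g (g \<otimes> (t0 [^] (1::int)) [^] (M::nat)) (M * len t0)"
      "\<exists>M. \<not> conn (outside n) g (g \<otimes> (t0 [^] (-1::int)) [^] (M::nat)) (M * len t0)"
      using that[of 1] that[of "-1"] by blast+
    then obtain i j where i: "4 * len (g \<otimes> t0 [^] (1 * int i)) < n + 4 * q"
      and j: "4 * len (g \<otimes> t0 [^] (-1 * int j)) < n + 4 * q"
      using one[of 1] one[of "-1"] by blast
    let ?a = "g \<otimes> t0 [^] int i" and ?b = "g \<otimes> t0 [^] (- int j)"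
    have ab: "?a \<in> carrier G" "?b \<in> carrier G" using g by auto
    have "inv ?b \<otimes> ?a = t0 [^] (int j) \<otimes> t0 [^] (int i)"
    proof -
      have "inv ?b = t0 [^] int j \<otimes> inv g" using g by (simp add: inv_mult_group int_pow_neg)
      moreover have "inv g \<otimes> ?a = t0 [^] int i" using g by (simp flip: m_assoc)
      ultimately show ?thesis using g by (simp add: m_assoc)
    qed
    then have t: "inv ?b \<otimes> ?a = t0 [^] (int j + int i)" by (simp add: int_pow_mult)
    have "int (j + i) \<le> int (D (t0 [^] (int j + int i)))" using D_t0_pow[of "int j + int i"] by simp
    then have "j + i \<le> D (inv ?b \<otimes> ?a)" unfolding t by linarith
    also have "\<dots> \<le> K * len (inv ?b \<otimes> ?a)" using ab by (intro K(2)) auto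
    also have "\<dots> \<le> K * (len ?b + len ?a)"
      using len_mult[of "inv ?b" ?a] ab by simp
    finally have "2 * (j + i) \<le> K * (2 * (len ?b + len ?a))" by (simp add: algebra_simps)
    also have "\<dots> \<le> K * (n + 4 * q)"
      by (intro mult_left_mono) (use i j in simp_all)
    finally have "2 * (j + i) \<le> K * (n + 4 * q)" .
    moreover have "2 * i \<le> 2 * (j + i)" by simp
    ultimately have 1: "2 * i \<le> K * (n + 4 * q)" by (rule order_trans[rotated])
    have "g = ?a \<otimes> t0 [^] (- int i)" using g by (simp add: m_assoc int_pow_mult[symmetric])
    then have "len g \<le> len ?a + len (t0 [^] (- int i))" using len_mult[of ?a "t0 [^] (- int i)"] ab by simp
    also have "len (t0 [^] (- int i)) \<le> i * len t0"
      using len_pow[of t0 i] by (simp add: int_pow_neg int_pow_int)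
    also have "i * len t0 \<le> i * q" using q by simp
    finally have 2: "4 * len g < n + 4 * q + 4 * (i * q)" using i by simp
    \<comment> \<open>Since \<open>1 \<le> n\<close>, additive constants are absorbed into multiples
      of \<open>n\<close>. This is the origin of the coefficient in \<open>big\<close>.\<close>
    have "4 * (i * q) = 2 * i * (2 * q)" by simp
    also have "\<dots> \<le> K * (n + 4 * q) * (2 * q)" by (intro mult_right_mono 1) simp
    also have "\<dots> \<le> K * (n + 4 * q * n) * (2 * q)"
      using q(2) by (intro mult_right_mono mult_left_mono add_left_mono) auto
    also have "\<dots> = 2 * q * K * (1 + 4 * q) * n" by (simp add: algebra_simps)
    finally have 3: "4 * (i * q) \<le> 2 * q * K * (1 + 4 * q) * n" .
    have 4: "q \<le> q * n" using q(2) by simp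
    have "4 * ((5 + 4 * q + 2 * q * K * (1 + 4 * q)) * n) =
        20 * n + 16 * (q * n) + 4 * (2 * q * K * (1 + 4 * q) * n)" by (simp add: algebra_simps)
    then show False using big 2 3 4 q(2) by linarith
  qed
qed

text \<open>In BV this is the twist at the vertex reached by \<open>k + 1\<close> steps to the
  right; see \<open>shift_pow_conj\<close>.\<close>

definition tau :: "nat \<Rightarrow> 'a" where
  "tau k = y [^] k \<otimes> t1 \<otimes> inv (y [^] k)"

lemma tau_closed [simp]: "tau k \<in> carrier G"
  by (simp add: tau_def)

text \<open>Choosing a common sign \<open>e\<close> for all twists reduces everything to nonnegative powers.\<close>

lemma signed_pow: "(g [^] (e::int)) [^] (j::nat) = g [^] (e * int j)" if "g \<in> carrier G"
  using int_pow_pow[OF that, of e "int j"] by (simp add: int_pow_int)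

lemma len_signed: "e \<in> {1, -1::int} \<Longrightarrow> g \<in> carrier G \<Longrightarrow> len (g [^] e) = len g"
  by (auto simp: int_pow_neg)

lemma signed_D:
  assumes "e \<in> {1, -1::int}" "f \<in> {1, -1::int}" "g \<in> carrier G" "h \<in> carrier G"
    and "\<And>(a::int) (b::int). max \<bar>a\<bar> \<bar>b\<bar> \<le> int (D (g [^] a \<otimes> h [^] b))"
  shows "i \<le> D ((g [^] e) [^] (i::nat) \<otimes> (h [^] f) [^] (j::nat))" "j \<le> D ((g [^] e) [^] i \<otimes> (h [^] f) [^] j)"
proof -
  have "\<bar>e * int i\<bar> = int i" "\<bar>f * int j\<bar> = int j" using assms(1,2) by auto
  then have "max (int i) (int j) \<le> int (D ((g [^] e) [^] i \<otimes> (h [^] f) [^] j))"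
    using assms(5)[of "e * int i" "f * int j"] assms(3,4) by (simp add: signed_pow)
  then show "i \<le> D ((g [^] e) [^] (i::nat) \<otimes> (h [^] f) [^] (j::nat))" "j \<le> D ((g [^] e) [^] i \<otimes> (h [^] f) [^] j)"
    by simp_all
qed

text \<open>The route turns at the product of the two powers: one is built up while the other is
  intact, and then the other is undone. The signs are independent, so two such routes also join
  opposite powers of \<open>t0\<close>.\<close>

lemma conn_base_twists:
  assumes K: "1 \<le> K" "\<And>g. g \<in> carrier G \<Longrightarrow> D g \<le> K * len g"
    and q: "len t0 \<le> q" "len t1 \<le> q" and m: "n + q \<le> m"
    and e: "e \<in> {1, -1::int}" "f \<in> {1, -1::int}"
  shows "conn (outside n) ((t0 [^] e) [^] (K * m)) ((t1 [^] f) [^] (K * m)) (2 * (K * m * q))"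
proof -
  let ?T0 = "t0 [^] e" and ?T1 = "t1 [^] f" and ?M = "K * m"
  have c: "?T0 \<in> carrier G" "?T1 \<in> carrier G" by auto
  have "t0 \<otimes> t1 = t1 \<otimes> t0" using t0_commute[of 0] by simp
  then have "?T1 \<otimes> ?T0 = ?T0 \<otimes> ?T1" by (metis closed(1,2) int_pow_commute)
  then have comm: "?T1 [^] (i::nat) \<otimes> ?T0 [^] (j::nat) = ?T0 [^] j \<otimes> ?T1 [^] i" for i j
    by (rule nat_pow_commute2) auto
  have "max \<bar>a\<bar> \<bar>b\<bar> \<le> int (D (t1 [^] a \<otimes> t0 [^] b))" for a b :: int
    using D_t0[where k = 0 and a = a and b = b] by simp
  note D = signed_D[OF e(2,1) closed(2,1) this]
  have 1: "conn (outside n) (\<one> \<otimes> ?T0 [^] ?M) (\<one> \<otimes> ?T0 [^] ?M \<otimes> ?T1 [^] ?M) (?M * len ?T1)"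
    by (rule conn_power_D[OF K, where m = m])
      (use c q m e D(2) in \<open>auto simp: len_signed comm[symmetric]\<close>)
  have 2: "conn (outside n) (\<one> \<otimes> ?T1 [^] ?M) (\<one> \<otimes> ?T1 [^] ?M \<otimes> ?T0 [^] ?M) (?M * len ?T0)"
    by (rule conn_power_D[OF K, where m = m])
      (use c q m e D(1)[of ?M] in \<open>auto simp: len_signed\<close>)
  have "conn (outside n) (?T0 [^] ?M) (?T1 [^] ?M) (?M * len ?T1 + ?M * len ?T0)"
  proof (rule conn_trans)
    show "conn (outside n) (?T0 [^] ?M) (?T0 [^] ?M \<otimes> ?T1 [^] ?M) (?M * len ?T1)"
      using 1 by (simp only: l_one nat_pow_closed c)
    show "conn (outside n) (?T0 [^] ?M \<otimes> ?T1 [^] ?M) (?T1 [^] ?M) (?M * len ?T0)"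
      using conn_sym[OF 2] by (simp only: l_one nat_pow_closed c comm)
  qed
  moreover have "?M * len ?T1 + ?M * len ?T0 \<le> 2 * (?M * q)"
  proof -
    have "?M * len ?T1 \<le> ?M * q" "?M * len ?T0 \<le> ?M * q"
      using q e by (simp_all only: len_signed closed mult_le_mono2)
    then show ?thesis by linarith
  qed
  ultimately show ?thesis by (rule conn_mono)
qed

text \<open>The path visits \<open>g\<close>, \<open>g T0\<^sup>M\<close>, \<open>g T0\<^sup>M c\<^sup>M = g c\<^sup>M T0\<^sup>M\<close>, \<open>g c\<^sup>M\<close>, \<open>g c\<^sup>M g\<inverse> = v\<^sup>M\<close>,
  \<open>v\<^sup>M S\<^sup>M = S\<^sup>M v\<^sup>M\<close>, \<open>S\<^sup>M\<close> and \<open>t0\<^sup>M\<close>.  At every moment some power with exponent \<open>M\<close> is intact, which keeps the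
  path far from the identity.\<close>

lemma conn_to_base_twist:
  assumes K: "1 \<le> K" "\<And>g. g \<in> carrier G \<Longrightarrow> D g \<le> K * len g"
    and q: "len t0 \<le> q" "len t1 \<le> q" and g: "g \<in> carrier G" and n: "1 \<le> n"
    and big: "(5 + 4 * q + 2 * q * K * (1 + 4 * q)) * n \<le> len g + n"
    and s: "s \<in> {t0, t1}" "s \<otimes> (g \<otimes> tau k \<otimes> inv g) = g \<otimes> tau k \<otimes> inv g \<otimes> s"
      "\<And>(a::int) (b::int). max \<bar>a\<bar> \<bar>b\<bar> \<le> int (D ((g \<otimes> tau k \<otimes> inv g) [^] a \<otimes> s [^] b))"
    and m: "n + 3 * len g + 2 * (k * len y) + q \<le> m"
  shows "conn (outside n) g (t0 [^] (K * m)) (10 * (K * m * q) + 3 * len g + 4 * (k * len y))"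
proof -
  let ?M = "K * m" and ?x = "y [^] k"
  obtain e :: int where e: "e \<in> {1, -1}"
    and c1: "\<And>M. conn (outside n) g (g \<otimes> (t0 [^] e) [^] (M::nat)) (M * len t0)"
    using escape_t0[OF K q(1) n g big] by blast
  define T0 T1 c S v where "T0 = t0 [^] e" and "T1 = t1 [^] e" and "c = tau k [^] e" and "S = s [^] e"
    and "v = (g \<otimes> tau k \<otimes> inv g) [^] e"
  have sc: "s \<in> carrier G" using s(1) by auto
  have cl: "T0 \<in> carrier G" "T1 \<in> carrier G" "c \<in> carrier G" "S \<in> carrier G" "v \<in> carrier G" "?x \<in> carrier G"
    using g sc by (auto simp: T0_def T1_def c_def S_def v_def)
  have ceq: "?x \<otimes> T1 \<otimes> inv ?x = c"
    unfolding c_def T1_def tau_def by (rule conj_int_pow[symmetric]) auto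
  have veq: "g \<otimes> c \<otimes> inv g = v"
    unfolding c_def v_def by (rule conj_int_pow[symmetric]) (use g in auto)
  \<comment> \<open>The last twist is also a conjugate of \<open>T1\<close>, by an element of linear
    length, so its power can be walked and undone with \<open>conn_conj_power\<close>.\<close>
  have veq': "(g \<otimes> ?x) \<otimes> T1 \<otimes> inv (g \<otimes> ?x) = v"
    unfolding veq[symmetric] ceq[symmetric] using g cl by (simp add: m_assoc inv_mult_group)
  have lens: "len T0 \<le> q" "len T1 \<le> q" "len S \<le> q"
    using e q s(1) sc by (auto simp: T0_def T1_def S_def len_signed)
  have lenx: "len ?x \<le> k * len y" by (rule len_pow) simp
  have lengx: "len (g \<otimes> ?x) \<le> len g + k * len y" using len_mult[OF g cl(6)] lenx by simp
  have "t0 \<otimes> tau k = tau k \<otimes> t0" using t0_commute[of k] by (simp add: tau_def)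
  then have "c \<otimes> T0 = T0 \<otimes> c" unfolding c_def T0_def by (metis closed(1) tau_closed int_pow_commute)
  then have comm: "c [^] (i::nat) \<otimes> T0 [^] (j::nat) = T0 [^] j \<otimes> c [^] i" for i j
    by (rule nat_pow_commute2) (use cl in auto)
  have "v \<otimes> S = S \<otimes> v" unfolding v_def S_def
    by (rule int_pow_commute) (use g sc s(2) in auto)
  then have comm': "v [^] (i::nat) \<otimes> S [^] (j::nat) = S [^] j \<otimes> v [^] i" for i j
    by (rule nat_pow_commute2) (use cl in auto)
  have D1: "i \<le> D (c [^] i \<otimes> T0 [^] j)" "j \<le> D (c [^] i \<otimes> T0 [^] j)" for i j :: nat
    unfolding c_def T0_def
    by (rule signed_D[OF e e tau_closed closed(1) D_t0[of _ _ k, folded tau_def]])+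
  have D2: "i \<le> D (v [^] i \<otimes> S [^] j)" "j \<le> D (v [^] i \<otimes> S [^] j)" for i j :: nat
    unfolding v_def S_def by (rule signed_D[OF e e _ sc s(3)]; use g in simp)+
  have 1: "conn (outside n) g (g \<otimes> T0 [^] ?M) (?M * len T0)"
    using c1[of ?M] e by (simp add: T0_def len_signed)
  have 2: "conn (outside n) (g \<otimes> T0 [^] ?M) (g \<otimes> T0 [^] ?M \<otimes> c [^] ?M) (2 * len ?x + ?M * len T1)"
    unfolding ceq[symmetric]
    by (rule conn_conj_power[OF K, where m = m])
      (use g cl lens lenx m D1(2) comm in \<open>auto simp: ceq\<close>)
  have 3: "conn (outside n) (g \<otimes> c [^] ?M) (g \<otimes> c [^] ?M \<otimes> T0 [^] ?M) (?M * len T0)"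
    by (rule conn_power_D[OF K, where m = m]) (use g cl lens m D1(1)[of ?M] in auto)
  have eq3: "g \<otimes> c [^] ?M \<otimes> T0 [^] ?M = g \<otimes> T0 [^] ?M \<otimes> c [^] ?M"
    using comm[of ?M ?M] g cl by (simp add: m_assoc)
  have 4: "conn (outside n) (g \<otimes> c [^] ?M) (g \<otimes> c [^] ?M \<otimes> inv g) (len (inv g))"
  proof (rule conn_geodesic)
    fix p s' assume p: "p \<in> carrier G" "len p + len s' = len (inv g)"
    have "K * m \<le> D (c [^] ?M)" using D1(1)[of ?M 0] cl by simp
    then show "g \<otimes> c [^] ?M \<otimes> p \<in> outside n"
      by (intro outside_if_D[OF K]) (use g cl p m in auto)
  qed (use g cl in auto)
  have eq4: "g \<otimes> c [^] ?M \<otimes> inv g = v [^] ?M"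
    using conj_pow[OF g cl(3), of ?M] veq by simp
  have 5: "conn (outside n) (\<one> \<otimes> v [^] ?M) (\<one> \<otimes> v [^] ?M \<otimes> S [^] ?M) (?M * len S)"
    by (rule conn_power_D[OF K, where m = m]) (use cl lens m D2(1)[of ?M] in auto)
  have 6: "conn (outside n) (\<one> \<otimes> S [^] ?M) (\<one> \<otimes> S [^] ?M \<otimes> v [^] ?M) (2 * len (g \<otimes> ?x) + ?M * len T1)"
    unfolding veq'[symmetric]
    by (rule conn_conj_power[OF K, where m = m])
      (use g cl lens lengx m D2(2) comm' in \<open>auto simp: veq'\<close>)
  have 7: "conn (outside n) (S [^] ?M) (t0 [^] ?M) (4 * (?M * q))"
  proof -
    have nq: "n + q \<le> m" using m by linarith
    have b: "conn (outside n) ((t0 [^] e) [^] ?M) ((t1 [^] f) [^] ?M) (2 * (?M * q))"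
      if "e \<in> {1, -1}" "f \<in> {1, -1}" for e f :: int
      by (rule conn_base_twists[OF K(1) _ q nq that]) (rule K(2))
    have one: "(1::int) \<in> {1, -1}" by simp
    have p1: "t0 [^] (1::int) = t0" "t1 [^] (1::int) = t1" by simp_all
    show ?thesis
    proof (cases "s = t0")
      case True
      \<comment> \<open>When \<open>e\<close> is negative, the sign is corrected by a detour through
        a power of \<open>t1\<close>.\<close>
      have "conn (outside n) (T0 [^] ?M) (t0 [^] ?M) (2 * (?M * q) + 2 * (?M * q))"
        using conn_trans[OF b[OF e one] conn_sym[OF b[OF one one]]] by (simp only: p1 T0_def)
      then have "conn (outside n) (T0 [^] ?M) (t0 [^] ?M) (4 * (?M * q))" by (rule conn_mono) linarith
      then show ?thesis using True by (simp only: S_def T0_def)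
    next
      case False
      then have "S = T1" using s(1) by (auto simp: S_def T1_def)
      moreover have "conn (outside n) (T1 [^] ?M) (t0 [^] ?M) (2 * (?M * q))"
        using conn_sym[OF b[OF one e]] by (simp only: p1 T1_def)
      ultimately show ?thesis by (simp add: conn_mono)
    qed
  qed
  have 5: "conn (outside n) (v [^] ?M) (S [^] ?M \<otimes> v [^] ?M) (?M * len S)"
    using 5 by (simp only: l_one nat_pow_closed cl comm')
  have 6: "conn (outside n) (S [^] ?M \<otimes> v [^] ?M) (S [^] ?M) (2 * len (g \<otimes> ?x) + ?M * len T1)"
    using conn_sym[OF 6] by (simp only: l_one nat_pow_closed cl)
  have "conn (outside n) g (t0 [^] ?M)
     (?M * len T0 + (2 * len ?x + ?M * len T1) + ?M * len T0 + len (inv g) + ?M * len S + (2 * len (g \<otimes> ?x) + ?M * len T1)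
       + 4 * (?M * q))"
    using conn_trans[OF conn_trans[OF conn_trans[OF conn_trans[OF conn_trans[OF conn_trans[OF 1 2]
      conn_sym[OF 3[unfolded eq3]]] 4[unfolded eq4]] 5] 6] 7] .
  then show ?thesis
  proof (rule conn_mono)
    have "?M * len T0 \<le> ?M * q" "?M * len T1 \<le> ?M * q" "?M * len S \<le> ?M * q"
      using lens by (simp_all add: mult_le_mono2)
    moreover have "len (inv g) = len g" using g by simp
    ultimately show "?M * len T0 + (2 * len ?x + ?M * len T1) + ?M * len T0 + len (inv g) + ?M * len S +
        (2 * len (g \<otimes> ?x) + ?M * len T1) + 4 * (?M * q) \<le> 10 * (?M * q) + 3 * len g + 4 * (k * len y)"
      using lenx lengx by linarith
  qed
qed

text \<open>The end point \<open>t0 [^] (K * (B * n))\<close> depends on \<open>n\<close> alone, so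
  paths from \<open>u\<close> and \<open>v\<close> meet there.\<close>

lemma linear_connection:
  obtains E where "\<And>n u v. \<lbrakk>1 \<le> n; u \<in> carrier G; v \<in> carrier G; len u = n; len v = n\<rbrakk>
    \<Longrightarrow> conn (outside n) u v (E * n)"
proof -
  obtain K :: nat where K: "1 \<le> K" "\<And>g. g \<in> carrier G \<Longrightarrow> D g \<le> K * len g"
    using D_le_len by blast
  obtain C where C: "\<And>g k. \<lbrakk>g \<in> carrier G; C * len g \<le> k\<rbrakk> \<Longrightarrow> \<exists>s\<in>{t0, t1}.
      s \<otimes> (g \<otimes> tau k \<otimes> inv g) = g \<otimes> tau k \<otimes> inv g \<otimes> s \<and>
      (\<forall>(a::int) (b::int). max \<bar>a\<bar> \<bar>b\<bar> \<le> int (D ((g \<otimes> tau k \<otimes> inv g) [^] a \<otimes> s [^] b)))"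
    using conj_ex unfolding tau_def by blast
  define q where "q = len t0 + len t1"
  \<comment> \<open>\<open>K1\<close> is the threshold of \<open>escape_t0\<close>,
    \<open>R * n\<close> bounds the length after walking away from the identity,
    \<open>B * n\<close> is the value of \<open>m\<close> that meets the demands of
    \<open>conn_to_base_twist\<close>, and \<open>E\<close> adds up the lengths.\<close>
  define K1 where "K1 = 5 + 4 * q + 2 * q * K * (1 + 4 * q)"
  define R where "R = Suc K1"
  define B where "B = 1 + 3 * R + 2 * (C * R * len y) + q"
  define E where "E = K1 + 10 * (K * B * q) + 3 * R + 4 * (C * R * len y)"
  have main: "conn (outside n) u (t0 [^] (K * (B * n))) (E * n)"
    if n: "1 \<le> n" and u: "u \<in> carrier G" "len u = n" for n u
  proof -
    obtain w where w: "w \<in> carrier G" "len w = K1 * n" "conn (outside n) u (u \<otimes> w) (K1 * n)"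
      using escape_far[OF u] by blast
    let ?g = "u \<otimes> w"
    have g: "?g \<in> carrier G" using u w by simp
    have up: "len ?g \<le> R * n" using len_mult[OF u(1) w(1)] u(2) w(2) by (simp add: R_def)
    have low: "K1 * n \<le> len ?g + n" using len_mult_ge_right[OF u(1) w(1)] u(2) w(2) by simp
    \<comment> \<open>The smallest exponent that \<open>C\<close> admits; being linear in
      \<open>n\<close>, it keeps the conjugator \<open>y [^] ?k\<close> linearly long.\<close>
    let ?k = "C * len ?g"
    obtain s where s: "s \<in> {t0, t1}" "s \<otimes> (?g \<otimes> tau ?k \<otimes> inv ?g) = ?g \<otimes> tau ?k \<otimes> inv ?g \<otimes> s"
      "\<And>(a::int) (b::int). max \<bar>a\<bar> \<bar>b\<bar> \<le> int (D ((?g \<otimes> tau ?k \<otimes> inv ?g) [^] a \<otimes> s [^] b))"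
      using C[OF g order_refl] by blast
    have ky: "?k * len y \<le> C * R * len y * n"
      using mult_le_mono1[OF mult_le_mono2[OF up, of C], of "len y"] by (simp add: mult_ac)
    have m: "n + 3 * len ?g + 2 * (?k * len y) + q \<le> B * n"
    proof -
      have "q \<le> q * n" using n by simp
      moreover have "B * n = n + 3 * (R * n) + 2 * (C * R * len y * n) + q * n"
        by (simp add: B_def algebra_simps)
      ultimately show ?thesis using up ky by linarith
    qed
    have "conn (outside n) ?g (t0 [^] (K * (B * n))) (10 * (K * (B * n) * q) + 3 * len ?g + 4 * (?k * len y))"
      by (rule conn_to_base_twist[OF K _ _ g n _ s m]) (use low in \<open>simp_all add: q_def K1_def\<close>)
    from conn_trans[OF w(3) this] show ?thesis
    proof (rule conn_mono)
      have "E * n = K1 * n + 10 * (K * (B * n) * q) + 3 * (R * n) + 4 * (C * R * len y * n)"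
        by (simp add: E_def algebra_simps)
      then show "K1 * n + (10 * (K * (B * n) * q) + 3 * len ?g + 4 * (?k * len y)) \<le> E * n"
        using up ky by linarith
    qed
  qed
  show ?thesis
  proof (rule that[of "2 * E"])
    fix n u v assume *: "1 \<le> n" "u \<in> carrier G" "v \<in> carrier G" "len u = n" "len v = n"
    from conn_trans[OF main[OF *(1,2,4)] conn_sym[OF main[OF *(1,3,5)]]]
    show "conn (outside n) u v (2 * E * n)" by (rule conn_mono) simp
  qed
qed

theorem divergence_equiv_linear: "div_equiv (divergence G X (1 / 4)) (\<lambda>x. ennreal (1 * x))"
proof -
  obtain E where E: "\<And>n u v. \<lbrakk>1 \<le> n; u \<in> carrier G; v \<in> carrier G; len u = n; len v = n\<rbrakk>
    \<Longrightarrow> conn (outside n) u v (E * n)" using linear_connection by blast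
  have bound: "divergence G X (1 / 4) x \<le> ennreal (real E * x + 1)" if x: "0 \<le> x" for x
  proof -
    \<comment> \<open>For non-integral \<open>x\<close> no vertex has distance \<open>x\<close> and
      the condition is vacuous; otherwise \<open>n\<close> is \<open>x\<close> itself.\<close>
    define n where "n = nat \<lfloor>x\<rfloor>"
    have "\<exists>vs. cayley_path G X u vs v \<and> path_length vs < E * n + 1 \<and>
        (\<forall>w\<in>set vs. \<not> real (len w) < 1 / 4 * x)"
      if uv: "u \<in> carrier G" "v \<in> carrier G" "real (len u) = x" "real (len v) = x" for u v
    proof -
      have xn: "x = real n" "len u = n" "len v = n" using uv(3,4) by (auto simp: n_def)
      have "conn (outside n) u v (E * n)"
      proof (cases "n = 0")
        case True
        have "g = \<one>" if g: "g \<in> carrier G" "len g = 0" for g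
        proof -
          obtain ws where "set ws \<subseteq> letters" "word_prod ws = g" "length ws = len g" using geodesic_word[OF g(1)] .
          then show ?thesis using g(2) by simp
        qed
        then have "u = \<one>" "v = \<one>" using uv xn True by auto
        then show ?thesis using conn_refl[of \<one> "outside n"] True by (simp add: outside_def)
      next
        case False
        then show ?thesis using E[of n u v] uv xn by simp
      qed
      then obtain vs where vs: "cayley_path G X u vs v" "path_length vs \<le> E * n" "set vs \<subseteq> outside n"
        by (auto simp: conn_def)
      have "\<not> real (len w) < 1 / 4 * x" if "w \<in> set vs" for w
      proof -
        have "n \<le> 4 * len w" using vs(3) that by (auto simp: outside_def)
        then have "real n \<le> real (4 * len w)" by (simp only: of_nat_le_iff)
        then show ?thesis using xn(1) by simp
      qed
      then show ?thesis using vs by (intro exI[of _ vs]) auto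
    qed
    then have "divergence G X (1 / 4) x \<le> of_nat (E * n + 1)"
      unfolding divergence_def by (intro Inf_lower) blast
    also have "\<dots> = ennreal (real (E * n + 1))" by (simp only: ennreal_of_nat_eq_real_of_nat)
    also have "\<dots> \<le> ennreal (real E * x + 1)"
    proof (rule ennreal_leI)
      have "real n \<le> x" using x by (simp add: n_def)
      then have "real E * real n \<le> real E * x" by (intro mult_left_mono) auto
      then show "real (E * n + 1) \<le> real E * x + 1" by simp
    qed
    finally show ?thesis .
  qed
  have "div_le (divergence G X (1 / 4)) (\<lambda>x. ennreal (1 * x))"
    unfolding div_le_def
    by (rule exI[of _ 0], rule exI[of _ 0], rule exI[of _ 0], rule exI[of _ "real E"], rule exI[of _ 1])
      (use bound in auto)
  moreover have "div_le (\<lambda>x. ennreal (1 * x)) (divergence G X (1 / 4))"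
    unfolding div_le_def
    by (rule exI[of _ 0], rule exI[of _ 0], rule exI[of _ 0], rule exI[of _ 1], rule exI[of _ 0]) auto
  ultimately show ?thesis by (simp add: div_equiv_def)
qed

end


section \<open>Twists in BV: their powers, addresses, defect and conjugates\<close>

section \<open>Twists at a leaf\<close>

interpretation BV: group BV by (rule group_BV)

fun lvine :: "btree \<Rightarrow> nat \<Rightarrow> nat \<Rightarrow> btree" where
  "lvine T j 0 = T"
| "lvine T j (Suc k) = add_caret (lvine T j k) j"

text \<open>After \<open>k\<close> carets the last leaf of the vine has number \<open>j + k\<close>,
  and the next caret goes there.\<close>

fun rvine :: "btree \<Rightarrow> nat \<Rightarrow> nat \<Rightarrow> btree" where
  "rvine T j 0 = T"
| "rvine T j (Suc k) = add_caret (rvine T j k) (j + k)"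

text \<open>A left vine for \<open>z \<ge> 0\<close> and a right vine for negative \<open>z\<close>,
  each with \<open>\<bar>z\<bar> + 1\<close> carets. Then the trees for \<open>z\<close> and
  \<open>- z\<close> form the diagram of the power \<open>z\<close> of the twist, whatever the
  sign.\<close>

definition vine :: "btree \<Rightarrow> nat \<Rightarrow> int \<Rightarrow> btree" where
  "vine T j z = (if z \<ge> 0 then lvine T j (Suc (nat z)) else rvine T j (Suc (nat (- z))))"

text \<open>The standard generator of Thompson's group F, acting below leaf \<open>j\<close> of \<open>T\<close>.\<close>

definition twist :: "btree \<Rightarrow> nat \<Rightarrow> diagram set" where
  "twist T j = F_elt (lvine T j 2) (rvine T j 2)"

lemma carets_lvine [simp]: "carets (lvine T j k) = carets T + k"
  and carets_rvine [simp]: "carets (rvine T j k) = carets T + k"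
  by (induction k) simp_all

lemma carets_vine [simp]: "carets (vine T j z) = carets T + Suc (nat \<bar>z\<bar>)"
  by (simp add: vine_def)

lemma twist_closed [simp]: "twist T j \<in> carrier BV"
  by (simp add: twist_def F_elt_closed)

lemma F_elt_inv: "carets S = carets T \<Longrightarrow> inv\<^bsub>BV\<^esub> (F_elt S T) = F_elt T S"
  by (rule BV.inv_equality) (simp_all add: F_elt_mult F_elt_self F_elt_closed)

lemma F_elt_lvine:
  "carets S = carets T \<Longrightarrow> j < leaves S \<Longrightarrow> F_elt (lvine S j k) (lvine T j k) = F_elt S T"
  by (induction k) (simp_all add: F_elt_add_caret)

lemma F_elt_rvine:
  "carets S = carets T \<Longrightarrow> j < leaves S \<Longrightarrow> F_elt (rvine S j k) (rvine T j k) = F_elt S T"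
  by (induction k) (simp_all add: F_elt_add_caret)

lemma F_elt_vine:
  "carets S = carets T \<Longrightarrow> j < leaves S \<Longrightarrow> F_elt (vine S j z) (vine T j z) = F_elt S T"
  by (simp add: vine_def F_elt_lvine F_elt_rvine del: lvine.simps rvine.simps)

lemma twist_pow_nat:
  assumes "j < leaves T"
  shows "twist T j [^]\<^bsub>BV\<^esub> (a::nat) = F_elt (lvine T j (Suc a)) (rvine T j (Suc a))"
proof (induction a)
  case 0
  then show ?case by (simp add: F_elt_self)
next
  case (Suc a)
  \<comment> \<open>Expanding the diagram of the twist repeatedly at its last leaf lengthens both
    right vines. In this form its head matches the tail of the power \<open>a\<close>, expanded once
    at leaf \<open>j\<close>.\<close>
  have *: "F_elt (add_caret (rvine T j (Suc k)) j) (rvine T j (Suc (Suc k))) = twist T j" for k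
  proof (induction k)
    case 0
    then show ?case by (simp add: twist_def numeral_2_eq_2)
  next
    case (Suc k)
    have "add_caret (rvine T j (Suc (Suc k))) j = add_caret (add_caret (rvine T j (Suc k)) j) (Suc (Suc (j + k)))"
      using assms add_caret_commute[of j "Suc (j + k)" "rvine T j (Suc k)"] by simp
    then have "F_elt (add_caret (rvine T j (Suc (Suc k))) j) (rvine T j (Suc (Suc (Suc k)))) =
        F_elt (add_caret (add_caret (rvine T j (Suc k)) j) (Suc (Suc (j + k))))
          (add_caret (rvine T j (Suc (Suc k))) (Suc (Suc (j + k))))"
      by simp
    also have "\<dots> = F_elt (add_caret (rvine T j (Suc k)) j) (rvine T j (Suc (Suc k)))"
      by (rule F_elt_add_caret) (use assms in simp_all)
    finally show ?case using Suc.IH by simp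
  qed
  have "twist T j [^]\<^bsub>BV\<^esub> (Suc a) = F_elt (lvine T j (Suc a)) (rvine T j (Suc a)) \<otimes>\<^bsub>BV\<^esub> twist T j"
    using Suc.IH by simp
  also have "F_elt (lvine T j (Suc a)) (rvine T j (Suc a)) =
      F_elt (lvine T j (Suc (Suc a))) (add_caret (rvine T j (Suc a)) j)"
    using F_elt_add_caret[of "lvine T j (Suc a)" "rvine T j (Suc a)" j] assms by simp
  also have "\<dots> \<otimes>\<^bsub>BV\<^esub> twist T j = F_elt (lvine T j (Suc (Suc a))) (rvine T j (Suc (Suc a)))"
    unfolding *[of a, symmetric] by (rule F_elt_mult) simp_all
  finally show ?case .
qed

lemma twist_pow:
  assumes "j < leaves T"
  shows "twist T j [^]\<^bsub>BV\<^esub> (z::int) = F_elt (vine T j z) (vine T j (- z))"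
proof -
  consider "z > 0" | "z = 0" | "z < 0" by linarith
  then show ?thesis
  proof cases
    case 1
    then show ?thesis
      unfolding int_pow_def2 twist_pow_nat[OF assms] by (simp add: vine_def del: lvine.simps rvine.simps)
  next
    case 2
    then show ?thesis by (simp add: F_elt_self)
  next
    case 3
    then show ?thesis
      unfolding int_pow_def2 twist_pow_nat[OF assms]
      by (simp add: vine_def F_elt_inv del: lvine.simps rvine.simps)
  qed
qed

lemma vine_add_caret_left:
  assumes "i < j" "j < leaves T"
  shows "vine (add_caret T i) (Suc j) z = add_caret (vine T j z) i"
proof -
  have "lvine (add_caret T i) (Suc j) k = add_caret (lvine T j k) i" for k
    using assms by (induction k) (simp_all add: add_caret_commute)
  moreover have "rvine (add_caret T i) (Suc j) k = add_caret (rvine T j k) i" for k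
    using assms by (induction k) (simp_all add: add_caret_commute)
  ultimately show ?thesis by (simp add: vine_def del: lvine.simps rvine.simps)
qed

lemma vine_add_caret_right:
  assumes "j < i" "i < leaves T"
  shows "vine (add_caret T i) j z = add_caret (vine T j z) (i + Suc (nat \<bar>z\<bar>))"
proof -
  have "lvine (add_caret T i) j k = add_caret (lvine T j k) (i + k)" for k
    using assms add_caret_commute[of j "i + k" "lvine T j k" for k] by (induction k) simp_all
  moreover have "rvine (add_caret T i) j k = add_caret (rvine T j k) (i + k)" for k
    using assms add_caret_commute[of "j + k" "i + k" "rvine T j k" for k] by (induction k) simp_all
  ultimately show ?thesis by (simp add: vine_def del: lvine.simps rvine.simps)
qed

lemma twist_eq_vine: "j < leaves T \<Longrightarrow> twist T j = F_elt (vine T j 1) (vine T j (- 1))"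
  using twist_pow[of j T 1] by (simp add: BV.int_pow_1)

lemma twist_add_caret:
  assumes "i \<noteq> j" "i < leaves T" "j < leaves T"
  shows "twist (add_caret T i) (if i < j then Suc j else j) = twist T j"
proof (cases "i < j")
  case True
  then show ?thesis
    using assms by (simp add: twist_eq_vine vine_add_caret_left F_elt_add_caret)
next
  case False
  then show ?thesis
    using assms by (simp add: twist_eq_vine vine_add_caret_right F_elt_add_caret)
qed

lemma twist_vine:
  assumes "i < j" "j < leaves T"
  shows "twist (vine T j z) i = twist T i"
proof -
  have "twist (lvine T j k) i = twist T i" for k
    using assms by (induction k) (use twist_add_caret[of j i "lvine T j k" for k] in auto)
  moreover have "twist (rvine T j k) i = twist T i" for k
    using assms by (induction k) (use twist_add_caret[of "j + k" i "rvine T j k" for k] in auto)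
  ultimately show ?thesis by (simp add: vine_def del: lvine.simps rvine.simps)
qed

text \<open>A common middle tree is found by reading the twist at \<open>i\<close> in the tree
  enlarged below \<open>j\<close>, and by expanding the diagram of the power at \<open>j\<close>
  below leaf \<open>i\<close>.\<close>

lemma twist_pow_mult:
  assumes "i < j" "j < leaves T"
  shows "twist T i [^]\<^bsub>BV\<^esub> (a::int) \<otimes>\<^bsub>BV\<^esub> twist T j [^]\<^bsub>BV\<^esub> (b::int) =
    F_elt (vine (vine T j b) i a) (vine (vine T j (- b)) i (- a))"
proof -
  have "twist T i [^]\<^bsub>BV\<^esub> a = F_elt (vine (vine T j b) i a) (vine (vine T j b) i (- a))"
    unfolding twist_vine[OF assms, of b, symmetric] by (rule twist_pow) (use assms in simp)
  moreover have "twist T j [^]\<^bsub>BV\<^esub> b = F_elt (vine (vine T j b) i (- a)) (vine (vine T j (- b)) i (- a))"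
    unfolding twist_pow[OF assms(2)] by (rule F_elt_vine[symmetric]) (use assms in simp_all)
  ultimately show ?thesis by (simp add: F_elt_mult)
qed

text \<open>Split strand \<open>i\<close> into three parallel strands. By
  \<open>split_braid_commute\<close> the braid is the same whether the trees grow by left vines or
  by right vines, so a twist on either side changes only one tree and both products have the same
  diagram.\<close>

lemma twist_conj:
  assumes d: "(S, \<beta>, T) \<in> diagrams" and i: "i < leaves S"
  shows "diagram_class (S, \<beta>, T) \<otimes>\<^bsub>BV\<^esub> twist T (braid_perm \<beta> i) = twist S i \<otimes>\<^bsub>BV\<^esub> diagram_class (S, \<beta>, T)"
proof -
  let ?n = "leaves S" and ?j = "braid_perm \<beta> i"
  have \<beta>: "carets T = carets S" "\<beta> \<in> carrier (braid_group ?n)" using diagramsD[OF d] by auto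
  have j: "?j < leaves T" using braid_perm_less[OF \<beta>(2) i] \<beta>(1) by simp
  let ?b = "split_braid ?n i \<beta>"
  have b: "?b \<in> carrier (braid_group (Suc ?n))" by (rule split_braid_closed[OF \<beta>(2) i])
  have p: "braid_perm ?b i = ?j" "braid_perm ?b (Suc i) = Suc ?j"
    using braid_perm_split[OF \<beta>(2) i, of i] braid_perm_split[OF \<beta>(2) i, of "Suc i"] i
    by (simp_all add: split_perm_def)
  let ?d = "(add_caret S i, ?b, add_caret T ?j)"
  have d1: "?d = split_diagram i (S, \<beta>, T)" by (simp add: split_diagram_def)
  have d1': "?d \<in> diagrams" unfolding d1 by (rule split_diagram_closed[OF d]) (use i in simp)
  let ?B = "split_braid (Suc ?n) i ?b"
  have B: "split_braid (Suc ?n) (Suc i) ?b = ?B" by (rule split_braid_commute[OF \<beta>(2) order_refl i])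
  have l: "split_diagram i ?d = (lvine S i 2, ?B, lvine T ?j 2)"
    using p by (simp add: split_diagram_def numeral_2_eq_2)
  have r: "split_diagram (Suc i) ?d = (rvine S i 2, ?B, rvine T ?j 2)"
    using p B by (simp add: split_diagram_def numeral_2_eq_2)
  have x: "diagram_class ?d = diagram_class (S, \<beta>, T)"
    unfolding d1 by (rule diagram_class_split[OF d]) (use i in simp)
  have xl: "diagram_class (lvine S i 2, ?B, lvine T ?j 2) = diagram_class (S, \<beta>, T)"
    unfolding l[symmetric] x[symmetric] by (rule diagram_class_split[OF d1']) (use i in simp)
  have xr: "diagram_class (rvine S i 2, ?B, rvine T ?j 2) = diagram_class (S, \<beta>, T)"
    unfolding r[symmetric] x[symmetric] by (rule diagram_class_split[OF d1']) (use i in simp)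
  have inl: "(lvine S i 2, ?B, lvine T ?j 2) \<in> diagrams"
    unfolding l[symmetric] by (rule split_diagram_closed[OF d1']) (use i in simp)
  have inr: "(rvine S i 2, ?B, rvine T ?j 2) \<in> diagrams"
    unfolding r[symmetric] by (rule split_diagram_closed[OF d1']) (use i in simp)
  have oT: "(lvine T ?j 2, \<one>\<^bsub>braid_group (leaves (lvine T ?j 2))\<^esub>, rvine T ?j 2) \<in> diagrams"
    and oS: "(lvine S i 2, \<one>\<^bsub>braid_group (leaves (lvine S i 2))\<^esub>, rvine S i 2) \<in> diagrams"
    by (rule one_diagram, simp)+
  have BB: "?B \<in> carrier (braid_group (leaves (lvine S i 2)))" using diagramsD[OF inl] by blast
  have L: "leaves (lvine T ?j 2) = leaves (lvine S i 2)" "leaves (rvine S i 2) = leaves (lvine S i 2)"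
    using \<beta>(1) by simp_all
  interpret B: group "braid_group (leaves (lvine S i 2))" by (rule group_braid_group)
  have "diagram_class (S, \<beta>, T) \<otimes>\<^bsub>BV\<^esub> twist T ?j = diagram_class (lvine S i 2, ?B, rvine T ?j 2)"
    unfolding xl[symmetric] twist_def F_elt_def BV_mult[OF inl oT]
    unfolding L using BB by (simp del: carets_lvine)
  also have "\<dots> = twist S i \<otimes>\<^bsub>BV\<^esub> diagram_class (S, \<beta>, T)"
    unfolding xr[symmetric] twist_def F_elt_def BV_mult[OF oS inr]
    unfolding L using BB by (simp del: carets_lvine)
  finally show ?thesis .
qed

text \<open>An instance of \<open>twist_conj\<close>: the diagram of the twist at \<open>j\<close>
  has trivial braid and sends leaf \<open>i\<close>, which lies to the left of the vines, to leaf
  \<open>i\<close>.\<close>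

lemma twist_commute:
  assumes "i \<noteq> j" "i < leaves T" "j < leaves T"
  shows "twist T i \<otimes>\<^bsub>BV\<^esub> twist T j = twist T j \<otimes>\<^bsub>BV\<^esub> twist T i"
proof -
  have *: "twist T i \<otimes>\<^bsub>BV\<^esub> twist T j = twist T j \<otimes>\<^bsub>BV\<^esub> twist T i" if "i < j" "j < leaves T" for i j
  proof -
    let ?S = "vine T j 1" and ?T = "vine T j (- 1)"
    have x: "twist T j = diagram_class (?S, \<one>\<^bsub>braid_group (leaves ?S)\<^esub>, ?T)"
      using twist_eq_vine[OF that(2)] by (simp add: F_elt_def)
    have d: "(?S, \<one>\<^bsub>braid_group (leaves ?S)\<^esub>, ?T) \<in> diagrams" by (rule one_diagram) simp
    have i: "i < leaves ?S" using that by simp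
    have "twist T j \<otimes>\<^bsub>BV\<^esub> twist ?T i = twist ?S i \<otimes>\<^bsub>BV\<^esub> twist T j"
      using twist_conj[OF d i] unfolding braid_perm_one[OF i] x .
    then show ?thesis by (simp only: twist_vine[OF that])
  qed
  show ?thesis using *[of i j] *[of j i] assms by (cases "i < j") auto
qed


section \<open>Twists at an address\<close>

lemma twist_in_larger_tree:
  assumes "nodes S \<subseteq> nodes U" "i < leaves S" "addr S i \<notin> nodes U"
  shows "\<exists>k<leaves U. addr U k = addr S i \<and> twist U k = twist S i"
  using assms
proof (induction arbitrary: i rule: tree_growth_induct)
  case refl
  then show ?case by blast
next
  case (step S i')
  then have ne: "i' \<noteq> i" by auto
  let ?k = "if i' < i then Suc i else i"
  have k: "?k < leaves (add_caret S i')" using step.prems by simp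
  have a: "addr (add_caret S i') ?k = addr S i"
    using addr_add_caret[OF step.hyps(2), of ?k] step.prems ne by auto
  have t: "twist (add_caret S i') ?k = twist S i"
    by (rule twist_add_caret) (use ne step in auto)
  show ?case using step.IH[OF k] a t step.prems(2) by simp
qed

text \<open>The address is interior in neither tree, so their common refinement still has a leaf
  there, and both twists are equal to the twist at that leaf.\<close>

lemma twist_eq_if_addr_eq:
  assumes "i < leaves S" "j < leaves T" "addr S i = addr T j"
  shows "twist S i = twist T j"
proof -
  obtain U where U: "nodes U = nodes S \<union> nodes T" using nodes_join by blast
  have "addr S i \<notin> nodes U" using U addr_not_in_nodes assms(3) by (metis UnE)
  then obtain k l where "k < leaves U" "addr U k = addr S i" "twist U k = twist S i"
    "l < leaves U" "addr U l = addr T j" "twist U l = twist T j"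
    using twist_in_larger_tree[of S U i] twist_in_larger_tree[of T U j] U assms by auto
  moreover from this have "k = l" using addr_eq_iff assms(3) by metis
  ultimately show ?thesis by simp
qed

text \<open>An interior vertex of depth \<open>d\<close> forces \<open>d + 1\<close> carets, so
  \<open>w\<close> is not interior in \<open>T\<close>, and \<open>T\<close> can be enlarged until
  \<open>w\<close> is a leaf. The bound on carets passes to both halves in the induction.\<close>

lemma tree_with_leaf:
  "carets T \<le> length w \<Longrightarrow> \<exists>U j. nodes T \<subseteq> nodes U \<and> j < leaves U \<and> addr U j = w"
proof (induction w arbitrary: T)
  case Nil
  then show ?case by (intro exI[of _ Leaf] exI[of _ 0]) (cases T; simp)
next
  case (Cons b w)
  obtain l r where lr: "carets l \<le> length w" "carets r \<le> length w" "nodes T \<subseteq> nodes (Caret l r)"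
  proof (cases T)
    case Leaf
    then show ?thesis using that[of Leaf Leaf] by simp
  next
    case (Caret l r)
    then show ?thesis using that[of l r] Cons.prems by simp
  qed
  show ?case
  proof (cases b)
    case False
    obtain U j where "nodes l \<subseteq> nodes U" "j < leaves U" "addr U j = w" using Cons.IH lr by blast
    then have "nodes T \<subseteq> nodes (Caret U r) \<and> j < leaves (Caret U r) \<and> addr (Caret U r) j = b # w"
      using False order_trans[OF lr(3), of "nodes (Caret U r)"] by (simp add: nodes_subset_Caret del: nodes.simps)
    then show ?thesis by blast
  next
    case True
    obtain U j where "nodes r \<subseteq> nodes U" "j < leaves U" "addr U j = w" using Cons.IH lr by blast
    then have "nodes T \<subseteq> nodes (Caret l U) \<and> leaves l + j < leaves (Caret l U) \<and> addr (Caret l U) (leaves l + j) = b # w"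
      using True order_trans[OF lr(3), of "nodes (Caret l U)"] by (simp add: nodes_subset_Caret del: nodes.simps)
    then show ?thesis by blast
  qed
qed

definition twist_at :: "bool list \<Rightarrow> diagram set" where
  "twist_at w = (SOME x. \<exists>T j. j < leaves T \<and> addr T j = w \<and> x = twist T j)"

lemma twist_at_addr:
  assumes "j < leaves T"
  shows "twist_at (addr T j) = twist T j"
proof -
  have "\<exists>T' j'. j' < leaves T' \<and> addr T' j' = addr T j \<and> twist_at (addr T j) = twist T' j'"
    unfolding twist_at_def by (rule someI) (use assms in blast)
  then show ?thesis using twist_eq_if_addr_eq assms by metis
qed

lemma leaf_exists: obtains T j where "j < leaves T" "addr T j = w"
  using tree_with_leaf[of Leaf w] by auto

lemma twist_at_closed [simp]: "twist_at w \<in> carrier BV"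
  using leaf_exists[of w] twist_at_addr twist_closed by metis


section \<open>The defect\<close>

text \<open>The largest change of depth of a leaf: a subadditive function that bounds word lengths from
  below.\<close>

definition depth_change :: "diagram \<Rightarrow> nat \<Rightarrow> int" where
  "depth_change = (\<lambda>(S, \<beta>, T) i. \<bar>int (length (addr S i)) - int (length (addr T (braid_perm \<beta> i)))\<bar>)"

definition defect_le :: "nat \<Rightarrow> diagram \<Rightarrow> bool" where
  "defect_le m d \<longleftrightarrow> (\<forall>i<leaves (head_tree d). depth_change d i \<le> int m)"

text \<open>Equivalent diagrams satisfy the same bounds by \<open>defect_le_equiv\<close>, so any
  diagram of the class computes the value.\<close>

definition defect :: "diagram set \<Rightarrow> nat" where
  "defect x = (LEAST m. \<exists>d\<in>x. defect_le m d)"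

text \<open>Splitting a strand lowers both of its end leaves by one level, so the difference of
  depths is inherited by the two copies; this makes the defect invariant under equivalence.\<close>

lemma depth_change_split:
  assumes d: "(S, \<beta>, T) \<in> diagrams" and i: "i < leaves S" and k: "k \<le> leaves S"
  shows "depth_change (split_diagram i (S, \<beta>, T)) k = depth_change (S, \<beta>, T) (collapse i k)"
proof -
  have \<beta>: "carets T = carets S" "\<beta> \<in> carrier (braid_group (leaves S))" using diagramsD[OF d] by auto
  let ?\<pi> = "braid_perm \<beta>"
  have j: "?\<pi> i < leaves T" using braid_perm_less[OF \<beta>(2) i] \<beta>(1) by simp
  have c: "collapse i k < leaves S" using collapse_less[OF i] k by simp
  have inj: "?\<pi> (collapse i k) = ?\<pi> i \<Longrightarrow> collapse i k = i"
    using braid_perm_bij[OF \<beta>(2)] c i by (auto simp: bij_betw_def dest: inj_onD)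
  have p: "braid_perm (split_braid (leaves S) i \<beta>) k = split_perm i ?\<pi> k"
    using braid_perm_split[OF \<beta>(2) i] k by simp
  have cl: "?\<pi> (collapse i k) < leaves T" using braid_perm_less[OF \<beta>(2) c] \<beta>(1) by simp
  have 1: "length (addr (add_caret S i) k) =
      length (addr S (collapse i k)) + (if collapse i k = i then 1 else 0)"
    using addr_add_caret[OF i k] by (auto simp: collapse_def)
  have sl: "split_perm i ?\<pi> k \<le> leaves T" using cl by (auto simp: split_perm_def)
  have 2: "length (addr (add_caret T (?\<pi> i)) (split_perm i ?\<pi> k)) =
      length (addr T (?\<pi> (collapse i k))) + (if collapse i k = i then 1 else 0)"
    using addr_add_caret[OF j sl] inj by (auto simp: split_perm_def)
  show ?thesis by (simp add: split_diagram_def depth_change_def p 1 2)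
qed

lemma defect_le_split:
  assumes "d \<in> diagrams" "i < leaves (head_tree d)"
  shows "defect_le m (split_diagram i d) \<longleftrightarrow> defect_le m d"
proof -
  obtain S \<beta> T where d: "d = (S, \<beta>, T)" by (cases d)
  have i: "i < leaves S" using assms d by simp
  have dc: "depth_change (split_diagram i d) k = depth_change d (collapse i k)" if "k \<le> leaves S" for k
    using depth_change_split[of S \<beta> T i k] assms d that by simp
  have "(\<forall>k\<le>leaves S. depth_change d (collapse i k) \<le> int m) \<longleftrightarrow> (\<forall>k<leaves S. depth_change d k \<le> int m)"
  proof (intro iffI allI impI)
    fix k assume *: "\<forall>k\<le>leaves S. depth_change d (collapse i k) \<le> int m" "k < leaves S"
    show "depth_change d k \<le> int m"
    proof (cases "k \<le> i")
      case True
      then show ?thesis using *(1)[rule_format, of k] *(2) by (simp add: collapse_def)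
    next
      case False
      then show ?thesis using *(1)[rule_format, of "Suc k"] *(2) by (simp add: collapse_def)
    qed
  next
    fix k assume *: "\<forall>k<leaves S. depth_change d k \<le> int m" "k \<le> leaves S"
    show "depth_change d (collapse i k) \<le> int m"
      using *(1) collapse_less[OF i, of k] *(2) by simp
  qed
  then show ?thesis
    using dc by (simp add: defect_le_def d less_Suc_eq_le)
qed

lemma defect_le_expansion: "(d, e) \<in> splitting\<^sup>* \<Longrightarrow> defect_le m e \<longleftrightarrow> defect_le m d"
  by (induction rule: rtrancl_induct) (auto simp: splitting_iff defect_le_split)

lemma defect_le_equiv: "(d, e) \<in> diagram_equiv \<Longrightarrow> defect_le m e \<longleftrightarrow> defect_le m d"
  unfolding diagram_equiv_iff using defect_le_expansion by metis

lemma defect_le_exists: "\<exists>m. defect_le m d"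
proof -
  let ?A = "depth_change d ` {..<leaves (head_tree d)}"
  have "depth_change d i \<le> int (nat (Max ?A))" if "i < leaves (head_tree d)" for i
  proof -
    have "depth_change d i \<le> Max ?A" using that by (intro Max_ge) auto
    then show ?thesis by simp
  qed
  then show ?thesis unfolding defect_le_def by blast
qed

lemma defect_le_defect:
  assumes "d \<in> diagrams"
  shows "defect_le (defect (diagram_class d)) d"
proof -
  have "\<exists>m. \<exists>e\<in>diagram_class d. defect_le m e"
    using defect_le_exists[of d] diagram_class_self[OF assms] by blast
  then have "\<exists>e\<in>diagram_class d. defect_le (defect (diagram_class d)) e"
    unfolding defect_def by (rule LeastI_ex)
  then show ?thesis using defect_le_equiv by blast
qed

lemma defect_least: "d \<in> diagrams \<Longrightarrow> defect_le m d \<Longrightarrow> defect (diagram_class d) \<le> m"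
  unfolding defect_def using diagram_class_self by (intro Least_le) blast

lemma defect_mult:
  assumes "x \<in> carrier BV" "y \<in> carrier BV"
  shows "defect (x \<otimes>\<^bsub>BV\<^esub> y) \<le> defect x + defect y"
  using assms
proof (rule BV_mult_reps)
  fix R \<beta> S \<gamma> T
  assume *: "(R, \<beta>, S) \<in> diagrams" "(S, \<gamma>, T) \<in> diagrams" "x = diagram_class (R, \<beta>, S)" "y = diagram_class (S, \<gamma>, T)"
  have S: "leaves S = leaves R" and \<beta>: "\<beta> \<in> carrier (braid_group (leaves R))" and \<gamma>: "\<gamma> \<in> carrier (braid_group (leaves R))"
    using *(1,2) by (simp_all add: diagrams_iff)
  have "defect_le (defect x + defect y) (R, \<beta> \<otimes>\<^bsub>braid_group (leaves S)\<^esub> \<gamma>, T)"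
    unfolding defect_le_def
  proof (intro allI impI)
    fix i assume "i < leaves (head_tree (R, \<beta> \<otimes>\<^bsub>braid_group (leaves S)\<^esub> \<gamma>, T))"
    then have i: "i < leaves R" by simp
    have "depth_change (R, \<beta>, S) i \<le> int (defect x)"
      using defect_le_defect[OF *(1)] i *(3) by (simp add: defect_le_def)
    moreover have "depth_change (S, \<gamma>, T) (braid_perm \<beta> i) \<le> int (defect y)"
      using defect_le_defect[OF *(2)] braid_perm_less[OF \<beta> i] S *(4) by (simp add: defect_le_def)
    ultimately show "depth_change (R, \<beta> \<otimes>\<^bsub>braid_group (leaves S)\<^esub> \<gamma>, T) i \<le> int (defect x + defect y)"
      unfolding S using braid_perm_mult[OF \<beta> \<gamma> i] by (simp add: depth_change_def)
  qed
  then show ?thesis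
    unfolding *(3,4) BV_mult[OF *(1,2)] using defect_least[OF diagram_mult_closed[OF *(1,2)]] by simp
qed

lemma defect_one: "defect \<one>\<^bsub>BV\<^esub> = 0"
proof -
  have "defect_le 0 (Leaf, \<one>\<^bsub>braid_group (leaves Leaf)\<^esub>, Leaf)"
    by (simp add: defect_le_def depth_change_def)
  then have "defect (diagram_class (Leaf, \<one>\<^bsub>braid_group (leaves Leaf)\<^esub>, Leaf)) \<le> 0"
    by (rule defect_least[OF one_diagram[OF refl]])
  then show ?thesis unfolding F_elt_self[of Leaf, symmetric] F_elt_def by simp
qed

lemma defect_F_elt:
  assumes "carets S = carets T" "i < leaves S"
  shows "\<bar>int (length (addr S i)) - int (length (addr T i))\<bar> \<le> int (defect (F_elt S T))"
  using defect_le_defect[OF one_diagram[OF assms(1)], unfolded defect_le_def, rule_format, of i]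
    assms(2) braid_perm_one[OF assms(2)]
  by (simp add: F_elt_def depth_change_def)

text \<open>For negative \<open>z\<close> the first leaf of the right vine lies one level below leaf
  \<open>j\<close> of \<open>T\<close>, in agreement with \<open>nat z = 0\<close>.\<close>

lemma length_addr_vine:
  assumes "j < leaves T"
  shows "length (addr (vine T j z) j) = length (addr T j) + Suc (nat z)"
proof -
  have "length (addr (lvine T j k) j) = length (addr T j) + k" for k
    using assms by (induction k) (simp_all add: addr_add_caret)
  moreover have "length (addr (rvine T j (Suc k)) j) = length (addr T j) + 1" for k
    using assms by (induction k) (simp_all add: addr_add_caret)
  ultimately show ?thesis by (simp add: vine_def del: lvine.simps rvine.simps)
qed

lemma addr_vine_right:
  assumes "i < j" "j < leaves T"
  shows "addr (vine T i z) (j + Suc (nat \<bar>z\<bar>)) = addr T j"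
proof -
  have "addr (lvine T i k) (j + k) = addr T j" for k
    using assms by (induction k) (simp_all add: addr_add_caret)
  moreover have "addr (rvine T i k) (j + k) = addr T j" for k
    using assms by (induction k) (simp_all add: addr_add_caret)
  ultimately show ?thesis by (simp add: vine_def del: lvine.simps rvine.simps add_Suc_right)
qed

text \<open>Both bounds are read off from the diagram of \<open>twist_pow_mult\<close>: the first
  leaf below \<open>i\<close> changes its depth by \<open>\<bar>a\<bar>\<close>, and the first leaf
  below \<open>j\<close>, which has moved to number \<open>j + Suc (nat \<bar>a\<bar>)\<close>,
  changes its depth by \<open>\<bar>b\<bar>\<close>.\<close>

lemma defect_twists_less:
  assumes "i < j" "j < leaves T"
  shows "max \<bar>a\<bar> \<bar>b\<bar> \<le> int (defect (twist T i [^]\<^bsub>BV\<^esub> (a::int) \<otimes>\<^bsub>BV\<^esub> twist T j [^]\<^bsub>BV\<^esub> (b::int)))"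
proof -
  let ?S = "vine (vine T j b) i a" and ?T = "vine (vine T j (- b)) i (- a)"
  have "length (addr (vine T j b) i) = length (addr (vine T j (- b)) i)"
  proof -
    have "addr (lvine T j k) i = addr T i" for k
      using assms by (induction k) (simp_all add: addr_add_caret)
    moreover have "addr (rvine T j k) i = addr T i" for k
      using assms by (induction k) (simp_all add: addr_add_caret)
    ultimately show ?thesis by (simp add: vine_def del: lvine.simps rvine.simps)
  qed
  then have "\<bar>int (length (addr ?S i)) - int (length (addr ?T i))\<bar> = \<bar>a\<bar>"
    using assms by (cases "a \<ge> 0") (simp_all add: length_addr_vine)
  then have "\<bar>a\<bar> \<le> int (defect (F_elt ?S ?T))"
    using defect_F_elt[of ?S ?T i] assms by simp
  moreover have "\<bar>int (length (addr ?S (j + Suc (nat \<bar>a\<bar>)))) - int (length (addr ?T (j + Suc (nat \<bar>a\<bar>))))\<bar> = \<bar>b\<bar>"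
    using assms addr_vine_right[of i j "vine T j b" a] addr_vine_right[of i j "vine T j (- b)" "- a"]
    by (cases "b \<ge> 0") (simp_all add: length_addr_vine)
  then have "\<bar>b\<bar> \<le> int (defect (F_elt ?S ?T))"
    using defect_F_elt[of ?S ?T "j + Suc (nat \<bar>a\<bar>)"] assms by simp
  ultimately show ?thesis using twist_pow_mult[OF assms] by simp
qed

lemma defect_twists:
  assumes "i \<noteq> j" "i < leaves T" "j < leaves T"
  shows "max \<bar>a\<bar> \<bar>b\<bar> \<le> int (defect (twist T i [^]\<^bsub>BV\<^esub> (a::int) \<otimes>\<^bsub>BV\<^esub> twist T j [^]\<^bsub>BV\<^esub> (b::int)))"
proof (cases "i < j")
  case False
  have "twist T i [^]\<^bsub>BV\<^esub> a \<otimes>\<^bsub>BV\<^esub> twist T j [^]\<^bsub>BV\<^esub> b = twist T j [^]\<^bsub>BV\<^esub> b \<otimes>\<^bsub>BV\<^esub> twist T i [^]\<^bsub>BV\<^esub> a"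
    by (rule BV.int_pow_commute[OF twist_commute[OF assms]]) simp_all
  then show ?thesis using defect_twists_less[of j i T b a] False assms by (simp add: max.commute)
qed (use assms defect_twists_less in blast)


section \<open>Conjugates of twists\<close>

lemma twist_conj_addr:
  assumes "(S, \<beta>, T) \<in> diagrams" "i < leaves S"
  shows "diagram_class (S, \<beta>, T) \<otimes>\<^bsub>BV\<^esub> twist_at (addr T (braid_perm \<beta> i)) \<otimes>\<^bsub>BV\<^esub>
    inv\<^bsub>BV\<^esub> (diagram_class (S, \<beta>, T)) = twist_at (addr S i)"
proof -
  have "braid_perm \<beta> i < leaves T"
    using assms braid_perm_less[of \<beta> "leaves S" i] by (simp add: diagrams_iff)
  then have tw: "twist_at (addr T (braid_perm \<beta> i)) = twist T (braid_perm \<beta> i)" "twist_at (addr S i) = twist S i"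
    using assms(2) by (simp_all add: twist_at_addr)
  have "diagram_class (S, \<beta>, T) \<in> carrier BV" using assms(1) by (rule diagram_class_in_BV)
  then show ?thesis
    unfolding tw twist_conj[OF assms] by (simp add: BV.m_assoc)
qed

text \<open>For \<open>w\<close> deep enough, \<open>x\<close> has a diagram whose tail tree has the
  leaf \<open>w\<close>. The strand that arrives there starts at a leaf \<open>w'\<close>, and the
  two depths differ by at most the defect of \<open>x\<close>.\<close>

lemma conj_twist_bounded:
  assumes x: "x \<in> carrier BV"
  shows "\<exists>c. \<forall>w. c \<le> length w \<longrightarrow> (\<exists>w'. x \<otimes>\<^bsub>BV\<^esub> twist_at w \<otimes>\<^bsub>BV\<^esub> inv\<^bsub>BV\<^esub> x = twist_at w' \<and>
    length w \<le> length w' + c)"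
proof -
  obtain S \<beta> T where d: "(S, \<beta>, T) \<in> diagrams" "x = diagram_class (S, \<beta>, T)" using BV_cases[OF x] .
  have "\<exists>w'. x \<otimes>\<^bsub>BV\<^esub> twist_at w \<otimes>\<^bsub>BV\<^esub> inv\<^bsub>BV\<^esub> x = twist_at w' \<and> length w \<le> length w' + (carets T + defect x)"
    if w: "carets T + defect x \<le> length w" for w
  proof -
    obtain U j where U: "nodes T \<subseteq> nodes U" "j < leaves U" "addr U j = w"
      using tree_with_leaf[of T w] w by auto
    obtain e where e: "((S, \<beta>, T), e) \<in> splitting\<^sup>*" "tail_tree e = U"
      using expansion_tail_exists[OF d(1), of U] U(1) by auto
    obtain S' \<beta>' where e': "e = (S', \<beta>', U)" using e(2) by (cases e) simp
    have in_e: "(S', \<beta>', U) \<in> diagrams" using splitting_star_closed[OF e(1) d(1)] e' by simp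
    have xe: "x = diagram_class (S', \<beta>', U)" using diagram_class_expansion[OF d(1) e(1)] d(2) e' by simp
    have \<beta>': "carets U = carets S'" "\<beta>' \<in> carrier (braid_group (leaves S'))" using diagramsD[OF in_e] by auto
    have "j \<in> braid_perm \<beta>' ` {..<leaves S'}"
      using braid_perm_bij[OF \<beta>'(2)] U(2) \<beta>'(1) by (simp add: bij_betw_def)
    then obtain i where i: "i < leaves S'" "braid_perm \<beta>' i = j" by auto
    have "x \<otimes>\<^bsub>BV\<^esub> twist_at w \<otimes>\<^bsub>BV\<^esub> inv\<^bsub>BV\<^esub> x = twist_at (addr S' i)"
      using twist_conj_addr[OF in_e i(1)] unfolding i(2) U(3) xe[symmetric] .
    moreover have "depth_change (S', \<beta>', U) i \<le> int (defect x)"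
      using defect_le_defect[OF in_e] i(1) unfolding xe[symmetric] defect_le_def by simp
    then have "length w \<le> length (addr S' i) + (carets T + defect x)"
      using i(2) U(3) by (simp add: depth_change_def)
    ultimately show ?thesis by blast
  qed
  then show ?thesis by blast
qed

lemma twist_at_disjoint:
  assumes "b \<noteq> c"
  shows "twist_at [c] \<otimes>\<^bsub>BV\<^esub> twist_at (b # v) = twist_at (b # v) \<otimes>\<^bsub>BV\<^esub> twist_at [c]"
    and "max \<bar>r\<bar> \<bar>s\<bar> \<le> int (defect (twist_at (b # v) [^]\<^bsub>BV\<^esub> (r::int) \<otimes>\<^bsub>BV\<^esub> twist_at [c] [^]\<^bsub>BV\<^esub> (s::int)))"
proof -
  obtain T j where T: "j < leaves T" "addr T j = v" by (rule leaf_exists)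
  have "\<exists>U i k. i < leaves U \<and> k < leaves U \<and> i \<noteq> k \<and> addr U i = b # v \<and> addr U k = [c]"
  proof (cases c)
    case True
    then show ?thesis using T assms
      by (intro exI[of _ "Caret T Leaf"] exI[of _ j] exI[of _ "leaves T"]) auto
  next
    case False
    then show ?thesis using T assms
      by (intro exI[of _ "Caret Leaf T"] exI[of _ "Suc j"] exI[of _ 0]) auto
  qed
  then obtain U i k where U: "i < leaves U" "k < leaves U" "i \<noteq> k" "addr U i = b # v" "addr U k = [c]" by blast
  then have t: "twist_at (b # v) = twist U i" "twist_at [c] = twist U k"
    using twist_at_addr by metis+
  show "twist_at [c] \<otimes>\<^bsub>BV\<^esub> twist_at (b # v) = twist_at (b # v) \<otimes>\<^bsub>BV\<^esub> twist_at [c]"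
    unfolding t using twist_commute[OF U(3,1,2)] by simp
  show "max \<bar>r\<bar> \<bar>s\<bar> \<le> int (defect (twist_at (b # v) [^]\<^bsub>BV\<^esub> (r::int) \<otimes>\<^bsub>BV\<^esub> twist_at [c] [^]\<^bsub>BV\<^esub> (s::int)))"
    unfolding t by (rule defect_twists[OF U(3,1,2)])
qed

text \<open>An element of Thompson's group F that maps the subtree at address 1 to the one at address 11.\<close>

definition shift :: "diagram set" where
  "shift = F_elt (rvine Leaf 0 2) (lvine Leaf 0 2)"

lemma shift_closed [simp]: "shift \<in> carrier BV"
  by (simp add: shift_def F_elt_closed)

lemma addr_rvine: "j < leaves T \<Longrightarrow> addr (rvine T j k) (j + k) = addr T j @ replicate k True"
  by (induction k) (simp_all add: addr_add_caret replicate_append_same)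

lemma shift_conj:
  "shift \<otimes>\<^bsub>BV\<^esub> twist_at (replicate (Suc k) True) \<otimes>\<^bsub>BV\<^esub> inv\<^bsub>BV\<^esub> shift = twist_at (replicate (Suc (Suc k)) True)"
proof -
  \<comment> \<open>Leaf 2 has address 11 in the head tree and address 1 in the tail tree; hanging
    the same right vine below it in both trees yields the leaves of the claim.\<close>
  let ?S = "rvine (rvine Leaf 0 2) 2 k" and ?T = "rvine (lvine Leaf 0 2) 2 k"
  have "shift = F_elt ?S ?T" unfolding shift_def by (rule F_elt_rvine[symmetric]) simp_all
  then have x: "shift = diagram_class (?S, \<one>\<^bsub>braid_group (leaves ?S)\<^esub>, ?T)" by (simp only: F_elt_def)
  have d: "(?S, \<one>\<^bsub>braid_group (leaves ?S)\<^esub>, ?T) \<in> diagrams" by (rule one_diagram) simp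
  have i: "2 + k < leaves ?S" by simp
  have a: "addr ?S (2 + k) = replicate (Suc (Suc k)) True" "addr ?T (2 + k) = replicate (Suc k) True"
    by (subst addr_rvine; simp add: numeral_2_eq_2)+
  show ?thesis
    using twist_conj_addr[OF d i] unfolding braid_perm_one[OF i] a x .
qed

lemma shift_pow_conj:
  "shift [^]\<^bsub>BV\<^esub> k \<otimes>\<^bsub>BV\<^esub> twist_at [True] \<otimes>\<^bsub>BV\<^esub> inv\<^bsub>BV\<^esub> (shift [^]\<^bsub>BV\<^esub> k) = twist_at (replicate (Suc k) True)"
  for k :: nat
proof (induction k)
  case (Suc k)
  have p: "shift [^]\<^bsub>BV\<^esub> Suc k = shift \<otimes>\<^bsub>BV\<^esub> shift [^]\<^bsub>BV\<^esub> k"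
    by (rule BV.nat_pow_Suc2) simp
  have "shift [^]\<^bsub>BV\<^esub> Suc k \<otimes>\<^bsub>BV\<^esub> twist_at [True] \<otimes>\<^bsub>BV\<^esub> inv\<^bsub>BV\<^esub> (shift [^]\<^bsub>BV\<^esub> Suc k) =
     shift \<otimes>\<^bsub>BV\<^esub> (shift [^]\<^bsub>BV\<^esub> k \<otimes>\<^bsub>BV\<^esub> twist_at [True] \<otimes>\<^bsub>BV\<^esub> inv\<^bsub>BV\<^esub> (shift [^]\<^bsub>BV\<^esub> k)) \<otimes>\<^bsub>BV\<^esub> inv\<^bsub>BV\<^esub> shift"
    unfolding p by (simp add: BV.m_assoc BV.inv_mult_group)
  then show ?case unfolding Suc.IH shift_conj .
qed simp

text \<open>One constant, the sum over all letters, replaces the bounds of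
  \<open>conj_twist_bounded\<close>; a word is then treated letter by letter.\<close>

lemma conj_twist_linear:
  assumes "finite X" "generates BV X"
  shows "\<exists>C. \<forall>g\<in>carrier BV. \<forall>w. C * cayley_dist BV X \<one>\<^bsub>BV\<^esub> g \<le> length w \<longrightarrow>
    (\<exists>w'. g \<otimes>\<^bsub>BV\<^esub> twist_at w \<otimes>\<^bsub>BV\<^esub> inv\<^bsub>BV\<^esub> g = twist_at w' \<and>
       length w \<le> length w' + C * cayley_dist BV X \<one>\<^bsub>BV\<^esub> g)"
proof -
  interpret cayley_graph BV X by unfold_locales (rule assms(2))
  have fin: "finite letters" using assms(1) by (simp add: letters_def)
  obtain c where c: "\<And>x w. \<lbrakk>x \<in> carrier BV; c x \<le> length w\<rbrakk> \<Longrightarrow>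
    \<exists>w'. x \<otimes>\<^bsub>BV\<^esub> twist_at w \<otimes>\<^bsub>BV\<^esub> inv\<^bsub>BV\<^esub> x = twist_at w' \<and> length w \<le> length w' + c x"
    using conj_twist_bounded by metis
  define C where "C = (\<Sum>x\<in>letters. c x)"
  have cC: "c x \<le> C" if "x \<in> letters" for x
    using member_le_sum[OF that _ fin, of c] by (simp add: C_def)
  have word: "\<exists>w'. word_prod ws \<otimes>\<^bsub>BV\<^esub> twist_at w \<otimes>\<^bsub>BV\<^esub> inv\<^bsub>BV\<^esub> (word_prod ws) = twist_at w' \<and>
      length w \<le> length w' + C * length ws" if "set ws \<subseteq> letters" "C * length ws \<le> length w" for ws w
    using that
  proof (induction ws)
    case Nil
    then show ?case by auto
  next
    case (Cons a ws)
    have a: "a \<in> letters" "a \<in> carrier BV" and ws: "set ws \<subseteq> letters" using Cons.prems(1) letters_sub by auto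
    obtain w1 where w1: "word_prod ws \<otimes>\<^bsub>BV\<^esub> twist_at w \<otimes>\<^bsub>BV\<^esub> inv\<^bsub>BV\<^esub> (word_prod ws) = twist_at w1"
      "length w \<le> length w1 + C * length ws"
      using Cons.IH[OF ws] Cons.prems(2) by auto
    \<comment> \<open>The letters act from last to first; the depth left over by \<open>ws\<close>
      still suffices for the letter \<open>a\<close>.\<close>
    have "c a \<le> length w1" using w1(2) Cons.prems(2) cC[OF a(1)] by simp
    then obtain w2 where w2: "a \<otimes>\<^bsub>BV\<^esub> twist_at w1 \<otimes>\<^bsub>BV\<^esub> inv\<^bsub>BV\<^esub> a = twist_at w2" "length w1 \<le> length w2 + c a"
      using c[OF a(2)] by blast
    have "word_prod (a # ws) \<otimes>\<^bsub>BV\<^esub> twist_at w \<otimes>\<^bsub>BV\<^esub> inv\<^bsub>BV\<^esub> (word_prod (a # ws)) =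
        a \<otimes>\<^bsub>BV\<^esub> (word_prod ws \<otimes>\<^bsub>BV\<^esub> twist_at w \<otimes>\<^bsub>BV\<^esub> inv\<^bsub>BV\<^esub> (word_prod ws)) \<otimes>\<^bsub>BV\<^esub> inv\<^bsub>BV\<^esub> a"
      using a ws by (simp add: BV.m_assoc BV.inv_mult_group)
    then have "word_prod (a # ws) \<otimes>\<^bsub>BV\<^esub> twist_at w \<otimes>\<^bsub>BV\<^esub> inv\<^bsub>BV\<^esub> (word_prod (a # ws)) = twist_at w2"
      unfolding w1(1) w2(1) .
    moreover have "length w \<le> length w2 + C * length (a # ws)"
      using w1(2) w2(2) cC[OF a(1)] by simp
    ultimately show ?case by blast
  qed
  show ?thesis
  proof (intro exI[of _ C] ballI allI impI)
    fix g and w :: "bool list" assume g: "g \<in> carrier BV" "C * cayley_dist BV X \<one>\<^bsub>BV\<^esub> g \<le> length w"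
    obtain ws where "set ws \<subseteq> letters" "word_prod ws = g" "length ws = cayley_dist BV X \<one>\<^bsub>BV\<^esub> g"
      using geodesic_word[OF g(1)] .
    then show "\<exists>w'. g \<otimes>\<^bsub>BV\<^esub> twist_at w \<otimes>\<^bsub>BV\<^esub> inv\<^bsub>BV\<^esub> g = twist_at w' \<and>
       length w \<le> length w' + C * cayley_dist BV X \<one>\<^bsub>BV\<^esub> g"
      using word[of ws w] g(2) by simp
  qed
qed

lemma linear_divergence_BV:
  assumes "finite X" "generates BV X"
  shows "linear_divergence BV X defect (twist_at [False]) (twist_at [True]) shift"
proof -
  interpret cayley_graph BV X by unfold_locales (rule assms(2))
  obtain C where C: "\<And>g w. \<lbrakk>g \<in> carrier BV; C * cayley_dist BV X \<one>\<^bsub>BV\<^esub> g \<le> length w\<rbrakk> \<Longrightarrow>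
    \<exists>w'. g \<otimes>\<^bsub>BV\<^esub> twist_at w \<otimes>\<^bsub>BV\<^esub> inv\<^bsub>BV\<^esub> g = twist_at w' \<and>
       length w \<le> length w' + C * cayley_dist BV X \<one>\<^bsub>BV\<^esub> g"
    using conj_twist_linear[OF assms] by blast
  have conj: "\<exists>s\<in>{twist_at [False], twist_at [True]}.
      s \<otimes>\<^bsub>BV\<^esub> (g \<otimes>\<^bsub>BV\<^esub> twist_at (replicate (Suc k) True) \<otimes>\<^bsub>BV\<^esub> inv\<^bsub>BV\<^esub> g) =
        g \<otimes>\<^bsub>BV\<^esub> twist_at (replicate (Suc k) True) \<otimes>\<^bsub>BV\<^esub> inv\<^bsub>BV\<^esub> g \<otimes>\<^bsub>BV\<^esub> s \<and>
      (\<forall>(a::int) (b::int). max \<bar>a\<bar> \<bar>b\<bar> \<le>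
        int (defect ((g \<otimes>\<^bsub>BV\<^esub> twist_at (replicate (Suc k) True) \<otimes>\<^bsub>BV\<^esub> inv\<^bsub>BV\<^esub> g) [^]\<^bsub>BV\<^esub> a \<otimes>\<^bsub>BV\<^esub> s [^]\<^bsub>BV\<^esub> b)))"
    if g: "g \<in> carrier BV" "C * cayley_dist BV X \<one>\<^bsub>BV\<^esub> g \<le> k" for g k
  proof -
    obtain w' where w': "g \<otimes>\<^bsub>BV\<^esub> twist_at (replicate (Suc k) True) \<otimes>\<^bsub>BV\<^esub> inv\<^bsub>BV\<^esub> g = twist_at w'"
      "length (replicate (Suc k) True) \<le> length w' + C * cayley_dist BV X \<one>\<^bsub>BV\<^esub> g"
      using C[OF g(1), of "replicate (Suc k) True"] g(2) by auto
    \<comment> \<open>The address has lost at most \<open>k\<close> of its \<open>k + 1\<close>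
      steps and is not the root. Its first step \<open>b\<close> tells the half in which it lies,
      and the twist in the other half commutes with it.\<close>
    then obtain b v where "w' = b # v" using g(2) by (cases w') auto
    then have "twist_at [\<not> b] \<otimes>\<^bsub>BV\<^esub> twist_at w' = twist_at w' \<otimes>\<^bsub>BV\<^esub> twist_at [\<not> b] \<and>
      (\<forall>(r::int) (s::int). max \<bar>r\<bar> \<bar>s\<bar> \<le>
        int (defect (twist_at w' [^]\<^bsub>BV\<^esub> r \<otimes>\<^bsub>BV\<^esub> twist_at [\<not> b] [^]\<^bsub>BV\<^esub> s)))"
      using twist_at_disjoint[where b = b and c = "\<not> b" and v = v] by blast
    moreover have "twist_at [\<not> b] \<in> {twist_at [False], twist_at [True]}"
      by (cases b) simp_all
    ultimately show ?thesis unfolding w'(1) by (rule bexI)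
  qed
  show ?thesis
  proof (unfold_locales, unfold shift_pow_conj)
    show "\<exists>C. \<forall>g\<in>carrier BV. \<forall>k\<ge>C * cayley_dist BV X \<one>\<^bsub>BV\<^esub> g. \<exists>s\<in>{twist_at [False], twist_at [True]}.
      s \<otimes>\<^bsub>BV\<^esub> (g \<otimes>\<^bsub>BV\<^esub> twist_at (replicate (Suc k) True) \<otimes>\<^bsub>BV\<^esub> inv\<^bsub>BV\<^esub> g) =
        g \<otimes>\<^bsub>BV\<^esub> twist_at (replicate (Suc k) True) \<otimes>\<^bsub>BV\<^esub> inv\<^bsub>BV\<^esub> g \<otimes>\<^bsub>BV\<^esub> s \<and>
      (\<forall>(a::int) (b::int). max \<bar>a\<bar> \<bar>b\<bar> \<le>
        int (defect ((g \<otimes>\<^bsub>BV\<^esub> twist_at (replicate (Suc k) True) \<otimes>\<^bsub>BV\<^esub> inv\<^bsub>BV\<^esub> g) [^]\<^bsub>BV\<^esub> a \<otimes>\<^bsub>BV\<^esub> s [^]\<^bsub>BV\<^esub> b)))"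
      by (rule exI[of _ C]) (intro ballI allI impI conj)
    show "twist_at [False] \<otimes>\<^bsub>BV\<^esub> twist_at (replicate (Suc k) True) =
        twist_at (replicate (Suc k) True) \<otimes>\<^bsub>BV\<^esub> twist_at [False]" for k
      using twist_at_disjoint(1)[where b = True and c = False and v = "replicate k True"] by simp
    show "max \<bar>a\<bar> \<bar>b\<bar> \<le> int (defect (twist_at (replicate (Suc k) True) [^]\<^bsub>BV\<^esub> a \<otimes>\<^bsub>BV\<^esub> twist_at [False] [^]\<^bsub>BV\<^esub> b))"
      for k and a b :: int
      using twist_at_disjoint(2)[where b = True and c = False and v = "replicate k True"] by simp
  qed (use assms(1) defect_one defect_mult in auto)
qed

theorem theorem1p1:
  shows "\<exists>\<delta>::real. 0 < \<delta> \<and> \<delta> < 1 \<and>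
           (\<forall>X. finite X \<and> generates BV X \<longrightarrow>
                (\<exists>a>0. div_equiv (divergence BV X \<delta>) (\<lambda>x. ennreal (a * x))))"
proof (rule exI[of _ "1 / 4"], safe)
  fix X :: "diagram set set"
  assume "finite X" "generates BV X"
  then interpret linear_divergence BV X defect "twist_at [False]" "twist_at [True]" shift
    by (rule linear_divergence_BV)
  show "\<exists>a>0. div_equiv (divergence BV X (1 / 4)) (\<lambda>x. ennreal (a * x))"
    using divergence_equiv_linear by (intro exI[of _ 1]) simp
qed simp_all

end
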